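(* Let $k,l$ be natural numbers, let $\alpha,\beta\ge 0$ be real numbers, and let $\sigma,\tau$ be non-zero complex numbers such that the quadruple $(k,l,\sigma,\tau)$ is elliptic. Then $\mathrm{BE}(k,l,\alpha,\beta,\sigma,\tau)$ holds if and only if all of the following hold: at least one of the numbers $k$ and $l$ is odd, $\alpha=\frac{k-1}{2}$, $\beta=\frac{l-1}{2}$, and the numbers $\sigma_1$ and $\tau_1$ have non-zero imaginary parts of the same sign.
   Context: The Fourier transform is $\hat\varphi(\xi,\eta)=\int_{\mathbb{R}^2}\varphi(x,y)e^{-2\pi i(x\xi+y\eta)}\,dx\,dy$. For real $\alpha,\beta\ge0$ and Schwartz functions $f,g$ on $\mathbb{R}^2$ set $\langle f,g\rangle_{W_2^{\alpha,\beta}}=\int_{\mathbb{R}^2}\hat f(\xi,\eta)\overline{\hat g(\xi,\eta)}|\xi|^{2\alpha}|\eta|^{2\beta}\,d\xi\,d\eta$. For natural $k,l$, real $\alpha,\beta\ge0$ and non-zero complex $\sigma,\tau$, the statement $\mathrm{BE}(k,l,\alpha,\beta,\sigma,\tau)$ means: there is a constant $C$ such that for all Schwartz functions $f,g$ on $\mathbb{R}^2$, $\left|\langle f,g\rangle_{W_2^{\alpha,\beta}}\right|\le C\,\|(\partial_1^k-\tau\partial_2^l)f\|_{L_1(\mathbb{R}^2)}\,\|(\partial_1^k-\sigma\partial_2^l)g\|_{L_1(\mathbb{R}^2)}$, where $\partial_j$ is differentiation in the $j$-th variable. Put $\tau_1=(2\pi i)^{l-k}\tau$ and $\sigma_1=(-1)^{l-k}(2\pi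 i)^{l-k}\overline{\sigma}$. The quadruple $(k,l,\sigma,\tau)$ is called elliptic if neither of the polynomials $\xi^k-\sigma_1\eta^l$ and $\xi^k-\tau_1\eta^l$ has a real zero $(\xi,\eta)\in\mathbb{R}^2$ other than $(0,0)$. *)

theory Defs
  imports "HOL-Analysis.Analysis"
begin

type_synonym fun2 = "real \<times> real \<Rightarrow> complex"

definition pd1 :: "fun2 \<Rightarrow> fun2" where
  "pd1 f = (\<lambda>(x, y). vector_derivative (\<lambda>t. f (t, y)) (at x))"

definition pd2 :: "fun2 \<Rightarrow> fun2" where
  "pd2 f = (\<lambda>(x, y). vector_derivative (\<lambda>t. f (x, t)) (at y))"

fun dops :: "bool list \<Rightarrow> fun2 \<Rightarrow> fun2" where
  "dops [] f = f"
| "dops (b # bs) f = (if b then pd1 else pd2) (dops bs f)"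

text \<open>Schwartz class on R^2: all iterated partial derivatives are (Frechet)
  differentiable everywhere (hence f is C-infinity), and every derivative decays faster
  than any power.\<close>
definition schwartz :: "fun2 \<Rightarrow> bool" where
  "schwartz f \<longleftrightarrow>
     (\<forall>ds z. dops ds f differentiable (at z)) \<and>
     (\<forall>ds (N::nat). \<exists>C. \<forall>z. (1 + norm z) ^ N * norm (dops ds f z) \<le> C)"

definition fourier2 :: "fun2 \<Rightarrow> fun2" where
  "fourier2 \<phi> = (\<lambda>(\<xi>, \<eta>). integral\<^sup>L lborel
      (\<lambda>(x, y). \<phi> (x, y) * exp (- 2 * pi * \<i> * complex_of_real (x * \<xi> + y * \<eta>))))"

text \<open>Weight |t|^(2a), with the convention |0|^0 = 1 (irrelevant a.e.).\<close>
definition wpow :: "real \<Rightarrow> real \<Rightarrow> real" where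
  "wpow t a = (if a = 0 then 1 else \<bar>t\<bar> powr (2 * a))"

definition W2_inner :: "real \<Rightarrow> real \<Rightarrow> fun2 \<Rightarrow> fun2 \<Rightarrow> complex" where
  "W2_inner \<alpha> \<beta> f g = integral\<^sup>L lborel
      (\<lambda>(\<xi>, \<eta>). fourier2 f (\<xi>, \<eta>) * cnj (fourier2 g (\<xi>, \<eta>))
                   * complex_of_real (wpow \<xi> \<alpha> * wpow \<eta> \<beta>))"

definition L1norm :: "fun2 \<Rightarrow> real" where
  "L1norm f = integral\<^sup>L lborel (\<lambda>z. norm (f z))"

definition Lop :: "nat \<Rightarrow> nat \<Rightarrow> complex \<Rightarrow> fun2 \<Rightarrow> fun2" where
  "Lop k l c f = (\<lambda>z. (pd1 ^^ k) f z - c * (pd2 ^^ l) f z)"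

definition BE :: "nat \<Rightarrow> nat \<Rightarrow> real \<Rightarrow> real \<Rightarrow> complex \<Rightarrow> complex \<Rightarrow> bool" where
  "BE k l \<alpha> \<beta> \<sigma> \<tau> \<longleftrightarrow>
     (\<exists>C. \<forall>f g. schwartz f \<longrightarrow> schwartz g \<longrightarrow>
        norm (W2_inner \<alpha> \<beta> f g) \<le> C * L1norm (Lop k l \<tau> f) * L1norm (Lop k l \<sigma> g))"

definition tau1 :: "nat \<Rightarrow> nat \<Rightarrow> complex \<Rightarrow> complex" where
  "tau1 k l \<tau> = (2 * pi * \<i>) powi (int l - int k) * \<tau>"

definition sigma1 :: "nat \<Rightarrow> nat \<Rightarrow> complex \<Rightarrow> complex" where
  "sigma1 k l \<sigma> = (-1) powi (int l - int k) * (2 * pi * \<i>) powi (int l - int k) * cnj \<sigma>"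

definition elliptic :: "nat \<Rightarrow> nat \<Rightarrow> complex \<Rightarrow> complex \<Rightarrow> bool" where
  "elliptic k l \<sigma> \<tau> \<longleftrightarrow>
     (\<forall>\<xi> \<eta> :: real. (\<xi>, \<eta>) \<noteq> (0, 0) \<longrightarrow>
        complex_of_real \<xi> ^ k - sigma1 k l \<sigma> * complex_of_real \<eta> ^ l \<noteq> 0 \<and>
        complex_of_real \<xi> ^ k - tau1 k l \<tau> * complex_of_real \<eta> ^ l \<noteq> 0)"

end

theory Submission
  imports Defs "HOL-Probability.Sinc_Integral" "HOL-Probability.Characteristic_Functions"
begin

text \<open>
  On the Fourier side the form pairs the Fourier transforms of the two differential expressions with the
  multiplier \<open>m = |\<xi>|^(2 \<alpha>) |\<eta>|^(2 \<beta>) / ((\<xi>^k - \<tau>\<^sub>1 \<eta>^l) (\<xi>^k - \<sigma>\<^sub>1 \<eta>^l))\<close>, which is anisotropically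
  homogeneous, so the estimate amounts to boundedness of the Fourier transform of \<open>m\<close>. Dilating a test
  function shows that \<open>m\<close> must have the critical degree, at which its Fourier transform has degree \<open>0\<close>. If
  the transforms of both expressions are close to \<open>1\<close> on a long range of scales, the form is the average
  of \<open>m\<close> over the unit curve times a factor that tends to infinity with the range, so this average must
  vanish. Conversely, when \<open>\<alpha> = (k - 1) / 2\<close> and \<open>\<beta> = (l - 1) / 2\<close>, its vanishing bounds the Fourier
  transforms of the truncations of \<open>m\<close> uniformly. The average is a combination of the integrals of
  \<open>s^(2 \<alpha>) / ((s^k + z) (s^k + w))\<close> over the half-line, which are divided differences of \<open>z^p\<close> (of the
  logarithm if \<open>p = 0\<close>) for \<open>p = (2 \<alpha> + 1) / k - 1\<close>; comparing arguments of these powers shows when it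
  vanishes.
\<close>

subsection \<open>Schwartz functions\<close>

text \<open>At the critical degree the multiplier is integrable neither at the origin nor at
  infinity: along the dilation orbits its integral is that of \<open>dt / t\<close> times the
  integral over the unit curve. This one logarithm governs both directions. In the necessity part it
  is the factor that tends to infinity; in the sufficiency part it is the reason why only
  truncations have a Fourier transform as functions, with bounds that must not depend on the
  truncation. The unit curve is replaced by the two lines \<open>y = 1\<close> and
  \<open>y = - 1\<close>, which meet every dilation orbit off the first axis once. All averages then
  become integrals of rational functions of \<open>s ^ k\<close>, up to a power of \<open>s\<close>,
  over half-lines. Test functions must be Schwartz although the symbols they have to cancel vanish
  at the origin. They are therefore built from functions of one polynomial \<open>Q\<close> that is
  divisible by both symbols, so no symbol is ever divided out at its zero. The critical degree alone
  leaves a one-parameter family of exponents. The explicit value of the average excludes all of them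
  but one.\<close>

definition rapid :: "fun2 \<Rightarrow> bool" where
  "rapid f \<longleftrightarrow> (\<forall>N::nat. \<exists>C. \<forall>z. (1 + norm z) ^ N * norm (f z) \<le> C)"

lemma rapidD:
  assumes "rapid f"
  obtains C where "C \<ge> 0" "\<And>z. (1 + norm z) ^ N * norm (f z) \<le> C"
proof -
  obtain C where C: "\<And>z. (1 + norm z) ^ N * norm (f z) \<le> C"
    using assms unfolding rapid_def by metis
  have "0 \<le> C" using C[of 0] by (smt (verit) norm_ge_zero mult_nonneg_nonneg zero_le_power)
  then show ?thesis using C that by blast
qed

lemma pd1_eq:
  assumes "(f has_derivative D) (at (x, y))"
  shows "pd1 f (x, y) = D (1, 0)"
proof -
  have "((\<lambda>t. (t, y)) has_derivative (\<lambda>h. (h, 0))) (at x)"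
    by (auto intro!: derivative_eq_intros)
  then have "((\<lambda>t. f (t, y)) has_derivative (\<lambda>h. D (h, 0))) (at x)"
    using has_derivative_compose[of "\<lambda>t. (t, y)" "\<lambda>h. (h, 0)" x UNIV f D] assms by auto
  moreover have "(\<lambda>h. D (h, 0)) = (\<lambda>h. h *\<^sub>R D (1, 0))"
  proof
    fix h
    show "D (h, 0) = h *\<^sub>R D (1, 0)"
      using linear_scale[OF has_derivative_linear[OF assms], of h "(1, 0)"] by simp
  qed
  ultimately have "((\<lambda>t. f (t, y)) has_vector_derivative D (1, 0)) (at x)"
    unfolding has_vector_derivative_def by simp
  then show ?thesis by (simp add: pd1_def vector_derivative_at)
qed

lemma pd2_eq:
  assumes "(f has_derivative D) (at (x, y))"
  shows "pd2 f (x, y) = D (0, 1)"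
proof -
  have "((\<lambda>t. (x, t)) has_derivative (\<lambda>h. (0, h))) (at y)"
    by (auto intro!: derivative_eq_intros)
  then have "((\<lambda>t. f (x, t)) has_derivative (\<lambda>h. D (0, h))) (at y)"
    using has_derivative_compose[of "\<lambda>t. (x, t)" "\<lambda>h. (0, h)" y UNIV f D] assms by auto
  moreover have "(\<lambda>h. D (0, h)) = (\<lambda>h. h *\<^sub>R D (0, 1))"
  proof
    fix h
    show "D (0, h) = h *\<^sub>R D (0, 1)"
      using linear_scale[OF has_derivative_linear[OF assms], of h "(0, 1)"] by simp
  qed
  ultimately have "((\<lambda>t. f (x, t)) has_vector_derivative D (0, 1)) (at y)"
    unfolding has_vector_derivative_def by simp
  then show ?thesis by (simp add: pd2_def vector_derivative_at)
qed

lemma pd1_has_vector_derivative: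
  assumes "f differentiable (at (x, y))"
  shows "((\<lambda>t. f (t, y)) has_vector_derivative pd1 f (x, y)) (at x)"
proof -
  obtain D where D: "(f has_derivative D) (at (x, y))"
    using assms by (meson differentiable_def)
  have "((\<lambda>t. (t, y)) has_derivative (\<lambda>h. (h, 0))) (at x)"
    by (auto intro!: derivative_eq_intros)
  from has_derivative_compose[OF this, of f D] D
  have "(\<lambda>t. f (t, y)) differentiable (at x)"
    by (auto intro: differentiableI)
  then show ?thesis by (simp add: pd1_def vector_derivative_works)
qed

lemma pd2_has_vector_derivative:
  assumes "f differentiable (at (x, y))"
  shows "((\<lambda>t. f (x, t)) has_vector_derivative pd2 f (x, y)) (at y)"
proof -
  obtain D where D: "(f has_derivative D) (at (x, y))"
    using assms by (meson differentiable_def)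
  have "((\<lambda>t. (x, t)) has_derivative (\<lambda>h. (0, h))) (at y)"
    by (auto intro!: derivative_eq_intros)
  from has_derivative_compose[OF this, of f D] D
  have "(\<lambda>t. f (x, t)) differentiable (at y)"
    by (auto intro: differentiableI)
  then show ?thesis by (simp add: pd2_def vector_derivative_works)
qed

lemma pd_add:
  assumes "\<And>z. f differentiable (at z)" "\<And>z. g differentiable (at z)"
  shows "pd1 (\<lambda>z. f z + g z) = (\<lambda>z. pd1 f z + pd1 g z)"
    and "pd2 (\<lambda>z. f z + g z) = (\<lambda>z. pd2 f z + pd2 g z)"
proof -
  have "pd1 (\<lambda>z. f z + g z) (x, y) = pd1 f (x, y) + pd1 g (x, y) \<and>
        pd2 (\<lambda>z. f z + g z) (x, y) = pd2 f (x, y) + pd2 g (x, y)" for x y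
  proof -
    obtain D E where "(f has_derivative D) (at (x, y))" "(g has_derivative E) (at (x, y))"
      using assms by (meson differentiable_def)
    note d = this has_derivative_add[OF this]
    show ?thesis using d(1,2) by (simp add: pd1_eq pd2_eq pd1_eq[OF d(3)] pd2_eq[OF d(3)])
  qed
  then show "pd1 (\<lambda>z. f z + g z) = (\<lambda>z. pd1 f z + pd1 g z)"
    and "pd2 (\<lambda>z. f z + g z) = (\<lambda>z. pd2 f z + pd2 g z)" by auto
qed

lemma pd_mult:
  fixes f g :: fun2
  assumes "\<And>z. f differentiable (at z)" "\<And>z. g differentiable (at z)"
  shows "pd1 (\<lambda>z. f z * g z) = (\<lambda>z. f z * pd1 g z + pd1 f z * g z)"
    and "pd2 (\<lambda>z. f z * g z) = (\<lambda>z. f z * pd2 g z + pd2 f z * g z)"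
proof -
  have "pd1 (\<lambda>z. f z * g z) (x, y) = f (x, y) * pd1 g (x, y) + pd1 f (x, y) * g (x, y) \<and>
        pd2 (\<lambda>z. f z * g z) (x, y) = f (x, y) * pd2 g (x, y) + pd2 f (x, y) * g (x, y)" for x y
  proof -
    obtain D E where "(f has_derivative D) (at (x, y))" "(g has_derivative E) (at (x, y))"
      using assms by (meson differentiable_def)
    note d = this has_derivative_mult[OF this]
    show ?thesis using d(1,2) by (simp add: pd1_eq pd2_eq pd1_eq[OF d(3)] pd2_eq[OF d(3)])
  qed
  then show "pd1 (\<lambda>z. f z * g z) = (\<lambda>z. f z * pd1 g z + pd1 f z * g z)"
    and "pd2 (\<lambda>z. f z * g z) = (\<lambda>z. f z * pd2 g z + pd2 f z * g z)" by auto
qed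

lemma dops_append: "dops (xs @ ys) f = dops xs (dops ys f)"
  by (induction xs) auto

text \<open>A coinduction principle: instead of computing iterated derivatives, later proofs exhibit
  a class of functions that both partial derivatives map to itself.\<close>

lemma schwartz_coinduct:
  assumes "f \<in> X"
    and X: "\<And>f. f \<in> X \<Longrightarrow> (\<forall>z. f differentiable (at z)) \<and> rapid f \<and> pd1 f \<in> X \<and> pd2 f \<in> X"
  shows "schwartz f"
proof -
  have "dops ds f \<in> X" for ds
    by (induction ds) (use assms in auto)
  then show ?thesis using X unfolding schwartz_def rapid_def by blast
qed

lemma schwartz_differentiable: "schwartz f \<Longrightarrow> f differentiable (at z)"
  unfolding schwartz_def by (metis dops.simps(1))

lemma schwartz_rapid: "schwartz f \<Longrightarrow> rapid f"
  unfolding schwartz_def rapid_def by (metis dops.simps(1))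

lemma schwartz_pd1:
  assumes "schwartz f"
  shows "schwartz (pd1 f)"
proof -
  have "dops ds (pd1 f) = dops (ds @ [True]) f" for ds
    by (simp add: dops_append)
  then show ?thesis using assms by (simp add: schwartz_def)
qed

lemma schwartz_pd2:
  assumes "schwartz f"
  shows "schwartz (pd2 f)"
proof -
  have "dops ds (pd2 f) = dops (ds @ [False]) f" for ds
    by (simp add: dops_append)
  then show ?thesis using assms by (simp add: schwartz_def)
qed

lemma schwartz_continuous: "schwartz f \<Longrightarrow> continuous_on A f"
  by (meson schwartz_differentiable differentiable_imp_continuous_within continuous_at_imp_continuous_on)

lemma schwartz_borel [measurable_dest]: "schwartz f \<Longrightarrow> f \<in> borel_measurable borel"
  by (simp add: borel_measurable_continuous_onI schwartz_continuous)

section \<open>Polynomials and modules over them\<close>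

inductive_set poly2 :: "fun2 set" where
  const: "(\<lambda>z. c) \<in> poly2"
| fst: "(\<lambda>z. of_real (fst z)) \<in> poly2"
| snd: "(\<lambda>z. of_real (snd z)) \<in> poly2"
| add: "p \<in> poly2 \<Longrightarrow> q \<in> poly2 \<Longrightarrow> (\<lambda>z. p z + q z) \<in> poly2"
| mult: "p \<in> poly2 \<Longrightarrow> q \<in> poly2 \<Longrightarrow> (\<lambda>z. p z * q z) \<in> poly2"

lemma poly2_power: "p \<in> poly2 \<Longrightarrow> (\<lambda>z. p z ^ n) \<in> poly2"
  by (induction n) (auto intro: poly2.intros)

lemma poly2_uminus: "p \<in> poly2 \<Longrightarrow> (\<lambda>z. - p z) \<in> poly2"
  using poly2.mult[OF poly2.const[of "-1"]] by simp

lemma poly2_diff: "p \<in> poly2 \<Longrightarrow> q \<in> poly2 \<Longrightarrow> (\<lambda>z. p z - q z) \<in> poly2"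
  using poly2.add[OF _ poly2_uminus] by fastforce

lemma poly2_cnj: "p \<in> poly2 \<Longrightarrow> (\<lambda>z. cnj (p z)) \<in> poly2"
  by (induction rule: poly2.induct) (auto intro: poly2.intros)

lemma poly2_differentiable: "p \<in> poly2 \<Longrightarrow> p differentiable (at z)"
proof (induction rule: poly2.induct)
  case fst
  have "((\<lambda>z. complex_of_real (fst z)) has_derivative (\<lambda>h. of_real (fst h))) (at z)"
    by (auto intro!: derivative_eq_intros)
  then show ?case by (meson differentiable_def)
next
  case snd
  have "((\<lambda>z. complex_of_real (snd z)) has_derivative (\<lambda>h. of_real (snd h))) (at z)"
    by (auto intro!: derivative_eq_intros)
  then show ?case by (meson differentiable_def)
qed auto

lemma pd_coord:
  "pd1 (\<lambda>z. c) = (\<lambda>z. 0)" "pd2 (\<lambda>z. c) = (\<lambda>z. 0)"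
  "pd1 (\<lambda>z. of_real (fst z)) = (\<lambda>z. 1)" "pd2 (\<lambda>z. of_real (fst z)) = (\<lambda>z. 0)"
  "pd1 (\<lambda>z. of_real (snd z)) = (\<lambda>z. 0)" "pd2 (\<lambda>z. of_real (snd z)) = (\<lambda>z. 1)"
proof -
  have "((\<lambda>z. complex_of_real (fst z)) has_derivative (\<lambda>h. of_real (fst h))) (at z)"
       "((\<lambda>z. complex_of_real (snd z)) has_derivative (\<lambda>h. of_real (snd h))) (at z)"
       "((\<lambda>z. c) has_derivative (\<lambda>h. 0)) (at z)" for z :: "real \<times> real" and c :: complex
    by (auto intro!: derivative_eq_intros)
  from this[THEN pd1_eq] this[THEN pd2_eq]
  show "pd1 (\<lambda>z. c) = (\<lambda>z. 0)" "pd2 (\<lambda>z. c) = (\<lambda>z. 0)"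
  "pd1 (\<lambda>z. of_real (fst z)) = (\<lambda>z. 1)" "pd2 (\<lambda>z. of_real (fst z)) = (\<lambda>z. 0)"
  "pd1 (\<lambda>z. of_real (snd z)) = (\<lambda>z. 0)" "pd2 (\<lambda>z. of_real (snd z)) = (\<lambda>z. 1)"
    by auto
qed

lemma poly2_pd: "p \<in> poly2 \<Longrightarrow> pd1 p \<in> poly2 \<and> pd2 p \<in> poly2"
proof (induction rule: poly2.induct)
  case (add p q)
  then show ?case by (simp add: pd_add poly2_differentiable poly2.add)
next
  case (mult p q)
  then show ?case by (simp add: pd_mult poly2_differentiable poly2.add poly2.mult)
qed (simp_all add: pd_coord poly2.const)

lemma norm_coord_le: "\<bar>fst z\<bar> \<le> norm z" "\<bar>snd z\<bar> \<le> norm z" for z :: "real \<times> real"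
  by (metis norm_fst_le real_norm_def prod.collapse, metis norm_snd_le real_norm_def prod.collapse)

lemma poly2_growth:
  assumes "p \<in> poly2"
  obtains C N where "C \<ge> 0" "\<And>z. norm (p z) \<le> C * (1 + norm z) ^ N"
proof -
  from assms have "\<exists>C N. C \<ge> 0 \<and> (\<forall>z. norm (p z) \<le> C * (1 + norm z) ^ N)"
  proof (induction rule: poly2.induct)
    case (const c)
    show ?case by (intro exI[of _ "norm c"] exI[of _ 0]) auto
  next
    case fst
    show ?case using norm_coord_le
      by (intro exI[of _ 1] exI[of _ "1::nat"]) (auto simp: add_increasing)
  next
    case snd
    show ?case using norm_coord_le
      by (intro exI[of _ 1] exI[of _ "1::nat"]) (auto simp: add_increasing)
  next
    case (add p q)
    then obtain C N C' N' where *: "C \<ge> 0" "\<And>z. norm (p z) \<le> C * (1 + norm z) ^ N"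
      "C' \<ge> 0" "\<And>z. norm (q z) \<le> C' * (1 + norm z) ^ N'" by blast
    have "norm (p z + q z) \<le> (C + C') * (1 + norm z) ^ max N N'" for z
    proof -
      have "norm (p z + q z) \<le> C * (1 + norm z) ^ N + C' * (1 + norm z) ^ N'"
        using *(2,4)[of z] norm_triangle_ineq[of "p z" "q z"] by linarith
      also have "\<dots> \<le> C * (1 + norm z) ^ max N N' + C' * (1 + norm z) ^ max N N'"
        using * by (intro add_mono mult_left_mono power_increasing) auto
      finally show ?thesis by (simp add: algebra_simps)
    qed
    then show ?case using * by (intro exI[of _ "C + C'"] exI[of _ "max N N'"]) auto
  next
    case (mult p q)
    then obtain C N C' N' where *: "C \<ge> 0" "\<And>z. norm (p z) \<le> C * (1 + norm z) ^ N"
      "C' \<ge> 0" "\<And>z. norm (q z) \<le> C' * (1 + norm z) ^ N'" by blast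
    have "norm (p z * q z) \<le> (C * C') * (1 + norm z) ^ (N + N')" for z
    proof -
      have "norm (p z * q z) \<le> (C * (1 + norm z) ^ N) * (C' * (1 + norm z) ^ N')"
        using *(2,4)[of z] *(1,3) by (auto simp: norm_mult intro!: mult_mono)
      then show ?thesis by (simp add: power_add algebra_simps)
    qed
    then show ?case using * by (intro exI[of _ "C * C'"] exI[of _ "N + N'"]) auto
  qed
  then show ?thesis using that by blast
qed

lemma rapid_add: "rapid f \<Longrightarrow> rapid g \<Longrightarrow> rapid (\<lambda>z. f z + g z)"
  unfolding rapid_def
proof (intro allI)
  fix N assume "\<forall>N. \<exists>C. \<forall>z. (1 + norm z) ^ N * norm (f z) \<le> C" "\<forall>N. \<exists>C. \<forall>z. (1 + norm z) ^ N * norm (g z) \<le> C"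
  then obtain C C' where *: "\<And>z. (1 + norm z) ^ N * norm (f z) \<le> C" "\<And>z. (1 + norm z) ^ N * norm (g z) \<le> C'"
    by metis
  have "(1 + norm z) ^ N * norm (f z + g z) \<le> C + C'" for z
  proof -
    have "(1 + norm z) ^ N * norm (f z + g z) \<le> (1 + norm z) ^ N * (norm (f z) + norm (g z))"
      by (intro mult_left_mono norm_triangle_ineq) auto
    then show ?thesis using *[of z] by (simp add: algebra_simps)
  qed
  then show "\<exists>C. \<forall>z. (1 + norm z) ^ N * norm (f z + g z) \<le> C" by blast
qed

lemma rapid_poly_mult:
  assumes "p \<in> poly2" "rapid f"
  shows "rapid (\<lambda>z. p z * f z)"
  unfolding rapid_def
proof
  fix N
  obtain C M where C: "C \<ge> 0" "\<And>z. norm (p z) \<le> C * (1 + norm z) ^ M"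
    using poly2_growth[OF assms(1)] by blast
  obtain B where B: "B \<ge> 0" "\<And>z. (1 + norm z) ^ (N + M) * norm (f z) \<le> B"
    using rapidD[OF assms(2)] by blast
  have "(1 + norm z) ^ N * norm (p z * f z) \<le> C * B" for z
  proof -
    have "(1 + norm z) ^ N * norm (p z * f z) \<le> (1 + norm z) ^ N * (C * (1 + norm z) ^ M * norm (f z))"
      unfolding norm_mult by (intro mult_left_mono mult_right_mono C) auto
    also have "\<dots> = C * ((1 + norm z) ^ (N + M) * norm (f z))"
      by (simp add: power_add)
    also have "\<dots> \<le> C * B" by (intro mult_left_mono B C)
    finally show ?thesis .
  qed
  then show "\<exists>C. \<forall>z. (1 + norm z) ^ N * norm (p z * f z) \<le> C" by blast
qed

text \<open>The module over the polynomials generated by \<open>S\<close>. By the Leibniz rule it is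
  closed under derivatives as soon as it contains the derivatives of its generators.\<close>

inductive_set pmod :: "fun2 set \<Rightarrow> fun2 set" for S where
  base: "f \<in> S \<Longrightarrow> f \<in> pmod S"
| add: "f \<in> pmod S \<Longrightarrow> g \<in> pmod S \<Longrightarrow> (\<lambda>z. f z + g z) \<in> pmod S"
| mult: "p \<in> poly2 \<Longrightarrow> f \<in> pmod S \<Longrightarrow> (\<lambda>z. p z * f z) \<in> pmod S"

text \<open>Everything is checked on the generators; the whole module then serves as the invariant
  class in \<open>schwartz_coinduct\<close>.\<close>

lemma pmod_schwartz:
  assumes S: "\<And>f. f \<in> S \<Longrightarrow> (\<forall>z. f differentiable (at z)) \<and> rapid f \<and> pd1 f \<in> pmod S \<and> pd2 f \<in> pmod S"
    and "f \<in> pmod S"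
  shows "schwartz f"
  using assms(2)
proof (rule schwartz_coinduct)
  fix f assume "f \<in> pmod S"
  then show "(\<forall>z. f differentiable (at z)) \<and> rapid f \<and> pd1 f \<in> pmod S \<and> pd2 f \<in> pmod S"
  proof (induction rule: pmod.induct)
    case (base f)
    then show ?case using S by blast
  next
    case (add f g)
    then have d: "\<And>z. f differentiable (at z)" "\<And>z. g differentiable (at z)" by auto
    with add show ?case unfolding pd_add[OF d] by (auto intro!: rapid_add pmod.add)
  next
    case (mult p f)
    then have d: "\<And>z. p differentiable (at z)" "\<And>z. f differentiable (at z)"
      by (auto intro: poly2_differentiable)
    with mult show ?case unfolding pd_mult[OF d]
      by (auto intro!: rapid_poly_mult pmod.add pmod.mult simp: poly2_pd)
  qed
qed

lemma schwartz_pmod: "f \<in> pmod {f. schwartz f} \<Longrightarrow> schwartz f"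
  by (rule pmod_schwartz[of "{f. schwartz f}"])
     (auto intro: schwartz_differentiable schwartz_rapid pmod.base schwartz_pd1 schwartz_pd2)

lemma schwartz_poly_mult: "p \<in> poly2 \<Longrightarrow> schwartz f \<Longrightarrow> schwartz (\<lambda>z. p z * f z)"
  by (intro schwartz_pmod pmod.mult pmod.base) auto

lemma schwartz_add: "schwartz f \<Longrightarrow> schwartz g \<Longrightarrow> schwartz (\<lambda>z. f z + g z)"
  by (intro schwartz_pmod pmod.add pmod.base) auto

lemma schwartz_cmult: "schwartz f \<Longrightarrow> schwartz (\<lambda>z. c * f z)"
  by (rule schwartz_poly_mult[OF poly2.const])

lemma schwartz_diff: "schwartz f \<Longrightarrow> schwartz g \<Longrightarrow> schwartz (\<lambda>z. f z - g z)"
  using schwartz_add[of f "\<lambda>z. - 1 * g z"] schwartz_cmult[of g "-1"] by simp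

lemma pd_reflect:
  assumes "\<And>z. f differentiable (at z)"
  shows "pd1 (\<lambda>z. f (- z)) = (\<lambda>z. - pd1 f (- z))" "pd2 (\<lambda>z. f (- z)) = (\<lambda>z. - pd2 f (- z))"
    and "(\<lambda>z. f (- z)) differentiable (at z)"
proof -
  have *: "\<exists>D. (f has_derivative D) (at (- z)) \<and> ((\<lambda>z. f (- z)) has_derivative (\<lambda>h. D (- h))) (at z)" for z
  proof -
    obtain D where D: "(f has_derivative D) (at (- z))" using assms by (meson differentiable_def)
    have "(uminus has_derivative uminus) (at z)" by (auto intro!: derivative_eq_intros)
    from has_derivative_compose[OF this, of f D] D show ?thesis by blast
  qed
  then show "(\<lambda>z. f (- z)) differentiable (at z)" by (meson differentiable_def)
  have "pd1 (\<lambda>z. f (- z)) (x, y) = - pd1 f (- x, - y) \<and> pd2 (\<lambda>z. f (- z)) (x, y) = - pd2 f (- x, - y)" for x y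
  proof -
    obtain D where D: "(f has_derivative D) (at (- x, - y))" "((\<lambda>z. f (- z)) has_derivative (\<lambda>h. D (- h))) (at (x, y))"
      using *[of "(x, y)"] by auto
    from linear_neg[OF has_derivative_linear[OF D(1)], of "(1, 0)"]
      linear_neg[OF has_derivative_linear[OF D(1)], of "(0, 1)"]
    show ?thesis using D by (simp add: pd1_eq pd2_eq)
  qed
  then show "pd1 (\<lambda>z. f (- z)) = (\<lambda>z. - pd1 f (- z))" "pd2 (\<lambda>z. f (- z)) = (\<lambda>z. - pd2 f (- z))" by auto
qed

text \<open>The minus sign of the chain rule is absorbed by taking as invariant class the
  reflections of all Schwartz functions.\<close>

lemma schwartz_reflect: 
  assumes "schwartz f"
  shows "schwartz (\<lambda>z. f (- z))"
proof (rule schwartz_coinduct[of _ "{g. \<exists>f. schwartz f \<and> g = (\<lambda>z. f (- z))}"])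
  show "(\<lambda>z. f (- z)) \<in> {g. \<exists>f. schwartz f \<and> g = (\<lambda>z. f (- z))}" using assms by blast
  fix g assume "g \<in> {g. \<exists>f. schwartz f \<and> g = (\<lambda>z. f (- z))}"
  then obtain f where f: "schwartz f" "g = (\<lambda>z. f (- z))" by blast
  have "\<exists>C. \<forall>z. (1 + norm z) ^ N * norm (f (- z)) \<le> C" for N
  proof -
    obtain C where "\<And>z. (1 + norm z) ^ N * norm (f z) \<le> C"
      using rapidD[OF schwartz_rapid[OF f(1)]] by metis
    from this[of "- z" for z] show ?thesis unfolding norm_minus_cancel by blast
  qed
  then have "rapid g" by (simp add: rapid_def f)
  moreover have "schwartz (\<lambda>z. - pd1 f z)" "schwartz (\<lambda>z. - pd2 f z)"
    using schwartz_cmult[OF schwartz_pd1[OF f(1)], of "-1"] schwartz_cmult[OF schwartz_pd2[OF f(1)], of "-1"] by auto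
  ultimately show "(\<forall>z. g differentiable (at z)) \<and> rapid g \<and> 
      pd1 g \<in> {g. \<exists>f. schwartz f \<and> g = (\<lambda>z. f (- z))} \<and> pd2 g \<in> {g. \<exists>f. schwartz f \<and> g = (\<lambda>z. f (- z))}"
    unfolding f(2) using schwartz_differentiable[OF f(1)] by (simp add: pd_reflect) blast
qed

subsection \<open>Integration on the plane\<close>

lemma integrable_prod_mult:
  fixes f :: "'a::euclidean_space \<Rightarrow> complex" and g :: "'b::euclidean_space \<Rightarrow> complex"
  assumes [measurable]: "integrable lborel f" "integrable lborel g"
  shows "integrable (lborel \<Otimes>\<^sub>M lborel) (\<lambda>(x, y). f x * g y)"
  by (rule lborel_pair.Fubini_integrable) (auto simp: norm_mult assms)

lemma integral_prod_mult:
  fixes f :: "real \<Rightarrow> complex" and g :: "real \<Rightarrow> complex"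
  assumes "integrable lborel f" "integrable lborel g"
  shows "integral\<^sup>L lborel (\<lambda>z. f (fst z) * g (snd z)) = integral\<^sup>L lborel f * integral\<^sup>L lborel g"
  using lborel_pair.integral_fst[OF integrable_prod_mult[OF assms]]
  by (simp add: lborel_prod case_prod_unfold)

lemma integrable_inv_sq: "integrable lborel (\<lambda>x::real. inverse (1 + x\<^sup>2))"
  using integrable_inverse_1_plus_square by (simp add: set_integrable_def)

text \<open>A fixed majorant in product form: its integrability reduces to that of
  \<open>1 / (1 + x ^ 2)\<close> on the line, and its reciprocal is at most
  \<open>(1 + norm z) ^ 4\<close>.\<close>

definition decay :: "real \<times> real \<Rightarrow> real" where
  "decay z = inverse (1 + (fst z)\<^sup>2) * inverse (1 + (snd z)\<^sup>2)"

lemma integrable_decay: "integrable lborel decay"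
proof -
  have "integrable (lborel \<Otimes>\<^sub>M lborel) (\<lambda>(x, y). complex_of_real (inverse (1 + x\<^sup>2)) * complex_of_real (inverse (1 + y\<^sup>2)))"
    by (intro integrable_prod_mult integrable_of_real integrable_inv_sq)
  then have "integrable lborel (\<lambda>z. complex_of_real (decay z))"
    by (simp add: lborel_prod case_prod_unfold decay_def[abs_def])
  then show ?thesis using complex_of_real_integrable_eq by blast
qed

lemma decay_pos: "decay z > 0"
  by (simp add: decay_def add_pos_nonneg)

lemma rapid_decay:
  assumes "rapid f"
  obtains C where "C \<ge> 0" "\<And>z. (1 + norm z) ^ N * norm (f z) \<le> C * decay z"
proof -
  \<comment> \<open>The four additional powers pay for the reciprocal of
    \<open>decay\<close>.\<close>
  obtain C where C: "C \<ge> 0" "\<And>z. (1 + norm z) ^ (N + 4) * norm (f z) \<le> C"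
    using rapidD[OF assms] by metis
  have "(1 + norm z) ^ N * norm (f z) \<le> C * decay z" for z
  proof -
    have *: "1 + a\<^sup>2 \<le> (1 + norm z)\<^sup>2" if "\<bar>a\<bar> \<le> norm z" for a
    proof -
      have "a\<^sup>2 \<le> (norm z)\<^sup>2" using that by (simp add: abs_le_square_iff[symmetric])
      moreover have "(1 + norm z)\<^sup>2 = 1 + 2 * norm z + (norm z)\<^sup>2"
        by (simp add: power2_sum)
      ultimately show ?thesis using norm_ge_zero[of z] by linarith
    qed
    have "inverse (decay z) = (1 + (fst z)\<^sup>2) * (1 + (snd z)\<^sup>2)"
      by (simp add: decay_def)
    also have "\<dots> \<le> (1 + norm z)\<^sup>2 * (1 + norm z)\<^sup>2"
      by (intro mult_mono * norm_coord_le) auto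
    finally have "inverse (decay z) \<le> (1 + norm z) ^ 4" by (simp add: power2_eq_square power4_eq_xxxx)
    then have "((1 + norm z) ^ N * norm (f z)) * inverse (decay z) \<le> ((1 + norm z) ^ N * norm (f z)) * (1 + norm z) ^ 4"
      by (intro mult_left_mono) auto
    also have "\<dots> \<le> C" using C(2)[of z] by (simp add: power_add algebra_simps)
    finally show ?thesis using decay_pos[of z] by (simp add: field_simps)
  qed
  then show ?thesis using C that by blast
qed

lemma integrable_bound_decay:
  fixes f :: "real \<times> real \<Rightarrow> 'a::{banach, second_countable_topology}"
  assumes "f \<in> borel_measurable borel" "\<And>z. norm (f z) \<le> C * decay z"
  shows "integrable lborel f"
  by (rule Bochner_Integration.integrable_bound[of lborel "\<lambda>z. C * decay z"])
     (use assms integrable_decay in \<open>auto intro!: AE_I2 order_trans[OF assms(2)]\<close>)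

lemma rapid_integrable_moment:
  assumes [measurable]: "f \<in> borel_measurable borel" and "rapid f"
  shows "integrable lborel (\<lambda>z. (1 + norm z) ^ N * norm (f z))"
proof -
  obtain C where C: "\<And>z. (1 + norm z) ^ N * norm (f z) \<le> C * decay z"
    using rapid_decay[OF assms(2)] by metis
  then show ?thesis by (intro integrable_bound_decay[of _ C]) auto
qed

lemma schwartz_integrable_moment:
  "schwartz f \<Longrightarrow> integrable lborel (\<lambda>z. (1 + norm z) ^ N * norm (f z))"
  by (simp add: rapid_integrable_moment schwartz_borel schwartz_rapid)

lemma schwartz_integrable: "schwartz f \<Longrightarrow> integrable lborel f"
  using schwartz_integrable_moment[of f 0] integrable_norm_cancel[of lborel f] schwartz_borel[of f] by simp

lemma L1norm_nonneg: "L1norm f \<ge> 0"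
  by (simp add: L1norm_def)

text \<open>The axes are scaled independently because the symbols are homogeneous under anisotropic
  dilations only; \<open>a = b = - 1\<close> gives the reflection.\<close>

lemma plane_affine:
  fixes f :: "real \<times> real \<Rightarrow> 'a::{banach, second_countable_topology}"
  assumes [measurable]: "f \<in> borel_measurable borel" and "a \<noteq> 0" "b \<noteq> 0"
  shows "integral\<^sup>L lborel f = \<bar>a * b\<bar> *\<^sub>R integral\<^sup>L lborel (\<lambda>z. f (s + a * fst z, t + b * snd z))"
    and "integrable lborel f \<Longrightarrow> integrable lborel (\<lambda>z. f (s + a * fst z, t + b * snd z))"
proof -
  define T where "T = (\<lambda>z::real\<times>real. (s + a * fst z, t + b * snd z))"
  define c where "c = (\<lambda>j::real\<times>real. if j = (1, 0) then a else b)"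
  have T: "T x = (s, t) + (\<Sum>j\<in>Basis. (c j * (x \<bullet> j)) *\<^sub>R j)" for x
    by (cases x) (simp add: T_def c_def Basis_prod_def sum.union_disjoint)
  have p: "(\<Prod>j\<in>Basis. \<bar>c j\<bar>) = \<bar>a * b\<bar>"
    by (simp add: c_def Basis_prod_def prod.union_disjoint abs_mult)
  have "T = (\<lambda>x. (s, t) + (\<Sum>j\<in>Basis. (c j * (x \<bullet> j)) *\<^sub>R j))" using T by auto
  then have eq: "lborel = density (distr lborel borel T) (\<lambda>_. ennreal \<bar>a * b\<bar>)"
    using lborel_affine_euclidean[of c "(s, t)"] assms(2,3) unfolding p by (auto simp: c_def)
  have [measurable]: "T \<in> borel \<rightarrow>\<^sub>M borel"
    unfolding T_def by (intro borel_measurable_continuous_onI continuous_intros)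
  show "integral\<^sup>L lborel f = \<bar>a * b\<bar> *\<^sub>R integral\<^sup>L lborel (\<lambda>z. f (s + a * fst z, t + b * snd z))"
    by (subst eq) (use assms(2,3) in \<open>simp add: integral_density integral_distr, simp add: T_def\<close>)
  assume "integrable lborel f"
  then have "integrable (density (distr lborel borel T) (\<lambda>_. ennreal \<bar>a * b\<bar>)) f" using eq by simp
  then have "integrable lborel (\<lambda>z. \<bar>a * b\<bar> *\<^sub>R f (T z))"
    by (simp add: integrable_density integrable_distr_eq)
  then have "integrable lborel (\<lambda>z. inverse \<bar>a * b\<bar> *\<^sub>R \<bar>a * b\<bar> *\<^sub>R f (T z))"
    by (rule integrable_scaleR_right)
  then show "integrable lborel (\<lambda>z. f (s + a * fst z, t + b * snd z))"
    using assms(2,3) by (simp add: T_def)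
qed

subsection \<open>The Fourier transform\<close>

definition fker :: "real \<times> real \<Rightarrow> real \<times> real \<Rightarrow> complex" where
  "fker z w = cis (- 2 * pi * (fst z * fst w + snd z * snd w))"

lemma norm_fker [simp]: "norm (fker z w) = 1"
  by (simp add: fker_def)

lemma fker_commute: "fker z w = fker w z"
  by (simp add: fker_def mult.commute)

lemma fker_add: "fker z (w + w') = fker z w * fker z w'"
  by (simp add: fker_def cis_mult algebra_simps)

lemma cnj_fker: "cnj (fker z w) = fker (- z) w"
  by (simp add: fker_def cis_cnj algebra_simps)

lemma fker_measurable [measurable]: "case_prod fker \<in> borel_measurable borel"
  unfolding fker_def cis_conv_exp case_prod_beta
  by (intro borel_measurable_continuous_onI continuous_intros)

lemma fker_measurable' [measurable]:
  assumes [measurable]: "f \<in> measurable M borel" "g \<in> measurable M borel"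
  shows "(\<lambda>x. fker (f x) (g x)) \<in> borel_measurable M"
proof -
  have "(\<lambda>x. case_prod fker (f x, g x)) \<in> borel_measurable M"
    by measurable
  then show ?thesis by simp
qed

lemma fourier2_eq: "fourier2 \<phi> w = integral\<^sup>L lborel (\<lambda>z. \<phi> z * fker z w)"
  unfolding fourier2_def fker_def cis_conv_exp
  by (simp add: case_prod_unfold mult_ac)

lemma integrable_fker:
  "integrable lborel \<phi> \<Longrightarrow> integrable lborel (\<lambda>z. \<phi> z * fker z w)"
  by (rule Bochner_Integration.integrable_bound[of lborel \<phi>]) (auto simp: norm_mult)

lemma norm_fourier2_le: "norm (fourier2 \<phi> w) \<le> L1norm \<phi>"
proof -
  have "norm (fourier2 \<phi> w) \<le> integral\<^sup>L lborel (\<lambda>z. norm (\<phi> z * fker z w))"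
    unfolding fourier2_eq by (rule integral_norm_bound)
  then show ?thesis by (simp add: norm_mult L1norm_def)
qed

lemma fourier2_borel [measurable]:
  assumes [measurable]: "\<phi> \<in> borel_measurable borel"
  shows "fourier2 \<phi> \<in> borel_measurable borel"
proof -
  have "(\<lambda>w. integral\<^sup>L lborel (\<lambda>z. \<phi> z * fker z w)) \<in> borel_measurable lborel"
    by (rule sigma_finite_measure.borel_measurable_lebesgue_integral[OF sigma_finite_lborel]) measurable
  then show ?thesis by (simp add: fourier2_eq[abs_def])
qed

lemma fourier2_cmult: "fourier2 (\<lambda>z. c * \<phi> z) w = c * fourier2 \<phi> w"
  by (simp add: fourier2_eq mult.assoc)

lemma fourier2_diff:
  assumes "integrable lborel \<phi>" "integrable lborel \<psi>"
  shows "fourier2 (\<lambda>z. \<phi> z - \<psi> z) w = fourier2 \<phi> w - fourier2 \<psi> w"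
  using integrable_fker[OF assms(1)] integrable_fker[OF assms(2)]
  by (simp add: fourier2_eq left_diff_distrib)

lemma integrable_mult_fourier2:
  assumes "integrable lborel \<phi>" "integrable lborel \<psi>"
  shows "integrable lborel (\<lambda>z. \<phi> z * fourier2 \<psi> z)"
proof (rule Bochner_Integration.integrable_bound[of lborel "\<lambda>z. L1norm \<psi> *\<^sub>R \<phi> z"])
  have [measurable]: "\<phi> \<in> borel_measurable borel" "\<psi> \<in> borel_measurable borel" using assms by auto
  show "(\<lambda>z. \<phi> z * fourier2 \<psi> z) \<in> borel_measurable lborel" by simp
  show "AE x in lborel. cmod (\<phi> x * fourier2 \<psi> x) \<le> cmod (L1norm \<psi> *\<^sub>R \<phi> x)"
    by (intro AE_I2) (simp add: norm_mult L1norm_nonneg norm_fourier2_le mult.commute[of "L1norm \<psi>"] mult_left_mono)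
qed (use assms in auto)

text \<open>Fubini for \<open>\<phi> z * \<psi> w * fker z w\<close>, whose modulus is a product of
  integrable functions. The formula moves the transform from one factor to the other, both in the
  inversion theorem and in the bilinear estimate.\<close>

lemma fourier2_multiplication:
  assumes [measurable]: "integrable lborel \<phi>" "integrable lborel \<psi>"
  shows "integral\<^sup>L lborel (\<lambda>z. \<phi> z * fourier2 \<psi> z) = integral\<^sup>L lborel (\<lambda>z. fourier2 \<phi> z * \<psi> z)"
proof -
  have "integrable (lborel \<Otimes>\<^sub>M lborel) (\<lambda>(z, w). \<phi> z * \<psi> w * fker z w)"
    by (rule Bochner_Integration.integrable_bound[OF integrable_prod_mult[OF assms]])
       (auto simp: norm_mult)
  from lborel_pair.Fubini_integral[OF this]
  have "(\<integral>w. \<integral>z. \<phi> z * \<psi> w * fker z w \<partial>lborel \<partial>lborel) = (\<integral>z. \<integral>w. \<phi> z * \<psi> w * fker z w \<partial>lborel \<partial>lborel)" .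
  moreover have "(\<integral>z. \<phi> z * \<psi> w * fker z w \<partial>lborel) = fourier2 \<phi> w * \<psi> w" for w
    unfolding fourier2_eq by (subst integral_mult_left_zero[symmetric]) (simp add: mult_ac)
  moreover have "(\<integral>w. \<phi> z * \<psi> w * fker z w \<partial>lborel) = \<phi> z * fourier2 \<psi> z" for z
    by (simp add: fourier2_eq mult.assoc fker_commute)
  ultimately show ?thesis by simp
qed

lemma fourier2_reflect:
  assumes [measurable]: "\<phi> \<in> borel_measurable borel"
  shows "fourier2 (\<lambda>z. \<phi> (- z)) w = fourier2 \<phi> (- w)"
proof -
  have *: "- z = (0 + (-1) * fst z, 0 + (-1) * snd z)" for z :: "real \<times> real" by (cases z) simp
  have "(\<integral>z. \<phi> z * fker z (- w) \<partial>lborel) = (\<integral>z. \<phi> (- z) * fker (- z) (- w) \<partial>lborel)"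
    by (subst plane_affine(1)[where a="-1" and b="-1" and s=0 and t=0]) (auto simp: *)
  then show ?thesis by (simp add: fourier2_eq fker_def)
qed

section \<open>Derivatives under the Fourier transform\<close>

lemma integral_deriv_zero:
  fixes F f :: "real \<Rightarrow> complex"
  assumes "\<And>x. (F has_vector_derivative f x) (at x)" "\<And>x. isCont f x" "integrable lborel f"
    and bd: "\<And>x. norm (F x) \<le> C * inverse (1 + x\<^sup>2)"
  shows "integral\<^sup>L lborel f = 0"
proof -
  have lim: "(F \<longlongrightarrow> 0) at_top" "(F \<longlongrightarrow> 0) at_bot"
  proof -
    have "((\<lambda>x::real. C * inverse (1 + x\<^sup>2)) \<longlongrightarrow> 0) at_top" "((\<lambda>x::real. C * inverse (1 + x\<^sup>2)) \<longlongrightarrow> 0) at_bot"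
      by real_asymp+
    then show "(F \<longlongrightarrow> 0) at_top" "(F \<longlongrightarrow> 0) at_bot"
      by (auto elim!: Lim_null_comparison[rotated] intro!: always_eventually bd)
  qed
  have "(LBINT x=-\<infinity>..\<infinity>. f x) = 0 - 0"
    by (rule interval_integral_FTC_integrable[of _ _ F])
       (use assms lim in \<open>auto simp: set_integrable_def ereal_tendsto_simps\<close>)
  then show ?thesis by (simp add: interval_lebesgue_integral_def set_lebesgue_integral_def)
qed

lemma fker_has_vector_derivative:
  "((\<lambda>t. fker (t, y) w) has_vector_derivative (- 2 * pi * \<i> * of_real (fst w)) * fker (x, y) w) (at x)"
  "((\<lambda>t. fker (y, t) w) has_vector_derivative (- 2 * pi * \<i> * of_real (snd w)) * fker (y, x) w) (at x)"
proof -
  have *: "((\<lambda>t. exp (c * complex_of_real t + d)) has_vector_derivative c * exp (c * of_real x + d)) (at x)"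
    for c d :: complex
    by (rule has_vector_derivative_real_field) (auto intro!: derivative_eq_intros)
  show "((\<lambda>t. fker (t, y) w) has_vector_derivative (- 2 * pi * \<i> * of_real (fst w)) * fker (x, y) w) (at x)"
    using *[of "- 2 * pi * \<i> * of_real (fst w)" "- 2 * pi * \<i> * of_real (y * snd w)"]
    by (simp add: fker_def cis_conv_exp algebra_simps)
  show "((\<lambda>t. fker (y, t) w) has_vector_derivative (- 2 * pi * \<i> * of_real (snd w)) * fker (y, x) w) (at x)"
    using *[of "- 2 * pi * \<i> * of_real (snd w)" "- 2 * pi * \<i> * of_real (y * fst w)"]
    by (simp add: fker_def cis_conv_exp algebra_simps)
qed

lemma decay_le1: "decay (x, y) \<le> inverse (1 + x\<^sup>2)" "decay (x, y) \<le> inverse (1 + y\<^sup>2)"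
proof -
  have "inverse (1 + t\<^sup>2) \<le> 1" for t :: real by (simp add: field_simps add_pos_nonneg)
  then show "decay (x, y) \<le> inverse (1 + x\<^sup>2)" "decay (x, y) \<le> inverse (1 + y\<^sup>2)"
    unfolding decay_def using mult_left_le[of "inverse (1+y\<^sup>2)" "inverse (1+x\<^sup>2)"] 
       mult_left_le[of "inverse (1+x\<^sup>2)" "inverse (1+y\<^sup>2)"] 
    by (auto simp: mult.commute simp del: inverse_mult_distrib)
qed

text \<open>The integrand is the partial derivative of \<open>f * fker\<close>, so its integral
  along each line in that direction is zero, and Fubini finishes. The majorant \<open>decay\<close>
  makes every slice integrable, not just almost every one.\<close>

lemma fourier2_pd_zero:
  assumes f: "schwartz f"
  shows "integral\<^sup>L lborel (\<lambda>z. pd1 f z * fker z w + f z * ((- 2 * pi * \<i> * of_real (fst w)) * fker z w)) = 0" (is "integral\<^sup>L lborel ?G = 0")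
    and "integral\<^sup>L lborel (\<lambda>z. pd2 f z * fker z w + f z * ((- 2 * pi * \<i> * of_real (snd w)) * fker z w)) = 0" (is "integral\<^sup>L lborel ?H = 0")
proof -
  obtain C where C: "C \<ge> 0" "norm (f z) \<le> C * decay z" for z
    using rapid_decay[OF schwartz_rapid[OF f], of 0] by auto
  obtain C1 where C1: "C1 \<ge> 0" "norm (pd1 f z) \<le> C1 * decay z" for z
    using rapid_decay[OF schwartz_rapid[OF schwartz_pd1[OF f]], of 0] by auto
  obtain C2 where C2: "C2 \<ge> 0" "norm (pd2 f z) \<le> C2 * decay z" for z
    using rapid_decay[OF schwartz_rapid[OF schwartz_pd2[OF f]], of 0] by auto
  have cont: "continuous_on UNIV f" "continuous_on UNIV (pd1 f)" "continuous_on UNIV (pd2 f)"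
    using f by (auto intro: schwartz_continuous schwartz_pd1 schwartz_pd2)
  have contk: "continuous_on UNIV (\<lambda>z. fker z w)"
    unfolding fker_def cis_conv_exp by (intro continuous_intros)
  have bG: "norm (?G z) \<le> (C1 + C * (2 * pi * \<bar>fst w\<bar>)) * decay z" for z
  proof -
    have "norm (?G z) \<le> norm (pd1 f z) + norm (f z) * (2 * pi * \<bar>fst w\<bar>)"
      by (rule order_trans[OF norm_triangle_ineq]) (simp add: norm_mult)
    also have "\<dots> \<le> C1 * decay z + (C * decay z) * (2 * pi * \<bar>fst w\<bar>)"
      by (intro add_mono mult_right_mono C C1) auto
    finally show ?thesis by (simp add: algebra_simps)
  qed
  have bH: "norm (?H z) \<le> (C2 + C * (2 * pi * \<bar>snd w\<bar>)) * decay z" for z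
  proof -
    have "norm (?H z) \<le> norm (pd2 f z) + norm (f z) * (2 * pi * \<bar>snd w\<bar>)"
      by (rule order_trans[OF norm_triangle_ineq]) (simp add: norm_mult)
    also have "\<dots> \<le> C2 * decay z + (C * decay z) * (2 * pi * \<bar>snd w\<bar>)"
      by (intro add_mono mult_right_mono C C2) auto
    finally show ?thesis by (simp add: algebra_simps)
  qed
  have cG: "continuous_on UNIV ?G" and cH: "continuous_on UNIV ?H"
    by (intro continuous_intros cont contk)+
  have iG: "integrable lborel ?G" and iH: "integrable lborel ?H"
    by (rule integrable_bound_decay[OF borel_measurable_continuous_onI[OF cG] bG],
        rule integrable_bound_decay[OF borel_measurable_continuous_onI[OF cH] bH])
  have slice: "integrable lborel g"
    if "continuous_on UNIV g" "\<And>x. norm (g x) \<le> B * inverse (1 + x\<^sup>2)" for g :: "real \<Rightarrow> complex" and B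
    by (rule Bochner_Integration.integrable_bound[of lborel "\<lambda>x. B * inverse (1 + x\<^sup>2)"])
       (use that integrable_inv_sq in \<open>auto intro!: AE_I2 order_trans[OF that(2)] borel_measurable_continuous_onI\<close>)
  have 1: "integral\<^sup>L lborel (\<lambda>x. ?G (x, y)) = 0" for y
  proof (rule integral_deriv_zero[of "\<lambda>x. f (x, y) * fker (x, y) w"])
    have c: "continuous_on UNIV (\<lambda>x. ?G (x, y))"
      by (rule continuous_on_compose2[OF cG]) (auto intro!: continuous_intros)
    then show "isCont (\<lambda>x. ?G (x, y)) x" for x by (simp add: continuous_on_eq_continuous_at)
    show "integrable lborel (\<lambda>x. ?G (x, y))"
      by (rule slice[OF c order_trans[OF bG mult_left_mono[OF decay_le1(1)]]]) (use C1 C in auto)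
    show "((\<lambda>x. f (x, y) * fker (x, y) w) has_vector_derivative ?G (x, y)) (at x)" for x
      using has_vector_derivative_mult[OF pd1_has_vector_derivative[OF schwartz_differentiable[OF f]] fker_has_vector_derivative(1)]
      by (simp add: add.commute)
    show "norm (f (x, y) * fker (x, y) w) \<le> C * inverse (1 + x\<^sup>2)" for x
      unfolding norm_mult norm_fker mult_1_right
      by (rule order_trans[OF C(2) mult_left_mono[OF decay_le1(1) C(1)]])
  qed
  have 2: "integral\<^sup>L lborel (\<lambda>y. ?H (x, y)) = 0" for x
  proof (rule integral_deriv_zero[of "\<lambda>y. f (x, y) * fker (x, y) w"])
    have c: "continuous_on UNIV (\<lambda>y. ?H (x, y))"
      by (rule continuous_on_compose2[OF cH]) (auto intro!: continuous_intros)
    then show "isCont (\<lambda>y. ?H (x, y)) y" for y by (simp add: continuous_on_eq_continuous_at)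
    show "integrable lborel (\<lambda>y. ?H (x, y))"
      by (rule slice[OF c order_trans[OF bH mult_left_mono[OF decay_le1(2)]]]) (use C2 C in auto)
    show "((\<lambda>y. f (x, y) * fker (x, y) w) has_vector_derivative ?H (x, y)) (at y)" for y
      using has_vector_derivative_mult[OF pd2_has_vector_derivative[OF schwartz_differentiable[OF f]] fker_has_vector_derivative(2)]
      by (simp add: add.commute)
    show "norm (f (x, y) * fker (x, y) w) \<le> C * inverse (1 + y\<^sup>2)" for y
      unfolding norm_mult norm_fker mult_1_right
      by (rule order_trans[OF C(2) mult_left_mono[OF decay_le1(2) C(1)]])
  qed
  show "integral\<^sup>L lborel ?G = 0"
    using lborel_pair.integral_snd[of "\<lambda>x y. ?G (x, y)"] iG 1 by (simp add: lborel_prod case_prod_unfold)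
  show "integral\<^sup>L lborel ?H = 0"
    using lborel_pair.integral_fst[of "\<lambda>x y. ?H (x, y)"] iH 2 by (simp add: lborel_prod case_prod_unfold)
qed

lemma fourier2_pd:
  assumes f: "schwartz f"
  shows "fourier2 (pd1 f) w = 2 * pi * \<i> * of_real (fst w) * fourier2 f w"
    and "fourier2 (pd2 f) w = 2 * pi * \<i> * of_real (snd w) * fourier2 f w"
proof -
  have i: "integrable lborel (\<lambda>z. f z * fker z w)" "integrable lborel (\<lambda>z. pd1 f z * fker z w)"
    "integrable lborel (\<lambda>z. pd2 f z * fker z w)"
    using f by (intro integrable_fker schwartz_integrable schwartz_pd1 schwartz_pd2; simp)+
  have c: "f z * (c * fker z w) = c * (f z * fker z w)" for c z by (simp add: mult_ac)
  show "fourier2 (pd1 f) w = 2 * pi * \<i> * of_real (fst w) * fourier2 f w"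
    using fourier2_pd_zero(1)[OF f, of w] i by (simp add: c fourier2_eq add_eq_0_iff)
  show "fourier2 (pd2 f) w = 2 * pi * \<i> * of_real (snd w) * fourier2 f w"
    using fourier2_pd_zero(2)[OF f, of w] i by (simp add: c fourier2_eq add_eq_0_iff)
qed

lemma schwartz_pd_funpow: "schwartz f \<Longrightarrow> schwartz ((pd1 ^^ n) f)" "schwartz f \<Longrightarrow> schwartz ((pd2 ^^ n) f)"
  by (induction n) (auto intro: schwartz_pd1 schwartz_pd2)

lemma fourier2_pd_funpow:
  assumes "schwartz f"
  shows "fourier2 ((pd1 ^^ n) f) w = (2 * pi * \<i> * of_real (fst w)) ^ n * fourier2 f w"
    and "fourier2 ((pd2 ^^ n) f) w = (2 * pi * \<i> * of_real (snd w)) ^ n * fourier2 f w"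
  by (induction n) (simp_all add: fourier2_pd schwartz_pd_funpow assms)

text \<open>The Fourier multiplier of \<open>Lop k l c\<close>.\<close>

definition Asym :: "nat \<Rightarrow> nat \<Rightarrow> complex \<Rightarrow> fun2" where
  "Asym k l c w = (2 * pi * \<i> * of_real (fst w)) ^ k - c * (2 * pi * \<i> * of_real (snd w)) ^ l"

lemma schwartz_Lop: "schwartz f \<Longrightarrow> schwartz (Lop k l c f)"
  unfolding Lop_def by (intro schwartz_diff schwartz_cmult schwartz_pd_funpow)

lemma fourier2_Lop:
  assumes "schwartz f"
  shows "fourier2 (Lop k l c f) w = Asym k l c w * fourier2 f w"
  unfolding Lop_def
  by (subst fourier2_diff)
     (simp_all add: fourier2_cmult fourier2_pd_funpow assms schwartz_integrable schwartz_pd_funpow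
        Asym_def algebra_simps)

lemma borel_measurable_cis [measurable]: "cis \<in> borel_measurable borel"
  unfolding cis_conv_exp[abs_def] by (intro borel_measurable_continuous_onI continuous_intros)

lemma borel_fst [measurable]: "(fst :: real \<times> real \<Rightarrow> real) \<in> borel \<rightarrow>\<^sub>M borel"
  and borel_snd [measurable]: "(snd :: real \<times> real \<Rightarrow> real) \<in> borel \<rightarrow>\<^sub>M borel"
  by (intro borel_measurable_continuous_onI continuous_intros)+

lemma schwartz_coord_mult:
  assumes "schwartz u"
  shows "schwartz (\<lambda>z. c * of_real (fst z) * u z)" "schwartz (\<lambda>z. c * of_real (snd z) * u z)"
  by (intro schwartz_poly_mult poly2.mult poly2.const poly2.fst poly2.snd assms)+

section \<open>Smoothness and decay of Fourier transforms\<close>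

lemma cis_diff_bound: "norm (cis (a + b) - cis a - \<i> * of_real b * cis a) \<le> b\<^sup>2 / 2"
proof -
  have "cis (a + b) - cis a - \<i> * of_real b * cis a = cis a * (iexp b - (\<Sum>k\<le>1. (\<i> * of_real b) ^ k / fact k))"
    by (simp add: cis_mult[symmetric] cis_conv_exp[of b] algebra_simps)
  moreover have "norm (iexp b - (\<Sum>k\<le>1. (\<i> * of_real b) ^ k / fact k)) \<le> \<bar>b\<bar> ^ 2 / fact 2"
    using iexp_approx1[of b 1] by (simp add: numeral_2_eq_2)
  ultimately show ?thesis by (simp add: norm_mult)
qed

text \<open>The Frechet derivative is obtained in one go: the first-order Taylor remainder of the
  kernel is bounded by a multiple of the square of \<open>norm z * norm h\<close>, and
  \<open>u\<close> has finite second moments.\<close>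

lemma fourier2_has_derivative:
  assumes u: "schwartz u"
  defines "u1 \<equiv> \<lambda>z. (- 2 * pi * \<i>) * of_real (fst z) * u z"
    and "u2 \<equiv> \<lambda>z. (- 2 * pi * \<i>) * of_real (snd z) * u z"
  shows "(fourier2 u has_derivative (\<lambda>h. of_real (fst h) * fourier2 u1 w + of_real (snd h) * fourier2 u2 w)) (at w)"
proof -
  define D where "D h = of_real (fst h) * fourier2 u1 w + of_real (snd h) * fourier2 u2 w" for h :: "real \<times> real"
  define K where "K = (2 * pi)\<^sup>2 / 2 * integral\<^sup>L lborel (\<lambda>z. (1 + norm z)\<^sup>2 * norm (u z))"
  have i: "integrable lborel u" "integrable lborel u1" "integrable lborel u2"
    unfolding u1_def u2_def by (intro schwartz_integrable schwartz_coord_mult u)+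
  note ik = i[THEN integrable_fker]
  have m: "integrable lborel (\<lambda>z. (1 + norm z)\<^sup>2 * norm (u z))"
    by (rule schwartz_integrable_moment[OF u])
  have "K \<ge> 0" unfolding K_def by (intro mult_nonneg_nonneg integral_nonneg_AE) auto
  have bd: "norm (fourier2 u (w + h) - fourier2 u w - D h) \<le> K * (norm h)\<^sup>2" for h
  proof -
    let ?E = "\<lambda>z. u z * fker z (w + h) - u z * fker z w - (of_real (fst h) * (u1 z * fker z w) + of_real (snd h) * (u2 z * fker z w))"
    have "fourier2 u (w + h) - fourier2 u w - D h = integral\<^sup>L lborel ?E"
      using ik by (simp add: fourier2_eq D_def)
    also have "norm \<dots> \<le> integral\<^sup>L lborel (\<lambda>z. (2 * pi)\<^sup>2 / 2 * (norm h)\<^sup>2 * ((1 + norm z)\<^sup>2 * norm (u z)))"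
    proof (rule order_trans[OF integral_norm_bound integral_mono])
      show "integrable lborel (\<lambda>z. norm (?E z))" using ik by auto
      show "integrable lborel (\<lambda>z. (2 * pi)\<^sup>2 / 2 * (norm h)\<^sup>2 * ((1 + norm z)\<^sup>2 * norm (u z)))"
        using m by simp
      fix z
      define a where "a = - 2 * pi * (fst z * fst w + snd z * snd w)"
      define b where "b = - 2 * pi * (fst z * fst h + snd z * snd h)"
      have "?E z = u z * (cis (a + b) - cis a - \<i> * of_real b * cis a)"
        by (simp add: a_def b_def u1_def u2_def fker_def algebra_simps)
      then have "norm (?E z) = norm (u z) * norm (cis (a + b) - cis a - \<i> * of_real b * cis a)"
        by (simp add: norm_mult)
      also have "\<dots> \<le> norm (u z) * (b\<^sup>2 / 2)" by (intro mult_left_mono cis_diff_bound) auto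
      also have "\<dots> \<le> norm (u z) * ((2 * pi)\<^sup>2 * ((norm h)\<^sup>2 * (1 + norm z)\<^sup>2) / 2)"
      proof -
        have "\<bar>fst z * fst h + snd z * snd h\<bar> \<le> norm z * norm h"
          using Cauchy_Schwarz_ineq2[of z h] by (simp add: inner_prod_def)
        also have "\<dots> \<le> (1 + norm z) * norm h" by (intro mult_right_mono) auto
        finally have "(fst z * fst h + snd z * snd h)\<^sup>2 \<le> ((1 + norm z) * norm h)\<^sup>2"
          by (subst abs_le_square_iff[symmetric]) simp
        then have "b\<^sup>2 \<le> (2 * pi)\<^sup>2 * ((norm h)\<^sup>2 * (1 + norm z)\<^sup>2)"
          by (simp add: b_def power_mult_distrib mult.commute)
        then show ?thesis by (intro mult_left_mono divide_right_mono) auto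
      qed
      finally show "norm (?E z) \<le> (2 * pi)\<^sup>2 / 2 * (norm h)\<^sup>2 * ((1 + norm z)\<^sup>2 * norm (u z))"
        by (simp add: mult_ac)
    qed
    also have "\<dots> = K * (norm h)\<^sup>2" by (simp add: K_def)
    finally show ?thesis .
  qed
  have lin: "bounded_linear D"
    unfolding D_def by (intro bounded_linear_add bounded_linear_mult_left
        bounded_linear_compose[OF bounded_linear_mult_left] bounded_linear_compose[OF bounded_linear_of_real]
        bounded_linear_fst bounded_linear_snd)
  have "(fourier2 u has_derivative D) (at w)"
    unfolding has_derivative_at
  proof (intro conjI lin)
    show "(\<lambda>h. norm (fourier2 u (w + h) - fourier2 u w - D h) / norm h) \<midarrow>0\<rightarrow> 0"
    proof (rule Lim_null_comparison)
      show "\<forall>\<^sub>F h in at 0. norm (norm (fourier2 u (w + h) - fourier2 u w - D h) / norm h) \<le> K * norm h"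
        using bd by (auto intro!: always_eventually simp: divide_simps power2_eq_square mult_ac \<open>K \<ge> 0\<close>)
      show "((\<lambda>h. K * norm h) \<longlongrightarrow> 0) (at (0 :: real \<times> real))"
        by (auto intro!: tendsto_eq_intros)
    qed
  qed
  then show ?thesis by (simp add: D_def[abs_def])
qed

lemma pd_fourier2:
  assumes "schwartz u"
  shows "pd1 (fourier2 u) = fourier2 (\<lambda>z. (- 2 * pi * \<i>) * of_real (fst z) * u z)"
    and "pd2 (fourier2 u) = fourier2 (\<lambda>z. (- 2 * pi * \<i>) * of_real (snd z) * u z)"
proof -
  have "pd1 (fourier2 u) (x, y) = fourier2 (\<lambda>z. (- 2 * pi * \<i>) * of_real (fst z) * u z) (x, y)"
    and "pd2 (fourier2 u) (x, y) = fourier2 (\<lambda>z. (- 2 * pi * \<i>) * of_real (snd z) * u z) (x, y)" for x y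
    using pd1_eq[OF fourier2_has_derivative[OF assms]] pd2_eq[OF fourier2_has_derivative[OF assms]] by simp_all
  then show "pd1 (fourier2 u) = fourier2 (\<lambda>z. (- 2 * pi * \<i>) * of_real (fst z) * u z)"
    and "pd2 (fourier2 u) = fourier2 (\<lambda>z. (- 2 * pi * \<i>) * of_real (snd z) * u z)" by auto
qed

text \<open>Derivatives of \<open>u\<close> yield powers of the frequency; the factor
  \<open>2 * pi\<close> that comes with each power is at least 1 and is dropped.\<close>

lemma power_coord_fourier2_le:
  assumes "schwartz u"
  shows "\<bar>fst w\<bar> ^ n * norm (fourier2 u w) \<le> L1norm ((pd1 ^^ n) u)"
    and "\<bar>snd w\<bar> ^ n * norm (fourier2 u w) \<le> L1norm ((pd2 ^^ n) u)"
proof -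
  have "\<bar>t\<bar> ^ n \<le> norm ((2 * pi * \<i> * complex_of_real t) ^ n)" for t
  proof -
    have "1 * \<bar>t\<bar> \<le> 2 * pi * \<bar>t\<bar>" by (intro mult_right_mono) (use pi_ge_two in auto)
    then show ?thesis by (simp add: norm_power norm_mult power_mono)
  qed
  then have *: "\<bar>t\<bar> ^ n * norm (fourier2 u w) \<le> norm ((2 * pi * \<i> * complex_of_real t) ^ n * fourier2 u w)" for t
    by (simp add: norm_mult mult_right_mono del: norm_power)
  show "\<bar>fst w\<bar> ^ n * norm (fourier2 u w) \<le> L1norm ((pd1 ^^ n) u)"
    using order_trans[OF *[of "fst w"]] norm_fourier2_le[of "(pd1 ^^ n) u" w] fourier2_pd_funpow(1)[OF assms] by metis
  show "\<bar>snd w\<bar> ^ n * norm (fourier2 u w) \<le> L1norm ((pd2 ^^ n) u)"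
    using order_trans[OF *[of "snd w"]] norm_fourier2_le[of "(pd2 ^^ n) u" w] fourier2_pd_funpow(2)[OF assms] by metis
qed

lemma rapid_fourier2:
  assumes u: "schwartz u"
  shows "rapid (fourier2 u)"
  unfolding rapid_def
proof
  fix N
  have "(1 + norm w) ^ N * norm (fourier2 u w) \<le> 3 ^ N * (L1norm u + L1norm ((pd1 ^^ N) u) + L1norm ((pd2 ^^ N) u))" for w
  proof -
    \<comment> \<open>\<open>1 + norm w\<close> is at most \<open>3 * M\<close>, and
      \<open>M ^ N\<close> is one of three quantities that can be bounded separately.\<close>
    define M where "M = Max {1, \<bar>fst w\<bar>, \<bar>snd w\<bar>}"
    have M: "1 \<le> M" "\<bar>fst w\<bar> \<le> M" "\<bar>snd w\<bar> \<le> M" by (simp_all add: M_def)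
    have "norm w \<le> \<bar>fst w\<bar> + \<bar>snd w\<bar>" using norm_Pair_le[of "fst w" "snd w"] by simp
    then have "(1 + norm w) ^ N \<le> (3 * M) ^ N" using M by (intro power_mono) auto
    also have "\<dots> = 3 ^ N * M ^ N" by (simp add: power_mult_distrib)
    also have "M ^ N \<le> 1 + \<bar>fst w\<bar> ^ N + \<bar>snd w\<bar> ^ N"
    proof -
      have "M = 1 \<or> M = \<bar>fst w\<bar> \<or> M = \<bar>snd w\<bar>" unfolding M_def by (auto simp: max_def)
      then show ?thesis by (auto simp: add_increasing add_increasing2)
    qed
    finally have "(1 + norm w) ^ N \<le> 3 ^ N * (1 + \<bar>fst w\<bar> ^ N + \<bar>snd w\<bar> ^ N)" by simp
    then have "(1 + norm w) ^ N * norm (fourier2 u w) \<le> 3 ^ N * (1 + \<bar>fst w\<bar> ^ N + \<bar>snd w\<bar> ^ N) * norm (fourier2 u w)"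
      by (intro mult_right_mono) auto
    also have "\<dots> = 3 ^ N * (norm (fourier2 u w) + \<bar>fst w\<bar> ^ N * norm (fourier2 u w) + \<bar>snd w\<bar> ^ N * norm (fourier2 u w))"
      by (simp add: algebra_simps)
    also have "\<dots> \<le> 3 ^ N * (L1norm u + L1norm ((pd1 ^^ N) u) + L1norm ((pd2 ^^ N) u))"
      by (intro mult_left_mono add_mono norm_fourier2_le power_coord_fourier2_le u) auto
    finally show ?thesis .
  qed
  then show "\<exists>C. \<forall>z. (1 + norm z) ^ N * norm (fourier2 u z) \<le> C" by blast
qed

text \<open>The partial derivatives of a Fourier transform are Fourier transforms of Schwartz
  functions, so the image of the Schwartz class is itself an invariant class.\<close>

lemma schwartz_fourier2:
  assumes "schwartz u"
  shows "schwartz (fourier2 u)"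
proof (rule schwartz_coinduct[of _ "fourier2 ` {u. schwartz u}"])
  show "fourier2 u \<in> fourier2 ` {u. schwartz u}" using assms by simp
  fix f assume "f \<in> fourier2 ` {u. schwartz u}"
  then obtain v where v: "schwartz v" "f = fourier2 v" by blast
  have "f differentiable (at z)" for z
    using fourier2_has_derivative[OF v(1)] unfolding v(2) differentiable_def by blast
  then show "(\<forall>z. f differentiable (at z)) \<and> rapid f \<and> pd1 f \<in> fourier2 ` {u. schwartz u} \<and> pd2 f \<in> fourier2 ` {u. schwartz u}"
    unfolding v(2) pd_fourier2[OF v(1)]
    by (intro conjI allI imageI CollectI rapid_fourier2 schwartz_coord_mult v(1))
qed

lemma fourier2_coord_power:
  assumes "schwartz u"
  shows "(pd1 ^^ n) (fourier2 u) = fourier2 (\<lambda>z. (- 2 * pi * \<i> * of_real (fst z)) ^ n * u z)"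
    and "(pd2 ^^ n) (fourier2 u) = fourier2 (\<lambda>z. (- 2 * pi * \<i> * of_real (snd z)) ^ n * u z)"
proof (induction n)
  case (Suc n)
  have s: "schwartz (\<lambda>z. (- 2 * pi * \<i> * of_real (fst z)) ^ n * u z)" "schwartz (\<lambda>z. (- 2 * pi * \<i> * of_real (snd z)) ^ n * u z)"
    by (intro schwartz_poly_mult poly2_power poly2.mult poly2.const poly2.fst poly2.snd assms)+
  case 1 then show ?case by (simp only: funpow.simps o_apply Suc.IH(1) pd_fourier2[OF s(1)], simp only: power_Suc mult.assoc)
  case 2 then show ?case by (simp only: funpow.simps o_apply Suc.IH(2) pd_fourier2[OF s(2)], simp only: power_Suc mult.assoc)
qed simp_all

text \<open>The reflection is built in because \<open>fourier2\<close> applied twice reflects: the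
  function with Fourier transform \<open>u\<close> is \<open>fourier2\<close> of the reflected
  \<open>u\<close>.\<close>

lemma Lop_fourier2:
  assumes u: "schwartz u"
  shows "Lop k l c (fourier2 (\<lambda>z. u (- z))) = fourier2 (\<lambda>z. Asym k l c (- z) * u (- z))"
proof
  fix w
  let ?v = "\<lambda>z. u (- z)"
  have v: "schwartz ?v" by (rule schwartz_reflect[OF u])
  have "schwartz (\<lambda>z. (- 2 * pi * \<i> * of_real (fst z)) ^ k * ?v z)" "schwartz (\<lambda>z. c * ((- 2 * pi * \<i> * of_real (snd z)) ^ l * ?v z))"
    by (intro schwartz_poly_mult poly2_power poly2.mult poly2.const poly2.fst poly2.snd v schwartz_cmult)+
  note i = this[THEN schwartz_integrable]
  have "Lop k l c (fourier2 ?v) w = fourier2 (\<lambda>z. (- 2 * pi * \<i> * of_real (fst z)) ^ k * ?v z) w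
      - fourier2 (\<lambda>z. c * ((- 2 * pi * \<i> * of_real (snd z)) ^ l * ?v z)) w"
    by (simp add: Lop_def fourier2_coord_power[OF v] fourier2_cmult)
  also have "\<dots> = fourier2 (\<lambda>z. Asym k l c (- z) * u (- z)) w"
    by (subst fourier2_diff[OF i, symmetric]) (simp add: Asym_def algebra_simps)
  finally show "Lop k l c (fourier2 ?v) w = fourier2 (\<lambda>z. Asym k l c (- z) * u (- z)) w" .
qed

subsection \<open>Fourier inversion\<close>

lemma gauss_integrable_1: "integrable lborel (\<lambda>x::real. exp (- x\<^sup>2 / 2))"
proof -
  have "integrable lborel (\<lambda>x. sqrt (2 * pi) * std_normal_density x)"
    by (intro integrable_mult_right integrable_normal_density) simp
  then show ?thesis by (simp add: std_normal_density_def)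
qed

lemma gauss_fourier_1: "integral\<^sup>L lborel (\<lambda>x::real. of_real (exp (- x\<^sup>2 / 2)) * cis (t * x)) = of_real (sqrt (2 * pi) * exp (- t\<^sup>2 / 2))"
proof -
  have "char std_normal_distribution t = integral\<^sup>L lborel (\<lambda>x. std_normal_density x *\<^sub>R iexp (t * x))"
    unfolding char_def by (subst integral_density) (auto simp: normal_density_nonneg)
  then have "of_real (exp (- t\<^sup>2 / 2)) = integral\<^sup>L lborel (\<lambda>x. std_normal_density x *\<^sub>R iexp (t * x))"
    by (simp only: char_std_normal_distribution)
  then have "of_real (exp (- t\<^sup>2 / 2)) = integral\<^sup>L lborel (\<lambda>x. of_real (1 / sqrt (2 * pi)) * (of_real (exp (- x\<^sup>2 / 2)) * cis (t * x)))"
    by (simp add: std_normal_density_def scaleR_conv_of_real cis_conv_exp mult_ac)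
  then have "of_real (exp (- t\<^sup>2 / 2)) = of_real (1 / sqrt (2 * pi)) * integral\<^sup>L lborel (\<lambda>x. of_real (exp (- x\<^sup>2 / 2)) * cis (t * x))"
    by simp
  moreover have "complex_of_real (sqrt (2 * pi)) \<noteq> 0" by simp
  ultimately show ?thesis by (simp add: field_simps)
qed

definition gauss2 :: fun2 where
  "gauss2 z = of_real (exp (- (fst z)\<^sup>2 / 2)) * of_real (exp (- (snd z)\<^sup>2 / 2))"

lemma gauss2_integrable: "integrable lborel gauss2"
  using integrable_prod_mult[OF integrable_of_real[OF gauss_integrable_1] integrable_of_real[OF gauss_integrable_1]]
  by (simp add: lborel_prod case_prod_unfold gauss2_def[abs_def])

lemma gauss2_fourier: "integral\<^sup>L lborel (\<lambda>z. gauss2 z * cis (s * fst z + t * snd z)) = 2 * pi * gauss2 (s, t)"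
proof -
  have i: "integrable lborel (\<lambda>x. of_real (exp (- x\<^sup>2 / 2)) * cis (s * x))" for s
    by (rule Bochner_Integration.integrable_bound[OF gauss_integrable_1])
       (auto simp: norm_mult cis_conv_exp)
  have "integral\<^sup>L lborel (\<lambda>z. gauss2 z * cis (s * fst z + t * snd z))
     = integral\<^sup>L lborel (\<lambda>z. (of_real (exp (- (fst z)\<^sup>2 / 2)) * cis (s * fst z)) * (of_real (exp (- (snd z)\<^sup>2 / 2)) * cis (t * snd z)))"
    by (simp add: gauss2_def cis_mult[symmetric] mult_ac)
  also have "\<dots> = of_real (sqrt (2 * pi) * exp (- s\<^sup>2 / 2)) * of_real (sqrt (2 * pi) * exp (- t\<^sup>2 / 2))"
    by (subst integral_prod_mult[OF i i]) (simp only: gauss_fourier_1)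
  also have "\<dots> = of_real (sqrt (2 * pi) * sqrt (2 * pi)) * gauss2 (s, t)"
    unfolding gauss2_def by (simp only: of_real_mult fst_conv snd_conv mult_ac)
  finally show ?thesis by simp
qed

text \<open>Gaussian regularisation. The iterated integral does not converge absolutely as a double
  integral, so a wide Gaussian \<open>G n\<close> is inserted. The multiplication formula then turns
  the integral into an average of \<open>u\<close> against a Gaussian of width \<open>e n\<close>
  centred at \<open>- w\<close>.\<close>

lemma fourier2_inversion:
  assumes u: "schwartz u"
  shows "fourier2 (fourier2 u) w = u (- w)"
proof -
  define e where "e n = inverse (real (Suc n))" for n
  have e: "e n > 0" for n by (simp add: e_def)
  have e0: "e \<longlonglongrightarrow> 0" unfolding e_def by (rule LIMSEQ_inverse_real_of_nat)
  \<comment> \<open>With the factor \<open>2 * pi\<close> the transform of \<open>G n\<close> is a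
    multiple of \<open>gauss2\<close> in the variable divided by \<open>e n\<close>.\<close>
  define G where "G n z = gauss2 (2 * pi * e n * fst z, 2 * pi * e n * snd z)" for n z
  have [measurable]: "gauss2 \<in> borel_measurable borel" using gauss2_integrable by auto
  have ub [measurable]: "u \<in> borel_measurable borel" by (rule schwartz_borel[OF u])
  have ui: "integrable lborel u" by (rule schwartz_integrable[OF u])
  have Fi: "integrable lborel (fourier2 u)" by (intro schwartz_integrable schwartz_fourier2 u)
  have normG: "norm (gauss2 z) \<le> 1" for z
    by (simp add: gauss2_def norm_mult exp_add[symmetric] del: exp_add)
  have Gi: "integrable lborel (G n)" for n
    using plane_affine(2)[where f=gauss2 and s=0 and t=0 and a="2*pi*e n" and b="2*pi*e n"] gauss2_integrable e[of n]
    by (simp add: G_def[abs_def])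
  have Gm [measurable]: "G n \<in> borel_measurable borel" for n using Gi by auto
  have FG: "fourier2 (\<lambda>z. G n z * fker z w) v = of_real (inverse (2 * pi * (e n)\<^sup>2)) * gauss2 ((1 / e n) * (fst w + fst v), (1 / e n) * (snd w + snd v))" for n v
  proof -
    have en: "e n \<noteq> 0" using e[of n] by simp
    let ?g = "\<lambda>z. gauss2 z * cis (- ((fst w + fst v) / e n) * fst z + - ((snd w + snd v) / e n) * snd z)"
    have c: "gauss2 (- a, - b) = gauss2 (a, b)" for a b by (simp add: gauss2_def)
    have "2 * pi * gauss2 ((1 / e n) * (fst w + fst v), (1 / e n) * (snd w + snd v)) = integral\<^sup>L lborel ?g"
      by (subst gauss2_fourier) (simp only: c, simp)
    also have "\<dots> = \<bar>(2 * pi * e n) * (2 * pi * e n)\<bar> *\<^sub>R integral\<^sup>L lborel (\<lambda>z. ?g (0 + (2 * pi * e n) * fst z, 0 + (2 * pi * e n) * snd z))"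
      by (rule plane_affine(1)) (use e[of n] in auto)
    also have "(\<lambda>z. ?g (0 + (2 * pi * e n) * fst z, 0 + (2 * pi * e n) * snd z)) = (\<lambda>z. G n z * fker z w * fker z v)"
    proof
      fix z
      have "- ((fst w + fst v) / e n) * (2 * pi * e n * fst z) + - ((snd w + snd v) / e n) * (2 * pi * e n * snd z)
        = - 2 * pi * (fst z * fst w + snd z * snd w) + - 2 * pi * (fst z * fst v + snd z * snd v)"
        using en by (simp add: field_simps)
      then show "?g (0 + (2 * pi * e n) * fst z, 0 + (2 * pi * e n) * snd z) = G n z * fker z w * fker z v"
        by (simp only: G_def fker_def mult.assoc cis_mult add_0 fst_conv snd_conv)
    qed
    finally show ?thesis unfolding fourier2_eq using en
      by (simp add: scaleR_conv_of_real field_simps power2_eq_square)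
  qed
  \<comment> \<open>Rescaling by \<open>e n\<close> around \<open>- w\<close> moves the whole
    dependence on \<open>n\<close> into the argument of \<open>u\<close>.\<close>
  have eq: "integral\<^sup>L lborel (\<lambda>z. G n z * fker z w * fourier2 u z) = integral\<^sup>L lborel (\<lambda>z. of_real (1 / (2 * pi)) * gauss2 z * u (- fst w + e n * fst z, - snd w + e n * snd z))" for n
  proof -
    have en: "e n \<noteq> 0" using e[of n] by simp
    have "integral\<^sup>L lborel (\<lambda>z. G n z * fker z w * fourier2 u z) = integral\<^sup>L lborel (\<lambda>v. fourier2 (\<lambda>z. G n z * fker z w) v * u v)"
      by (rule fourier2_multiplication[OF integrable_fker[OF Gi] ui])
    also have "\<dots> = \<bar>e n * e n\<bar> *\<^sub>R integral\<^sup>L lborel (\<lambda>z. fourier2 (\<lambda>z. G n z * fker z w) (- fst w + e n * fst z, - snd w + e n * snd z) * u (- fst w + e n * fst z, - snd w + e n * snd z))"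
      by (rule plane_affine(1)) (use en in auto)
    also have "\<dots> = integral\<^sup>L lborel (\<lambda>z. \<bar>e n * e n\<bar> *\<^sub>R (fourier2 (\<lambda>z. G n z * fker z w) (- fst w + e n * fst z, - snd w + e n * snd z) * u (- fst w + e n * fst z, - snd w + e n * snd z)))"
      by simp
    also have "\<dots> = integral\<^sup>L lborel (\<lambda>z. of_real (1 / (2 * pi)) * gauss2 z * u (- fst w + e n * fst z, - snd w + e n * snd z))"
      using en by (intro Bochner_Integration.integral_cong refl) (simp add: FG scaleR_conv_of_real field_simps power2_eq_square)
    finally show ?thesis .
  qed
  have lim1: "(\<lambda>n. integral\<^sup>L lborel (\<lambda>z. G n z * fker z w * fourier2 u z)) \<longlonglongrightarrow> integral\<^sup>L lborel (\<lambda>z. fourier2 u z * fker z w)"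
  proof (rule integral_dominated_convergence[where w="\<lambda>z. norm (fourier2 u z)"])
    show "AE z in lborel. (\<lambda>n. G n z * fker z w * fourier2 u z) \<longlonglongrightarrow> fourier2 u z * fker z w"
    proof (intro AE_I2)
      fix z
      have "(\<lambda>n. G n z) \<longlonglongrightarrow> of_real (exp (- (2 * pi * 0 * fst z)\<^sup>2 / 2)) * of_real (exp (- (2 * pi * 0 * snd z)\<^sup>2 / 2))"
        unfolding G_def gauss2_def fst_conv snd_conv by (intro tendsto_intros e0) auto
      then have "(\<lambda>n. G n z * fker z w * fourier2 u z) \<longlonglongrightarrow> 1 * fker z w * fourier2 u z"
        by (intro tendsto_mult tendsto_const) simp
      then show "(\<lambda>n. G n z * fker z w * fourier2 u z) \<longlonglongrightarrow> fourier2 u z * fker z w" by (simp add: mult.commute)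
    qed
    show "AE z in lborel. norm (G n z * fker z w * fourier2 u z) \<le> norm (fourier2 u z)" for n
      by (intro AE_I2) (simp add: norm_mult G_def mult_left_le_one_le normG)
  qed (use Fi in auto)
  obtain B where B: "\<And>z. norm (u z) \<le> B"
    using rapidD[OF schwartz_rapid[OF u], of 0] unfolding power_0 mult_1 by blast
  have "B \<ge> 0" using B[of 0] norm_ge_zero order_trans by blast
  have lim2: "(\<lambda>n. integral\<^sup>L lborel (\<lambda>z. of_real (1 / (2 * pi)) * gauss2 z * u (- fst w + e n * fst z, - snd w + e n * snd z)))
      \<longlonglongrightarrow> integral\<^sup>L lborel (\<lambda>z. of_real (1 / (2 * pi)) * gauss2 z * u (- w))"
  proof (rule integral_dominated_convergence[where w="\<lambda>z. norm (gauss2 z) * B"])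
    show "AE z in lborel. (\<lambda>n. of_real (1 / (2 * pi)) * gauss2 z * u (- fst w + e n * fst z, - snd w + e n * snd z)) \<longlonglongrightarrow> of_real (1 / (2 * pi)) * gauss2 z * u (- w)"
    proof (intro AE_I2 tendsto_mult tendsto_const)
      fix z
      have "(\<lambda>n. (- fst w + e n * fst z, - snd w + e n * snd z)) \<longlonglongrightarrow> (- fst w + 0 * fst z, - snd w + 0 * snd z)"
        by (intro tendsto_intros e0)
      moreover have "(- fst w + 0 * fst z, - snd w + 0 * snd z) = - w" by (cases w) simp
      ultimately have l: "(\<lambda>n. (- fst w + e n * fst z, - snd w + e n * snd z)) \<longlonglongrightarrow> - w" by simp
      have "isCont u (- w)" using schwartz_continuous[OF u, of UNIV] continuous_on_eq_continuous_at[of UNIV u] by blast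
      from isCont_tendsto_compose[OF this l]
      show "(\<lambda>n. u (- fst w + e n * fst z, - snd w + e n * snd z)) \<longlonglongrightarrow> u (- w)" .
    qed
    show "AE z in lborel. norm (of_real (1 / (2 * pi)) * gauss2 z * u (- fst w + e n * fst z, - snd w + e n * snd z)) \<le> norm (gauss2 z) * B" for n
    proof (intro AE_I2)
      fix z
      have "norm (complex_of_real (1 / (2 * pi))) \<le> 1" using pi_ge_two by (simp add: norm_divide)
      then have "norm (complex_of_real (1 / (2 * pi)) * gauss2 z) \<le> norm (gauss2 z)"
        unfolding norm_mult by (intro mult_left_le_one_le) auto
      then show "norm (of_real (1 / (2 * pi)) * gauss2 z * u (- fst w + e n * fst z, - snd w + e n * snd z)) \<le> norm (gauss2 z) * B"
        unfolding norm_mult[of _ "u _"] by (intro mult_mono B) auto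
    qed
  qed (use gauss2_integrable in auto)
  have "integral\<^sup>L lborel gauss2 = 2 * pi * gauss2 (0, 0)"
    using gauss2_fourier[of 0 0] by simp
  also have "gauss2 (0, 0) = 1" by (simp add: gauss2_def)
  finally have g: "integral\<^sup>L lborel gauss2 = 2 * pi" by simp
  have "integral\<^sup>L lborel (\<lambda>z. of_real (1 / (2 * pi)) * gauss2 z * u (- w)) = u (- w)"
    by (simp add: g)
  with lim2 have "(\<lambda>n. integral\<^sup>L lborel (\<lambda>z. G n z * fker z w * fourier2 u z)) \<longlonglongrightarrow> u (- w)"
    by (simp only: eq)
  from LIMSEQ_unique[OF lim1 this] show ?thesis by (simp add: fourier2_eq)
qed

lemma poly2_Asym: "Asym k l c \<in> poly2"
  unfolding Asym_def[abs_def] by (intro poly2_diff poly2_power poly2.mult poly2.const poly2.fst poly2.snd)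

text \<open>Here \<open>u\<close> and \<open>v\<close> are the Fourier transforms of the test functions.\<close>
lemma BE_fourier_side:
  assumes "BE k l \<alpha> \<beta> \<sigma> \<tau>"
  obtains C where "\<And>u v. schwartz u \<Longrightarrow> schwartz v \<Longrightarrow>
     norm (integral\<^sup>L lborel (\<lambda>z. u z * cnj (v z) * of_real (wpow (fst z) \<alpha> * wpow (snd z) \<beta>)))
       \<le> C * L1norm (fourier2 (\<lambda>z. Asym k l \<tau> z * u z)) * L1norm (fourier2 (\<lambda>z. Asym k l \<sigma> z * v z))"
proof -
  obtain C where C: "\<And>f g. schwartz f \<Longrightarrow> schwartz g \<Longrightarrow>
        norm (W2_inner \<alpha> \<beta> f g) \<le> C * L1norm (Lop k l \<tau> f) * L1norm (Lop k l \<sigma> g)"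
    using assms unfolding BE_def by blast
  show ?thesis
  proof (rule that[of C])
    fix u v assume uv: "schwartz u" "schwartz v"
    \<comment> \<open>By inversion these test functions have Fourier transforms \<open>u\<close> and
      \<open>v\<close>, so the transforms themselves can be prescribed.\<close>
    let ?f = "fourier2 (\<lambda>z. u (- z))" and ?g = "fourier2 (\<lambda>z. v (- z))"
    have s: "schwartz ?f" "schwartz ?g" using uv by (auto intro: schwartz_fourier2 schwartz_reflect)
    have ff: "fourier2 ?f = u" "fourier2 ?g = v" using uv by (auto simp: fourier2_inversion schwartz_reflect)
    have L: "L1norm (Lop k l c (fourier2 (\<lambda>z. u (- z)))) = L1norm (fourier2 (\<lambda>z. Asym k l c z * u z))" if u: "schwartz u" for u c
    proof -
      have s: "schwartz (\<lambda>z. Asym k l c z * u z)" by (intro schwartz_poly_mult poly2_Asym u)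
      have "fourier2 (\<lambda>z. Asym k l c (- z) * u (- z)) = (\<lambda>w. fourier2 (\<lambda>z. Asym k l c z * u z) (- w))"
        by (intro ext fourier2_reflect[OF schwartz_borel[OF s]])
      moreover have "L1norm (\<lambda>w. f (- w)) = L1norm f" if "f \<in> borel_measurable borel" for f
      proof -
        have *: "- z = (0 + (-1) * fst z, 0 + (-1) * snd z)" for z :: "real \<times> real" by (cases z) simp
        show ?thesis unfolding L1norm_def
          by (subst plane_affine(1)[where a="-1" and b="-1" and s=0 and t=0 and f="\<lambda>z. norm (f z)"]) (use that in \<open>auto simp: *\<close>)
      qed
      ultimately show ?thesis
        using fourier2_borel[OF schwartz_borel[OF s]] by (simp add: Lop_fourier2[OF u])
    qed
    show "norm (integral\<^sup>L lborel (\<lambda>z. u z * cnj (v z) * of_real (wpow (fst z) \<alpha> * wpow (snd z) \<beta>)))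
       \<le> C * L1norm (fourier2 (\<lambda>z. Asym k l \<tau> z * u z)) * L1norm (fourier2 (\<lambda>z. Asym k l \<sigma> z * v z))"
      using C[OF s] unfolding L[OF uv(1)] L[OF uv(2)] W2_inner_def ff
      by (simp add: case_prod_unfold)
  qed
qed

subsection \<open>The angular average of the symbol\<close>

lemma integrable_powr_tail:
  fixes r :: real
  assumes "r < - 1"
  shows "integrable lborel (\<lambda>s. indicator {1<..} s * s powr r)"
proof -
  have "set_integrable lborel (einterval 1 \<infinity>) (\<lambda>s. s powr r)"
  proof (rule interval_integral_FTC_nonneg(1)[where F="\<lambda>s. s powr (r + 1) / (r + 1)"])
    show "DERIV (\<lambda>s. s powr (r + 1) / (r + 1)) x :> x powr r" if "1 < ereal x" for x
    proof -
      have "x > 1" using that by simp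
      then show ?thesis using assms by (auto intro!: derivative_eq_intros)
    qed
    show "isCont (\<lambda>s. s powr r) x" if "1 < ereal x" for x
    proof -
      have "x > 1" using that by simp
      then show ?thesis by (auto intro!: continuous_intros)
    qed
    have "((\<lambda>s. s powr (r + 1) / (r + 1)) \<longlongrightarrow> 0 / (r + 1)) at_top"
      using assms by (intro tendsto_divide tendsto_neg_powr tendsto_const filterlim_ident) auto
    then show "(((\<lambda>s. s powr (r + 1) / (r + 1)) \<circ> real_of_ereal) \<longlongrightarrow> 0 / (r + 1)) (at_left \<infinity>)"
      by (simp add: ereal_tendsto_simps)
    have "((\<lambda>s. s powr (r + 1) / (r + 1)) \<longlongrightarrow> 1 powr (r + 1) / (r + 1)) (at_right 1)"
      using assms by (intro tendsto_intros) auto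
    then show "(((\<lambda>s. s powr (r + 1) / (r + 1)) \<circ> real_of_ereal) \<longlongrightarrow> 1 powr (r + 1) / (r + 1)) (at_right 1)"
      by (simp add: ereal_tendsto_simps one_ereal_def)
  qed auto
  moreover have "einterval 1 \<infinity> = {1<..}" by (auto simp: einterval_def one_ereal_def)
  ultimately show ?thesis by (simp add: set_integrable_def)
qed

lemma integrable_weight_real:
  fixes q :: real and k :: nat
  assumes "0 \<le> q" "q + 1 < real n"
  shows "integrable lborel (\<lambda>s. indicator {0<..} s * s powr q / (1 + s ^ n))"
proof (rule Bochner_Integration.integrable_bound)
  show "integrable lborel (\<lambda>s. indicator {0..1} s + indicator {1<..} s * s powr (q - real n) :: real)"
    using assms by (intro Bochner_Integration.integrable_add integrable_powr_tail integrable_real_indicator) auto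
  show "(\<lambda>s. indicator {0<..} s * s powr q / (1 + s ^ n)) \<in> borel_measurable lborel" by simp
  show "AE s in lborel. norm (indicator {0<..} s * s powr q / (1 + s ^ n)) \<le> norm (indicator {0..1} s + indicator {1<..} s * s powr (q - real n) :: real)"
  proof (intro AE_I2)
    fix s :: real
    consider "s \<le> 0" | "0 < s" "s \<le> 1" | "1 < s" by linarith
    then show "norm (indicator {0<..} s * s powr q / (1 + s ^ n)) \<le> norm (indicator {0..1} s + indicator {1<..} s * s powr (q - real n) :: real)"
    proof cases
      case 2
      have "s powr q \<le> 1 powr q" using 2 assms by (intro powr_mono2) auto
      then have "s powr q / (1 + s ^ n) \<le> 1" using 2 by (simp add: divide_le_eq add_pos_nonneg add_increasing2)
      then show ?thesis using 2 by (simp add: add_pos_nonneg)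
    next
      case 3
      have "s powr q / (1 + s ^ n) \<le> s powr q / s ^ n" using 3 by (intro divide_left_mono) (auto simp: add_pos_nonneg)
      also have "\<dots> = s powr (q - real n)" using 3 by (simp add: powr_diff powr_realpow)
      finally show ?thesis using 3 by simp
    qed auto
  qed
qed

text \<open>For non-real \<open>z\<close> the imaginary part bounds the modulus from below, and the
  triangle inequality upgrades this to linear growth in \<open>s\<close>. For positive
  \<open>z\<close> nothing cancels.\<close>

lemma slit_lower_bound:
  fixes z :: complex
  assumes "z \<notin> \<real>\<^sub>\<le>\<^sub>0"
  obtains c where "c > 0" "\<And>s. s \<ge> 0 \<Longrightarrow> c * (1 + s) \<le> norm (of_real s + z)"
proof (cases "Im z = 0")
  case True
  then have z: "z = of_real (Re z)" "Re z > 0" using assms by (auto simp: complex_eq_iff complex_nonpos_Reals_iff)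
  show ?thesis
  proof (rule that[of "min 1 (Re z)"])
    fix s :: real assume "s \<ge> 0"
    have "norm (of_real s + z) = \<bar>s + Re z\<bar>" by (subst z(1)) (simp only: of_real_add[symmetric] norm_of_real)
    also have "\<dots> = s + Re z" using z \<open>s \<ge> 0\<close> by simp
    also have "\<dots> \<ge> min 1 (Re z) * s + min 1 (Re z) * 1"
      using \<open>s \<ge> 0\<close> z by (intro add_mono) (auto simp: mult_left_le_one_le)
    finally show "min 1 (Re z) * (1 + s) \<le> norm (of_real s + z)" by (simp add: algebra_simps)
  qed (use z in auto)
next
  case False
  \<comment> \<open>The triangle inequality gives \<open>1 + s \<le> ?n + (1 + norm z)\<close>, and
    the last bracket is at most \<open>(1 + norm z) / abs (Im z)\<close> times
    \<open>?n\<close>.\<close>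
  define B where "B = 1 + (1 + norm z) / \<bar>Im z\<bar>"
  have B: "B > 0" unfolding B_def by (intro add_pos_nonneg) auto
  show ?thesis
  proof (rule that[of "1 / B"])
    fix s :: real assume "s \<ge> 0"
    let ?n = "norm (of_real s + z)"
    have 1: "\<bar>Im z\<bar> \<le> ?n" using abs_Im_le_cmod[of "of_real s + z"] by simp
    have 2: "s \<le> ?n + norm z"
      using norm_triangle_ineq4[of "of_real s + z" z] \<open>s \<ge> 0\<close> by simp
    have "1 + norm z \<le> ?n * ((1 + norm z) / \<bar>Im z\<bar>)"
      using mult_right_mono[OF 1, of "(1 + norm z) / \<bar>Im z\<bar>"] False by (simp add: divide_simps)
    then have "1 + s \<le> ?n * B" using 2 by (simp add: B_def algebra_simps)
    then show "1 / B * (1 + s) \<le> ?n" using B by (simp add: divide_simps mult.commute)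
  qed (use B in auto)
qed

text \<open>The antiderivative of the power with exponent \<open>p - 1\<close> that vanishes at 1.
  The case \<open>p = 0\<close> is the limit of the general formula.\<close>

definition Ep :: "real \<Rightarrow> complex \<Rightarrow> complex" where
  "Ep p z = (if p = 0 then Ln z else (exp (p * Ln z) - 1) / p)"

text \<open>Used with \<open>q = 2 * \<alpha>\<close>, where the integrands are the symbol on a
  half-line. The second assumption is convergence at infinity against two factors of degree
  \<open>k\<close>.\<close>

locale mellin =
  fixes q :: real and k :: nat
  assumes q0: "0 \<le> q" and qk: "q + 1 < 2 * real k"
begin

text \<open>\<open>J\<close> is homogeneous of degree \<open>p - 1\<close> in its two arguments, so
  \<open>p\<close> is the exponent of its antiderivative \<open>D\<close>.\<close>

definition p :: real where "p = (q + 1) / real k - 1"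

definition W :: "real \<Rightarrow> real" where "W s = indicator {0<..} s * s powr q"

text \<open>A single factor \<open>1 / (s ^ k + z)\<close> need not be integrable against
  \<open>W\<close>, but its difference from the one with \<open>z = 1\<close> is. \<open>J\<close>
  is then the divided difference of \<open>D\<close>.\<close>

definition D :: "complex \<Rightarrow> complex" where
  "D z = integral\<^sup>L lborel (\<lambda>s. of_real (W s) * (1 / (of_real (s ^ k) + 1) - 1 / (of_real (s ^ k) + z)))"

definition J :: "complex \<Rightarrow> complex \<Rightarrow> complex" where
  "J z w = integral\<^sup>L lborel (\<lambda>s. of_real (W s) / ((of_real (s ^ k) + z) * (of_real (s ^ k) + w)))"

lemma k0: "k > 0" using q0 qk by (cases k) auto

lemma p_bounds: "- 1 < p" "p < 1"
  using q0 qk k0 by (auto simp: p_def field_simps)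

lemma W_nonneg: "W s \<ge> 0" by (simp add: W_def)

lemma W_measurable [measurable]: "W \<in> borel_measurable borel"
  unfolding W_def[abs_def] by measurable

lemma W_integrable: "integrable lborel (\<lambda>s. W s / (1 + s ^ k)\<^sup>2)"
proof (rule Bochner_Integration.integrable_bound)
  show "integrable lborel (\<lambda>s. indicator {0<..} s * s powr q / (1 + s ^ (2 * k)))"
    using q0 qk by (intro integrable_weight_real) auto
  show "AE s in lborel. norm (W s / (1 + s ^ k)\<^sup>2) \<le> norm (indicator {0<..} s * s powr q / (1 + s ^ (2 * k)))"
  proof (intro AE_I2)
    fix s :: real
    show "norm (W s / (1 + s ^ k)\<^sup>2) \<le> norm (indicator {0<..} s * s powr q / (1 + s ^ (2 * k)))"
    proof (cases "s > 0")
      case True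
      have "1 + s ^ (2 * k) \<le> (1 + s ^ k)\<^sup>2" using True by (simp add: power2_sum power_mult[symmetric] mult.commute)
      moreover have "0 < 1 + s ^ k" "0 < 1 + s ^ (2 * k)" using True by (auto simp: add_pos_nonneg)
      ultimately have "s powr q / (1 + s ^ k)\<^sup>2 \<le> s powr q / (1 + s ^ (2 * k))"
        by (intro divide_left_mono mult_pos_pos zero_less_power) auto
      then show ?thesis using True by (simp add: W_def add_pos_nonneg)
    qed (simp add: W_def)
  qed
qed measurable

lemma dominated:
  fixes F :: "real \<Rightarrow> complex"
  assumes [measurable]: "F \<in> borel_measurable borel"
    and "\<And>s. s > 0 \<Longrightarrow> norm (F s) \<le> C / (1 + s ^ k)\<^sup>2"
  shows "integrable lborel (\<lambda>s. of_real (W s) * F s)"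
    and "norm (integral\<^sup>L lborel (\<lambda>s. of_real (W s) * F s)) \<le> C * integral\<^sup>L lborel (\<lambda>s. W s / (1 + s ^ k)\<^sup>2)"
proof -
  have *: "norm (of_real (W s) * F s) \<le> C * (W s / (1 + s ^ k)\<^sup>2)" for s
  proof (cases "s > 0")
    case True
    then have "W s * norm (F s) \<le> W s * (C / (1 + s ^ k)\<^sup>2)"
      by (intro mult_left_mono assms W_nonneg)
    then show ?thesis by (simp add: norm_mult W_nonneg mult_ac)
  qed (simp add: W_def)
  have i: "integrable lborel (\<lambda>s. C * (W s / (1 + s ^ k)\<^sup>2))" by (rule integrable_mult_right[OF W_integrable])
  show 1: "integrable lborel (\<lambda>s. of_real (W s) * F s)"
    by (rule Bochner_Integration.integrable_bound[OF i]) (use order_trans[OF * abs_ge_self] in auto)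
  have "norm (integral\<^sup>L lborel (\<lambda>s. of_real (W s) * F s)) \<le> integral\<^sup>L lborel (\<lambda>s. C * (W s / (1 + s ^ k)\<^sup>2))"
    by (rule order_trans[OF integral_norm_bound integral_mono]) (use 1 i * in auto)
  then show "norm (integral\<^sup>L lborel (\<lambda>s. of_real (W s) * F s)) \<le> C * integral\<^sup>L lborel (\<lambda>s. W s / (1 + s ^ k)\<^sup>2)"
    by (simp only: integral_mult_right_zero)
qed

lemma J_integrable:
  fixes z w :: complex
  assumes "z \<notin> \<real>\<^sub>\<le>\<^sub>0" "w \<notin> \<real>\<^sub>\<le>\<^sub>0"
  shows "integrable lborel (\<lambda>s. of_real (W s) / ((of_real (s ^ k) + z) * (of_real (s ^ k) + w)))"
proof -
  obtain c where c: "c > 0" "\<And>s. s \<ge> 0 \<Longrightarrow> c * (1 + s) \<le> norm (of_real s + z)"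
    using slit_lower_bound[OF assms(1)] by blast
  obtain d where d: "d > 0" "\<And>s. s \<ge> 0 \<Longrightarrow> d * (1 + s) \<le> norm (of_real s + w)"
    using slit_lower_bound[OF assms(2)] by blast
  have "norm (1 / ((of_real (s ^ k) + z) * (of_real (s ^ k) + w))) \<le> (1 / (c * d)) / (1 + s ^ k)\<^sup>2" if "s > 0" for s
  proof -
    have "s ^ k \<ge> 0" using that by simp
    then have "(c * (1 + s ^ k)) * (d * (1 + s ^ k)) \<le> norm (of_real (s ^ k) + z) * norm (of_real (s ^ k) + w)"
      using c(1) d(1) by (intro mult_mono c(2) d(2)) auto
    moreover have "0 < (c * (1 + s ^ k)) * (d * (1 + s ^ k))" using c d that by (simp add: add_pos_nonneg)
    ultimately have "1 / (norm (of_real (s ^ k) + z) * norm (of_real (s ^ k) + w)) \<le> 1 / ((c * (1 + s ^ k)) * (d * (1 + s ^ k)))"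
      by (intro frac_le) auto
    then show ?thesis by (simp add: norm_divide norm_mult power2_eq_square mult_ac)
  qed
  from dominated(1)[OF _ this] show ?thesis by simp
qed

lemma one_slit: "(1::complex) \<notin> \<real>\<^sub>\<le>\<^sub>0" by (simp add: complex_nonpos_Reals_iff)

lemma slit_add_nz:
  assumes "z \<notin> \<real>\<^sub>\<le>\<^sub>0" "s \<ge> 0"
  shows "complex_of_real s + z \<noteq> 0"
proof -
  obtain c where "c > 0" "\<And>s. s \<ge> 0 \<Longrightarrow> c * (1 + s) \<le> norm (of_real s + z)"
    using slit_lower_bound[OF assms(1)] by blast
  from this(1) this(2)[OF assms(2)] show ?thesis using assms(2)
    by (metis add_nonneg_pos mult_pos_pos norm_zero not_less zero_less_one add.commute)
qed

lemma D_alt: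
  assumes "z \<notin> \<real>\<^sub>\<le>\<^sub>0"
  shows "D z = (z - 1) * J z 1"
    and "integrable lborel (\<lambda>s. of_real (W s) * (1 / (of_real (s ^ k) + 1) - 1 / (of_real (s ^ k) + z)))"
proof -
  have *: "(\<lambda>s. of_real (W s) * (1 / (of_real (s ^ k) + 1) - 1 / (of_real (s ^ k) + z)))
    = (\<lambda>s. (z - 1) * (of_real (W s) / ((of_real (s ^ k) + z) * (of_real (s ^ k) + 1))))"
  proof
    fix s
    show "of_real (W s) * (1 / (of_real (s ^ k) + 1) - 1 / (of_real (s ^ k) + z))
      = (z - 1) * (of_real (W s) / ((of_real (s ^ k) + z) * (of_real (s ^ k) + 1)))"
    proof (cases "s > 0")
      case True
      then have "s ^ k \<ge> 0" by simp
      from slit_add_nz[OF assms this] slit_add_nz[OF one_slit this]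
      show ?thesis by (simp add: divide_simps; simp add: algebra_simps)
    qed (simp add: W_def)
  qed
  show "D z = (z - 1) * J z 1" unfolding D_def * J_def by (rule integral_mult_right_zero)
  show "integrable lborel (\<lambda>s. of_real (W s) * (1 / (of_real (s ^ k) + 1) - 1 / (of_real (s ^ k) + z)))"
    unfolding * by (intro integrable_mult_right J_integrable assms one_slit)
qed

lemma D_diff:
  assumes "z \<notin> \<real>\<^sub>\<le>\<^sub>0" "w \<notin> \<real>\<^sub>\<le>\<^sub>0"
  shows "D z - D w = (z - w) * J z w"
proof -
  have "D z - D w = integral\<^sup>L lborel (\<lambda>s. of_real (W s) * (1 / (of_real (s ^ k) + 1) - 1 / (of_real (s ^ k) + z))
      - of_real (W s) * (1 / (of_real (s ^ k) + 1) - 1 / (of_real (s ^ k) + w)))"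
    unfolding D_def by (rule Bochner_Integration.integral_diff[symmetric]) (intro D_alt assms)+
  also have "\<dots> = integral\<^sup>L lborel (\<lambda>s. (z - w) * (of_real (W s) / ((of_real (s ^ k) + z) * (of_real (s ^ k) + w))))"
  proof (rule Bochner_Integration.integral_cong[OF refl])
    fix s
    show "of_real (W s) * (1 / (of_real (s ^ k) + 1) - 1 / (of_real (s ^ k) + z))
      - of_real (W s) * (1 / (of_real (s ^ k) + 1) - 1 / (of_real (s ^ k) + w))
      = (z - w) * (of_real (W s) / ((of_real (s ^ k) + z) * (of_real (s ^ k) + w)))"
    proof (cases "s > 0")
      case True
      then have "s ^ k \<ge> 0" by simp
      from slit_add_nz[OF assms(1) this] slit_add_nz[OF assms(2) this]
      show ?thesis by (simp add: right_diff_distrib divide_simps; simp add: algebra_simps)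
    qed (simp add: W_def)
  qed
  also have "\<dots> = (z - w) * J z w" by (simp only: J_def integral_mult_right_zero)
  finally show ?thesis .
qed

text \<open>By \<open>D_diff\<close> the difference quotient is \<open>J (z + h) z\<close>; its
  distance from \<open>J z z\<close> is dominated by a constant times \<open>norm h\<close>.\<close>

lemma D_has_field_derivative:
  assumes z: "z \<notin> \<real>\<^sub>\<le>\<^sub>0"
  shows "(D has_field_derivative J z z) (at z)"
proof -
  obtain c where c: "c > 0" "\<And>s. s \<ge> 0 \<Longrightarrow> c * (1 + s) \<le> norm (of_real s + z)"
    using slit_lower_bound[OF z] by blast
  define B where "B = 2 / c ^ 3 * integral\<^sup>L lborel (\<lambda>s. W s / (1 + s ^ k)\<^sup>2)"
  have "open (- \<real>\<^sub>\<le>\<^sub>0 :: complex set)" by (simp add: open_Compl)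
  then obtain d where d: "d > 0" "ball z d \<subseteq> - \<real>\<^sub>\<le>\<^sub>0"
    using z by (metis ComplI openE)
  \<comment> \<open>A shift \<open>h\<close> shorter than \<open>c / 2\<close> uses up at most half
    of the lower bound for \<open>s ^ k + z\<close>.\<close>
  have bd: "norm ((D (z + h) - D z) / h - J z z) \<le> B * norm h" if h: "h \<noteq> 0" "norm h < min d (c / 2)" for h
  proof -
    have zh: "z + h \<notin> \<real>\<^sub>\<le>\<^sub>0" using d h by (auto simp: subset_iff dist_norm)
    have eq: "(D (z + h) - D z) / h - J z z = J (z + h) z - J z z"
      using D_diff[OF zh z] h by simp
    also have "\<dots> = integral\<^sup>L lborel (\<lambda>s. of_real (W s) / ((of_real (s ^ k) + (z + h)) * (of_real (s ^ k) + z))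
          - of_real (W s) / ((of_real (s ^ k) + z) * (of_real (s ^ k) + z)))"
      unfolding J_def by (rule Bochner_Integration.integral_diff[symmetric]) (intro J_integrable z zh)+
    also have "\<dots> = integral\<^sup>L lborel (\<lambda>s. of_real (W s) * (- h / ((of_real (s ^ k) + (z + h)) * ((of_real (s ^ k) + z) * (of_real (s ^ k) + z)))))"
    proof (rule Bochner_Integration.integral_cong[OF refl])
      fix s
      show "of_real (W s) / ((of_real (s ^ k) + (z + h)) * (of_real (s ^ k) + z))
          - of_real (W s) / ((of_real (s ^ k) + z) * (of_real (s ^ k) + z))
         = of_real (W s) * (- h / ((of_real (s ^ k) + (z + h)) * ((of_real (s ^ k) + z) * (of_real (s ^ k) + z))))"
      proof (cases "s > 0")
        case True
        then have "s ^ k \<ge> 0" by simp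
        from slit_add_nz[OF z this] slit_add_nz[OF zh this]
        show ?thesis by (simp add: divide_simps; simp add: algebra_simps)
      qed (simp add: W_def)
    qed
    finally have eq2: "(D (z + h) - D z) / h - J z z = \<dots>" .
    have "norm (- h / ((of_real (s ^ k) + (z + h)) * ((of_real (s ^ k) + z) * (of_real (s ^ k) + z)))) \<le> (2 / c ^ 3 * norm h) / (1 + s ^ k)\<^sup>2" if "s > 0" for s
    proof -
      have s: "s ^ k \<ge> 0" using that by simp
      have 1: "c * (1 + s ^ k) \<le> norm (of_real (s ^ k) + z)" using c s by blast
      have "norm (of_real (s ^ k) + z) \<le> norm (of_real (s ^ k) + (z + h)) + norm h"
        using norm_triangle_ineq4[of "of_real (s ^ k) + (z + h)" h] by (simp add: add.assoc[symmetric])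
      moreover have "c / 2 * 1 \<le> c / 2 * (1 + s ^ k)" using c(1) s by (intro mult_left_mono) auto
      then have "norm h \<le> c / 2 * (1 + s ^ k)" using h by linarith
      ultimately have 2: "c / 2 * (1 + s ^ k) \<le> norm (of_real (s ^ k) + (z + h))" using 1 by (simp add: algebra_simps)
      have s1: "1 + s ^ k \<ge> 1" using s by simp
      \<comment> \<open>The third power of \<open>1 + s ^ k\<close> is lowered to the second in
        order to match the majorant in \<open>dominated\<close>.\<close>
      have "c ^ 3 / 2 * (1 + s ^ k)\<^sup>2 \<le> c ^ 3 / 2 * (1 + s ^ k) ^ 3"
        using c(1) s1 by (intro mult_left_mono power_increasing) auto
      also have "\<dots> = (c / 2 * (1 + s ^ k)) * ((c * (1 + s ^ k)) * (c * (1 + s ^ k)))"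
        by (simp add: power3_eq_cube)
      also have "\<dots> \<le> norm (of_real (s ^ k) + (z + h)) * (norm (of_real (s ^ k) + z) * norm (of_real (s ^ k) + z))"
        using 1 2 c(1) s1 by (intro mult_mono) auto
      finally have 3: "c ^ 3 / 2 * (1 + s ^ k)\<^sup>2 \<le> \<dots>" .
      have "0 < c ^ 3 / 2 * (1 + s ^ k)\<^sup>2" using c(1) s1 by simp
      then have "norm h / (norm (of_real (s ^ k) + (z + h)) * (norm (of_real (s ^ k) + z) * norm (of_real (s ^ k) + z))) \<le> norm h / (c ^ 3 / 2 * (1 + s ^ k)\<^sup>2)"
        using 3 by (intro divide_left_mono mult_pos_pos[of _ "c ^ 3 / 2 * (1 + s ^ k)\<^sup>2"]) auto
      then show ?thesis by (simp add: norm_divide norm_mult mult_ac)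
    qed
    from dominated(2)[OF _ this] show ?thesis unfolding eq2 B_def by (simp add: mult_ac)
  qed
  have "(\<lambda>h. (D (z + h) - D z) / h - J z z) \<midarrow>0\<rightarrow> 0"
  proof (rule Lim_null_comparison)
    show "\<forall>\<^sub>F h in at 0. norm ((D (z + h) - D z) / h - J z z) \<le> B * norm h"
      unfolding eventually_at using bd d c by (intro exI[of _ "min d (c / 2)"]) auto
    show "((\<lambda>h. B * norm h) \<longlongrightarrow> 0) (at (0 :: complex))"
      by (auto intro!: tendsto_eq_intros)
  qed
  then show ?thesis unfolding DERIV_def by (rule LIM_zero_cancel)
qed

definition K :: real where "K = integral\<^sup>L lborel (\<lambda>s. W s / (1 + s ^ k)\<^sup>2)"

lemma J11: "J 1 1 = of_real K"
proof -
  have "J 1 1 = integral\<^sup>L lborel (\<lambda>s. complex_of_real (W s / (1 + s ^ k)\<^sup>2))"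
    unfolding J_def by (simp add: power2_eq_square add.commute)
  then show ?thesis by (simp only: integral_complex_of_real K_def)
qed

text \<open>On \<open>{1..2}\<close> the integrand is at least a positive constant. \<open>K\<close>
  is divided out whenever the vanishing of \<open>J\<close> is decided.\<close>

lemma K_pos: "K > 0"
proof -
  have "integral\<^sup>L lborel (\<lambda>s::real. indicator {1..2} s / (1 + 2 ^ k)\<^sup>2) \<le> K"
    unfolding K_def
  proof (rule integral_mono[OF _ W_integrable])
    show "integrable lborel (\<lambda>s::real. indicator {1..2} s / (1 + 2 ^ k)\<^sup>2 :: real)"
      by (intro integrable_divide integrable_real_indicator) auto
    fix s :: real
    show "indicator {1..2} s / (1 + 2 ^ k)\<^sup>2 \<le> W s / (1 + s ^ k)\<^sup>2"
    proof (cases "s \<in> {1..2}")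
      case True
      then have "1 \<le> W s" using q0 by (simp add: W_def ge_one_powr_ge_zero)
      moreover have "(1 + s ^ k)\<^sup>2 \<le> (1 + 2 ^ k)\<^sup>2" using True by (intro power_mono add_left_mono) auto
      ultimately have "1 / (1 + 2 ^ k)\<^sup>2 \<le> W s / (1 + s ^ k)\<^sup>2"
        using True by (intro frac_le zero_less_power) (auto simp: add_pos_nonneg)
      then show ?thesis using True by simp
    qed (use W_nonneg[of s] in simp)
  qed
  moreover have "integral\<^sup>L lborel (\<lambda>s::real. indicator {1..2} s / (1 + 2 ^ k)\<^sup>2 :: real) = 1 / (1 + 2 ^ k)\<^sup>2"
    by simp
  moreover have "(0::real) < 1 + 2 ^ k" by (simp add: add_pos_nonneg)
  then have "(0::real) < 1 / (1 + 2 ^ k)\<^sup>2" by simp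
  ultimately show ?thesis by linarith
qed

text \<open>Substitution \<open>s = c * t\<close> with \<open>c ^ k = r\<close>: the weight and
  \<open>ds\<close> contribute \<open>r powr (p + 1)\<close>, the denominators
  \<open>1 / r ^ 2\<close>.\<close>

lemma J_scale:
  assumes "r > 0"
  shows "J (of_real r * z) (of_real r * w) = of_real (r powr (p - 1)) * J z w"
proof -
  define c where "c = r powr (1 / real k)"
  have c: "c > 0" "c ^ k = r" using assms k0 by (auto simp: c_def powr_powr powr_realpow[symmetric])
  have cq: "c * c powr q = r powr (p + 1)"
  proof -
    have "c * c powr q = c powr (1 + q)" using c by (simp add: powr_add)
    also have "\<dots> = r powr (p + 1)" by (simp add: c_def powr_powr p_def add.commute)
    finally show ?thesis .
  qed
  have Wc: "W (c * t) = c powr q * W t" for t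
    using c by (auto simp: W_def indicator_def powr_mult zero_less_mult_iff)
  have "J (of_real r * z) (of_real r * w) = c *\<^sub>R integral\<^sup>L lborel (\<lambda>t. of_real (W (0 + c * t)) / ((of_real ((0 + c * t) ^ k) + of_real r * z) * (of_real ((0 + c * t) ^ k) + of_real r * w)))"
    unfolding J_def by (subst lborel_integral_real_affine[of c _ 0]) (use c in simp_all)
  also have "\<dots> = c *\<^sub>R integral\<^sup>L lborel (\<lambda>t. of_real (c powr q / r\<^sup>2) * (of_real (W t) / ((of_real (t ^ k) + z) * (of_real (t ^ k) + w))))"
  proof -
    have "of_real (W (0 + c * t)) / ((of_real ((0 + c * t) ^ k) + of_real r * z) * (of_real ((0 + c * t) ^ k) + of_real r * w))
        = of_real (c powr q / r\<^sup>2) * (of_real (W t) / ((of_real (t ^ k) + z) * (of_real (t ^ k) + w)))" for t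
    proof -
      have "of_real ((0 + c * t) ^ k) + of_real r * x = of_real r * (of_real (t ^ k) + x)" for x :: complex
        using c by (simp add: power_mult_distrib algebra_simps)
      then show ?thesis by (simp add: Wc power2_eq_square mult_ac)
    qed
    then show ?thesis by simp
  qed
  also have "\<dots> = of_real (c * c powr q / r\<^sup>2) * J z w"
    unfolding J_def integral_mult_right_zero by (simp add: scaleR_conv_of_real)
  also have "c * c powr q / r\<^sup>2 = r powr (p - 1)"
    unfolding cq using assms by (simp add: powr_diff powr_add power2_eq_square)
  finally show ?thesis .
qed

lemma slit_scale: "z \<notin> \<real>\<^sub>\<le>\<^sub>0 \<Longrightarrow> r > 0 \<Longrightarrow> of_real r * z \<notin> \<real>\<^sub>\<le>\<^sub>0" for z :: complex
  by (auto simp: complex_nonpos_Reals_iff zero_less_mult_iff mult_le_0_iff)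

text \<open>The homogeneity of \<open>J\<close>, read as a statement on \<open>D\<close>. The term
  \<open>D r\<close> appears because scaling moves the base point 1 of \<open>D\<close> to
  \<open>r\<close>.\<close>

lemma D_scale:
  assumes "r > 0" "z \<notin> \<real>\<^sub>\<le>\<^sub>0"
  shows "D (of_real r * z) = of_real (r powr p) * D z + D (of_real r)"
proof -
  have r: "of_real r \<notin> (\<real>\<^sub>\<le>\<^sub>0 :: complex set)" using slit_scale[OF one_slit assms(1)] by simp
  have "D (of_real r * z) - D (of_real r) = (of_real r * z - of_real r) * J (of_real r * z) (of_real r * 1)"
    using D_diff[OF slit_scale[OF assms(2,1)] r] by simp
  also have "\<dots> = of_real (r * r powr (p - 1)) * ((z - 1) * J z 1)"
    unfolding J_scale[OF assms(1)] by (simp add: algebra_simps)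
  also have "r * r powr (p - 1) = r powr p" using assms by (simp add: powr_diff)
  also have "(z - 1) * J z 1 = D z" by (rule D_alt(1)[OF assms(2), symmetric])
  finally show ?thesis by (simp add: algebra_simps)
qed

text \<open>Obtained by differentiating \<open>D_scale\<close> in \<open>r\<close> at \<open>r = 1\<close>.\<close>
lemma D_ode:
  assumes z: "z \<notin> \<real>\<^sub>\<le>\<^sub>0"
  shows "z * J z z = of_real p * D z + of_real K"
proof -
  have 1: "((\<lambda>r. D (of_real r * z)) has_vector_derivative J z z * z) (at 1)"
  proof (rule has_vector_derivative_real_field[of "\<lambda>r. D (r * z)"])
    have "((\<lambda>r. r * z) has_field_derivative z) (at (of_real 1))" by (auto intro!: derivative_eq_intros)
    from DERIV_chain2[OF _ this, of D "J z z"] D_has_field_derivative[OF z]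
    show "((\<lambda>r. D (r * z)) has_field_derivative J z z * z) (at (of_real 1))" by simp
  qed
  have 2: "((\<lambda>r. of_real (r powr p) * D z + D (of_real r)) has_vector_derivative of_real p * D z + J 1 1) (at 1)"
  proof -
    have "((\<lambda>r. r powr p) has_real_derivative p) (at 1)" by (auto intro!: derivative_eq_intros)
    then have "((\<lambda>r. complex_of_real (r powr p)) has_vector_derivative of_real p) (at 1)"
      by (simp add: has_real_derivative_iff_has_vector_derivative has_vector_derivative_of_real)
    moreover have "((\<lambda>r. D (of_real r)) has_vector_derivative J 1 1) (at 1)"
      by (rule has_vector_derivative_real_field) (use D_has_field_derivative[OF one_slit] in simp)
    ultimately show ?thesis
      by (intro has_vector_derivative_add has_vector_derivative_mult_left)
  qed
  have "((\<lambda>r. D (of_real r * z)) has_vector_derivative of_real p * D z + J 1 1) (at 1)"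
    by (rule has_vector_derivative_transform_within_open[OF 2, of "{0<..}"]) (auto simp: D_scale[OF _ z])
  from vector_derivative_unique_at[OF 1 this] show ?thesis by (simp add: J11 mult.commute)
qed

lemma slit_constant:
  fixes H :: "complex \<Rightarrow> complex"
  assumes "\<And>z. z \<notin> \<real>\<^sub>\<le>\<^sub>0 \<Longrightarrow> (H has_field_derivative 0) (at z)" "z \<notin> \<real>\<^sub>\<le>\<^sub>0"
  shows "H z = H 1"
proof -
  have "(- \<real>\<^sub>\<le>\<^sub>0 :: complex set) = - (complex_of_real ` {..0})"
    by (simp add: nonpos_Reals_def setcompr_eq_image atMost_def)
  then have "connected (- \<real>\<^sub>\<le>\<^sub>0 :: complex set)"
    using starlike_imp_connected[OF starlike_slotted_complex_plane_left[of 0]] by simp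
  moreover have "open (- \<real>\<^sub>\<le>\<^sub>0 :: complex set)" by (simp add: open_Compl)
  moreover have "continuous_on (- \<real>\<^sub>\<le>\<^sub>0) H"
    using assms(1) by (intro continuous_at_imp_continuous_on) (auto intro: DERIV_isCont)
  ultimately obtain c where "\<And>z. z \<in> - \<real>\<^sub>\<le>\<^sub>0 \<Longrightarrow> H z = c"
    using DERIV_zero_connected_constant[of "- \<real>\<^sub>\<le>\<^sub>0" "{}" H] assms(1) by auto
  then show ?thesis using assms(2) one_slit by simp
qed

text \<open>Since \<open>J z z\<close> is the derivative of \<open>D\<close>, \<open>D_ode\<close>
  is a linear equation of first order. For \<open>p = 0\<close> subtracting a logarithm leaves a
  constant, otherwise an integrating factor does; \<open>D 1 = 0\<close> fixes it.\<close>

lemma D_eq: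
  assumes z: "z \<notin> \<real>\<^sub>\<le>\<^sub>0"
  shows "D z = of_real K * Ep p z"
proof (cases "p = 0")
  case True
  have "D z - of_real K * Ln z = D 1 - of_real K * Ln 1"
  proof (rule slit_constant[OF _ z])
    fix z :: complex assume z: "z \<notin> \<real>\<^sub>\<le>\<^sub>0"
    then have nz: "z \<noteq> 0" by auto
    have "J z z - of_real K * (1 / z) = 0" using D_ode[OF z] True nz by (simp add: field_simps)
    moreover have "((\<lambda>z. D z - of_real K * Ln z) has_field_derivative (J z z - of_real K * (1 / z))) (at z)"
      using z nz by (auto intro!: derivative_eq_intros D_has_field_derivative simp: divide_inverse)
    ultimately show "((\<lambda>z. D z - of_real K * Ln z) has_field_derivative 0) (at z)" by simp
  qed
  then show ?thesis using D_alt(1)[OF one_slit] True by (simp add: Ep_def)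
next
  case False
  have "exp (- (of_real p * Ln z)) * (D z + of_real K / of_real p) = exp (- (of_real p * Ln 1)) * (D 1 + of_real K / of_real p)"
  proof (rule slit_constant[OF _ z])
    fix z :: complex assume z: "z \<notin> \<real>\<^sub>\<le>\<^sub>0"
    then have nz: "z \<noteq> 0" by auto
    have J: "J z z = (of_real p * D z + of_real K) / z" using D_ode[OF z] nz by (simp add: field_simps)
    have "((\<lambda>z. exp (- (of_real p * Ln z)) * (D z + of_real K / of_real p)) has_field_derivative
        (exp (- (of_real p * Ln z)) * (- (of_real p * inverse z))) * (D z + of_real K / of_real p) + J z z * exp (- (of_real p * Ln z))) (at z)"
      using z nz by (auto intro!: derivative_eq_intros D_has_field_derivative simp: divide_inverse)
    moreover have "(exp (- (of_real p * Ln z)) * (- (of_real p * inverse z))) * (D z + of_real K / of_real p) + J z z * exp (- (of_real p * Ln z)) = 0"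
      using nz False unfolding J by (simp add: field_simps)
    ultimately show "((\<lambda>z. exp (- (of_real p * Ln z)) * (D z + of_real K / of_real p)) has_field_derivative 0) (at z)"
      by simp
  qed
  then have *: "exp (- (of_real p * Ln z)) * (D z + of_real K / of_real p) = of_real K / of_real p"
    using D_alt(1)[OF one_slit] by simp
  have "D z + of_real K / of_real p = exp (of_real p * Ln z) * (exp (- (of_real p * Ln z)) * (D z + of_real K / of_real p))"
    by (simp add: exp_minus)
  then have "D z + of_real K / of_real p = exp (of_real p * Ln z) * (of_real K / of_real p)"
    unfolding * .
  then show ?thesis using False by (simp add: Ep_def field_simps)
qed

lemma Jzz_eq:
  assumes z: "z \<notin> \<real>\<^sub>\<le>\<^sub>0"
  shows "J z z = of_real K * exp (of_real p * Ln z) / z"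
proof -
  have "z \<noteq> 0" using z by auto
  moreover have "of_real p * D z + of_real K = of_real K * exp (of_real p * Ln z)"
  proof -
    have "of_real p * Ep p z = exp (of_real p * Ln z) - 1" by (simp add: Ep_def)
    moreover have "of_real p * D z + of_real K = of_real K * (of_real p * Ep p z + 1)"
      unfolding D_eq[OF z] by (simp add: algebra_simps)
    ultimately show ?thesis by simp
  qed
  ultimately show ?thesis using D_ode[OF z] by (simp add: field_simps)
qed

lemma J_eq:
  assumes "z \<notin> \<real>\<^sub>\<le>\<^sub>0" "w \<notin> \<real>\<^sub>\<le>\<^sub>0" "z \<noteq> w"
  shows "J z w = of_real K * (Ep p z - Ep p w) / (z - w)"
  using D_diff[OF assms(1,2)] assms by (simp add: D_eq field_simps)

text \<open>A divided difference of \<open>Ep p\<close> vanishes only if \<open>Ep p\<close> repeats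
  a value. As \<open>abs p < 1\<close>, the imaginary parts of \<open>p * Ln\<close> at two points
  differ by less than \<open>2 * pi\<close>, so the power is injective. On the diagonal
  \<open>J\<close> is an explicit non-zero multiple of a power.\<close>

lemma J_nonzero:
  assumes z: "z \<notin> \<real>\<^sub>\<le>\<^sub>0" and w: "w \<notin> \<real>\<^sub>\<le>\<^sub>0"
  shows "J z w \<noteq> 0"
proof (cases "z = w")
  case True
  have "z \<noteq> 0" using z by auto
  then show ?thesis using K_pos True by (simp add: Jzz_eq[OF z, unfolded True] True)
next
  case False
  have nz: "z \<noteq> 0" "w \<noteq> 0" using z w by auto
  have "Ep p z \<noteq> Ep p w"
  proof
    assume eq: "Ep p z = Ep p w"
    have "Ln z = Ln w"
    proof (cases "p = 0")
      case True then show ?thesis using eq by (simp add: Ep_def)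
    next
      case False
      have "exp (of_real p * Ln z) = exp (of_real p * Ln w)" using eq False by (simp add: Ep_def)
      moreover have "\<bar>Im (of_real p * Ln z) - Im (of_real p * Ln w)\<bar> < 2 * pi"
      proof -
        have "\<bar>Im (Ln z) - Im (Ln w)\<bar> \<le> 2 * pi"
          using Im_Ln_le_pi[OF nz(1)] mpi_less_Im_Ln[OF nz(1)] Im_Ln_le_pi[OF nz(2)] mpi_less_Im_Ln[OF nz(2)] by linarith
        then have "\<bar>p\<bar> * \<bar>Im (Ln z) - Im (Ln w)\<bar> \<le> \<bar>p\<bar> * (2 * pi)" by (intro mult_left_mono) auto
        also have "\<dots> < 1 * (2 * pi)" using p_bounds by (intro mult_strict_right_mono) auto
        finally show ?thesis by (simp add: abs_mult[symmetric] right_diff_distrib)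
      qed
      ultimately have "of_real p * Ln z = of_real p * Ln w" by (metis exp_complex_eqI)
      then show ?thesis using False by simp
    qed
    then have "z = w" using nz by (metis exp_Ln)
    then show False using \<open>z \<noteq> w\<close> by simp
  qed
  then show ?thesis using J_eq[OF z w False] K_pos False by simp
qed

section \<open>Sums over opposite arguments\<close>

definition sg :: "complex \<Rightarrow> real" where "sg z = (if Im z > 0 then 1 else - 1)"

text \<open>From \<open>z\<close> to \<open>- z\<close> the logarithm turns by \<open>pi\<close>, in
  a direction given by the half-plane of \<open>z\<close>. For \<open>p \<noteq> 0\<close> both
  powers are written around the argument halfway between them, and their difference becomes a
  sine.\<close>

lemma Ep_odd:
  assumes "Im z \<noteq> 0"
  shows "p = 0 \<Longrightarrow> Ep p z - Ep p (- z) = \<i> * of_real (sg z * pi)"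
    and "p \<noteq> 0 \<Longrightarrow> exp (of_real p * Ln z) - exp (of_real p * Ln (- z)) = of_real (sg z) * exp (of_real p * (Ln z - \<i> * of_real (sg z * pi / 2))) * (2 * \<i> * of_real (sin (p * pi / 2)))"
proof -
  have nz: "z \<noteq> 0" using assms by auto
  have Ln: "Ln (- z) = Ln z - \<i> * of_real (sg z * pi)"
    using Ln_minus[OF nz] assms by (auto simp: sg_def)
  show "p = 0 \<Longrightarrow> Ep p z - Ep p (- z) = \<i> * of_real (sg z * pi)"
    by (simp add: Ep_def Ln)
  let ?X = "of_real p * (Ln z - \<i> * of_real (sg z * pi / 2))"
  have "exp (of_real p * Ln z) = exp (?X + \<i> * of_real (p * sg z * pi / 2))"
    by (simp add: algebra_simps)
  moreover have "exp (of_real p * Ln (- z)) = exp (?X + \<i> * of_real (- (p * sg z * pi / 2)))"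
    unfolding Ln by (simp add: algebra_simps)
  ultimately have "exp (of_real p * Ln z) - exp (of_real p * Ln (- z)) = exp ?X * (cis (p * sg z * pi / 2) - cis (- (p * sg z * pi / 2)))"
    by (simp only: exp_add cis_conv_exp right_diff_distrib)
  also have "cis (p * sg z * pi / 2) - cis (- (p * sg z * pi / 2)) = 2 * \<i> * of_real (sin (p * sg z * pi / 2))"
    by (simp add: complex_eq_iff)
  also have "sin (p * sg z * pi / 2) = sg z * sin (p * pi / 2)"
    by (simp add: sg_def)
  finally show "exp (of_real p * Ln z) - exp (of_real p * Ln (- z)) = of_real (sg z) * exp ?X * (2 * \<i> * of_real (sin (p * pi / 2)))"
    by simp
qed

text \<open>A quarter turn takes the half-plane containing \<open>z\<close> to the right
  half-plane.\<close>

lemma Im_Ln_centered: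
  assumes "Im z \<noteq> 0"
  shows "\<bar>Im (Ln z - \<i> * of_real (sg z * pi / 2))\<bar> < pi / 2"
proof -
  have nz: "z \<noteq> 0" using assms by auto
  have Im: "Im (Ln z - \<i> * of_real (sg z * pi / 2)) = Im (Ln z) - sg z * pi / 2" by simp
  show ?thesis unfolding Im abs_less_iff
  proof (cases "Im z > 0")
    case True
    then have "0 < Im (Ln z)" "Im (Ln z) < pi" using Im_Ln_pos_lt[OF nz] by auto
    then show "Im (Ln z) - sg z * pi / 2 < pi / 2 \<and> - (Im (Ln z) - sg z * pi / 2) < pi / 2"
      using True by (simp add: sg_def)
  next
    case False
    then have "Im z < 0" using assms by simp
    then have "Im (Ln z) < 0" using Im_Ln_pos_le[OF nz] Im_Ln_le_pi[OF nz] by force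
    moreover have "- pi < Im (Ln z)" by (rule mpi_less_Im_Ln[OF nz])
    ultimately show "Im (Ln z) - sg z * pi / 2 < pi / 2 \<and> - (Im (Ln z) - sg z * pi / 2) < pi / 2"
      using False by (simp add: sg_def)
  qed
qed

lemma nonreal_slit: "Im z \<noteq> 0 \<Longrightarrow> z \<notin> \<real>\<^sub>\<le>\<^sub>0" by (auto simp: complex_nonpos_Reals_iff)

text \<open>The differences of the arguments are \<open>a - b\<close> and its negative, so for
  \<open>a \<noteq> b\<close> the sum is \<open>K\<close> times the divided difference of
  \<open>A z = Ep p z - Ep p (- z)\<close>. For \<open>p = 0\<close> the function \<open>A\<close>
  sees only the half-plane of \<open>z\<close>. For \<open>p \<noteq> 0\<close> it is a constant
  times the sign of \<open>z\<close> times the \<open>p\<close>-th power of a point in the right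
  half-plane. Such a power is injective with positive real part, which excludes a coincidence for
  equal signs by injectivity and for opposite signs by positivity.\<close>

lemma J_odd_sum:
  assumes a: "Im a \<noteq> 0" and b: "Im b \<noteq> 0"
  shows "J (- a) (- b) + J a b = 0 \<longleftrightarrow> p = 0 \<and> sg a = sg b"
proof -
  define A where "A z = (if p = 0 then \<i> * of_real (sg z * pi) else of_real (sg z) * exp (of_real p * (Ln z - \<i> * of_real (sg z * pi / 2))) * (2 * \<i> * of_real (sin (p * pi / 2))) / of_real p)" for z
  have A: "Ep p z - Ep p (- z) = A z" if "Im z \<noteq> 0" for z
    using Ep_odd[OF that] by (simp add: A_def Ep_def diff_divide_distrib[symmetric])
  have sl: "a \<notin> \<real>\<^sub>\<le>\<^sub>0" "b \<notin> \<real>\<^sub>\<le>\<^sub>0" "- a \<notin> \<real>\<^sub>\<le>\<^sub>0" "- b \<notin> \<real>\<^sub>\<le>\<^sub>0"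
    using a b nonreal_slit[of a] nonreal_slit[of b] nonreal_slit[of "- a"] nonreal_slit[of "- b"] by simp_all
  have sgs: "sg z = 1 \<or> sg z = - 1" for z by (auto simp: sg_def)
  have sin: "sin (p * pi / 2) \<noteq> 0" if "p \<noteq> 0"
  proof
    assume 0: "sin (p * pi / 2) = 0"
    have "p * pi < 1 * pi" "(- 1) * pi < p * pi"
      using p_bounds by (intro mult_strict_right_mono; simp)+
    then have "- pi < p * pi / 2" "p * pi / 2 < pi" using pi_gt_zero by linarith+
    from sin_eq_0_pi[OF this 0] show False using that by simp
  qed
  show ?thesis
  proof (cases "a = b")
    case True
    have nz: "a \<noteq> 0" using a by auto
    \<comment> \<open>For coinciding arguments the divided difference degenerates to the derivative
      computed in \<open>Jzz_eq\<close>.\<close>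
    have "J (- a) (- b) + J a b = of_real K / a * (exp (of_real p * Ln a) - exp (of_real p * Ln (- a)))"
      unfolding True[symmetric] Jzz_eq[OF sl(1)] Jzz_eq[OF sl(3)] using nz by (simp add: field_simps)
    then have "J (- a) (- b) + J a b = 0 \<longleftrightarrow> exp (of_real p * Ln a) - exp (of_real p * Ln (- a)) = 0"
      using nz K_pos by simp
    also have "\<dots> \<longleftrightarrow> p = 0"
    proof (cases "p = 0")
      case False
      have "sg a \<noteq> 0" using sgs[of a] by auto
      then show ?thesis unfolding Ep_odd(2)[OF a False] using False sin by simp
    qed simp
    finally show ?thesis using True by simp
  next
    case False
    have "J (- a) (- b) + J a b = of_real K * ((Ep p a - Ep p (- a)) - (Ep p b - Ep p (- b))) / (a - b)"
    proof -
      let ?X = "of_real K * (Ep p (- a) - Ep p (- b))"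
      have "J (- a) (- b) = ?X / (b - a)" using False J_eq[OF sl(3,4)] by simp
      also have "\<dots> = - ?X / (a - b)" using minus_divide_divide[of "- ?X" "a - b"] by simp
      finally show ?thesis
        unfolding J_eq[OF sl(1,2) False] by (simp add: add_divide_distrib[symmetric] algebra_simps)
    qed
    then have 1: "J (- a) (- b) + J a b = 0 \<longleftrightarrow> A a = A b"
      using False K_pos unfolding A[OF a] A[OF b] by simp
    show ?thesis
    proof (cases "p = 0")
      case True
      then show ?thesis using 1 by (simp add: A_def)
    next
      case p: False
      let ?X = "\<lambda>z. of_real p * (Ln z - \<i> * of_real (sg z * pi / 2))"
      have "A a \<noteq> A b"
      proof
        assume "A a = A b"
        then have eq: "of_real (sg a) * exp (?X a) = of_real (sg b) * exp (?X b)"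
          using p sin by (simp add: A_def)
        have im: "\<bar>Im (?X z)\<bar> < pi / 2" if "Im z \<noteq> 0" for z
        proof -
          have "\<bar>Im (?X z)\<bar> = \<bar>p\<bar> * \<bar>Im (Ln z - \<i> * of_real (sg z * pi / 2))\<bar>" by (simp add: abs_mult)
          also have "\<dots> \<le> 1 * \<bar>Im (Ln z - \<i> * of_real (sg z * pi / 2))\<bar>"
            using p_bounds by (intro mult_right_mono) auto
          also have "\<dots> < pi / 2" using Im_Ln_centered[OF that] by simp
          finally show ?thesis .
        qed
        have re: "Re (exp (?X z)) > 0" if "Im z \<noteq> 0" for z
          using im[OF that] unfolding Re_exp by (intro mult_pos_pos cos_gt_zero_pi) (auto simp: abs_less_iff)
        show False
        proof (cases "sg a = sg b")
          case True
          then have "exp (?X a) = exp (?X b)" using eq sgs[of b] by auto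
          moreover have "\<bar>Im (?X a) - Im (?X b)\<bar> < 2 * pi" using im[OF a] im[OF b] pi_gt_zero by linarith
          ultimately have "?X a = ?X b" by (metis exp_complex_eqI)
          then have "Ln a = Ln b" using p True by simp
          then have "a = b" using a b by (metis exp_Ln zero_complex.simps(2))
          then show False using \<open>a \<noteq> b\<close> by simp
        next
          case False
          moreover have "X = - Y" if "of_real s * X = of_real t * Y" "s = 1 \<or> s = - 1" "t = 1 \<or> t = - 1" "s \<noteq> t"
            for X Y :: complex and s t :: real using that by auto
          ultimately have "exp (?X a) = - exp (?X b)" using eq sgs[of a] sgs[of b] by blast
          then have "Re (exp (?X a)) = - Re (exp (?X b))" by simp
          then show False using re[OF a] re[OF b] by linarith
        qed
      qed
      then show ?thesis using 1 p by simp
    qed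
  qed
qed

end

subsection \<open>Ellipticity and the homogeneous symbol\<close>

definition psym :: "nat \<Rightarrow> nat \<Rightarrow> complex \<Rightarrow> fun2" where
  "psym k l a w = of_real (fst w) ^ k - a * of_real (snd w) ^ l"

text \<open>The arithmetic form of ellipticity: a real coefficient is admissible only if it is
  negative and both powers are even.\<close>

definition ell_coeff :: "nat \<Rightarrow> nat \<Rightarrow> complex \<Rightarrow> bool" where
  "ell_coeff k l a \<longleftrightarrow> Im a \<noteq> 0 \<or> even k \<and> even l \<and> Re a < 0"

text \<open>If the condition fails, a real root gives a zero on the line \<open>y = 1\<close> or on
  the line \<open>x = 1\<close>.\<close>

lemma ell_coeffI:
  assumes "k \<ge> 1" "l \<ge> 1" "a \<noteq> 0"
    and "\<And>x y. (x, y) \<noteq> (0, 0) \<Longrightarrow> psym k l a (x, y) \<noteq> 0"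
  shows "ell_coeff k l a"
proof (rule ccontr)
  assume "\<not> ell_coeff k l a"
  then have im: "Im a = 0" and re: "\<not> (even k \<and> even l \<and> Re a < 0)" by (auto simp: ell_coeff_def)
  define r where "r = Re a"
  have a: "a = of_real r" using im by (simp add: r_def complex_eq_iff)
  have r: "r \<noteq> 0" using assms(3) a by auto
  consider "odd k" | "odd l" | "even k" "even l" "r > 0" using re r r_def by fastforce
  then show False
  proof cases
    case 1
    then have "root k r ^ k = r" by (rule odd_real_root_pow)
    then have "psym k l a (root k r, 1) = 0"
      by (simp add: psym_def a of_real_power[symmetric] del: of_real_power)
    then show False using assms(4)[of "root k r" 1] by simp
  next
    case 2
    then have "root l (1 / r) ^ l = 1 / r" by (rule odd_real_root_pow)
    then have "psym k l a (1, root l (1 / r)) = 0"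
      using r by (simp add: psym_def a of_real_power[symmetric] of_real_mult[symmetric] del: of_real_power of_real_mult)
    then show False using assms(4)[of 1 "root l (1 / r)"] by simp
  next
    case 3
    then have "root k r ^ k = r" using assms(1) by (intro real_root_pow_pos2) auto
    then have "psym k l a (root k r, 1) = 0"
      by (simp add: psym_def a of_real_power[symmetric] del: of_real_power)
    then show False using assms(4)[of "root k r" 1] by simp
  qed
qed

text \<open>Quantitative ellipticity. For non-real \<open>a\<close> the imaginary part controls the
  second coordinate and then the triangle inequality the first; for real \<open>a\<close> both terms
  are non-negative and cannot cancel.\<close>

lemma psym_coercive:
  assumes "ell_coeff k l a"
  obtains c where "c > 0" "\<And>w. c * (\<bar>fst w\<bar> ^ k + \<bar>snd w\<bar> ^ l) \<le> norm (psym k l a w)"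
proof (cases "Im a = 0")
  case True
  then have kl: "even k" "even l" "Re a < 0" using assms by (auto simp: ell_coeff_def)
  have a: "a = of_real (Re a)" using True by (simp add: complex_eq_iff)
  show ?thesis
  proof (rule that[of "min 1 (- Re a)"])
    fix w :: "real \<times> real"
    have "psym k l a w = of_real (fst w ^ k - Re a * snd w ^ l)"
      unfolding psym_def by (subst a) simp
    then have "norm (psym k l a w) = \<bar>fst w ^ k - Re a * snd w ^ l\<bar>" by (simp only: norm_of_real)
    also have "\<dots> \<ge> fst w ^ k - Re a * snd w ^ l" by simp
    finally have "fst w ^ k - Re a * snd w ^ l \<le> norm (psym k l a w)" .
    moreover have "min 1 (- Re a) * \<bar>fst w\<bar> ^ k \<le> 1 * \<bar>fst w\<bar> ^ k" "min 1 (- Re a) * \<bar>snd w\<bar> ^ l \<le> - Re a * \<bar>snd w\<bar> ^ l"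
      by (intro mult_right_mono; simp)+
    ultimately show "min 1 (- Re a) * (\<bar>fst w\<bar> ^ k + \<bar>snd w\<bar> ^ l) \<le> norm (psym k l a w)"
      using kl by (simp add: power_even_abs distrib_left)
  qed (use kl in auto)
next
  case False
  define B where "B = 1 + (1 + norm a) / \<bar>Im a\<bar>"
  have B: "B > 0" unfolding B_def by (intro add_pos_nonneg) auto
  show ?thesis
  proof (rule that[of "1 / B"])
    fix w :: "real \<times> real"
    let ?n = "norm (psym k l a w)"
    have "Im (psym k l a w) = - Im a * snd w ^ l"
      by (simp add: psym_def of_real_power[symmetric] del: of_real_power)
    then have 1: "\<bar>Im a\<bar> * \<bar>snd w\<bar> ^ l \<le> ?n"
      using abs_Im_le_cmod[of "psym k l a w"] by (simp add: abs_mult power_abs)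
    have "norm (complex_of_real (fst w) ^ k) \<le> ?n + norm (a * complex_of_real (snd w) ^ l)"
      using norm_triangle_ineq[of "psym k l a w" "a * complex_of_real (snd w) ^ l"] by (simp add: psym_def)
    then have 2: "\<bar>fst w\<bar> ^ k \<le> ?n + norm a * \<bar>snd w\<bar> ^ l" by (simp add: norm_mult norm_power)
    have "(1 + norm a) * \<bar>snd w\<bar> ^ l = ((1 + norm a) / \<bar>Im a\<bar>) * (\<bar>Im a\<bar> * \<bar>snd w\<bar> ^ l)"
      using False by simp
    also have "\<dots> \<le> ((1 + norm a) / \<bar>Im a\<bar>) * ?n" by (intro mult_left_mono 1) auto
    finally have "\<bar>fst w\<bar> ^ k + \<bar>snd w\<bar> ^ l \<le> B * ?n" using 2 by (simp add: B_def algebra_simps)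
    then show "1 / B * (\<bar>fst w\<bar> ^ k + \<bar>snd w\<bar> ^ l) \<le> ?n" using B by (simp add: divide_simps mult.commute)
  qed (use B in auto)
qed

lemma poly2_psym: "psym k l a \<in> poly2"
  unfolding psym_def[abs_def] by (intro poly2_diff poly2_power poly2.mult poly2.const poly2.fst poly2.snd)

lemma psym_measurable [measurable]: "psym k l a \<in> borel_measurable borel"
  unfolding psym_def[abs_def] by measurable

text \<open>Taking out \<open>(2 * pi * \<i>) ^ k\<close> leaves a power of
  \<open>2 * pi * \<i>\<close> in the coefficient, which is the origin of \<open>tau1\<close>. The
  second argument of the form is conjugated, and \<open>sigma1 k l \<sigma>\<close> is the conjugate
  of \<open>tau1 k l \<sigma>\<close>.\<close>

lemma Asym_eq_psym:
  assumes "k \<ge> 1"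
  shows "Asym k l \<tau> w = (2 * pi * \<i>) ^ k * psym k l (tau1 k l \<tau>) w"
    and "cnj (Asym k l \<sigma> w) = cnj ((2 * pi * \<i>) ^ k) * psym k l (sigma1 k l \<sigma>) w"
proof -
  have nz: "2 * complex_of_real pi * \<i> \<noteq> 0" by simp
  have 1: "(2 * complex_of_real pi * \<i>) ^ k * (2 * pi * \<i>) powi (int l - int k) = (2 * pi * \<i>) ^ l"
    using power_int_add[OF disjI1[OF nz], of "int k" "int l - int k"] by simp
  show A: "Asym k l \<tau> w = (2 * pi * \<i>) ^ k * psym k l (tau1 k l \<tau>) w" for \<tau>
    unfolding Asym_def psym_def tau1_def power_mult_distrib[of _ "of_real _"] 1[symmetric]
    by (simp add: algebra_simps)
  define Z where "Z = 2 * complex_of_real pi * \<i>"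
  have "cnj Z = (- 1) * Z" by (simp add: Z_def)
  then have "cnj (Z powi (int l - int k)) = (- 1) powi (int l - int k) * Z powi (int l - int k)"
    unfolding complex_cnj_power_int by (simp only: power_int_mult_distrib)
  then have "sigma1 k l \<sigma> = cnj (tau1 k l \<sigma>)"
    unfolding sigma1_def tau1_def by (simp add: Z_def del: complex_cnj_power_int)
  then show "cnj (Asym k l \<sigma> w) = cnj ((2 * pi * \<i>) ^ k) * psym k l (sigma1 k l \<sigma>) w"
    unfolding A by (simp add: psym_def)
qed

text \<open>The multiplier on a line where the second coordinate \<open>y\<close> is
  \<open>1\<close> or \<open>- 1\<close>, with \<open>e = y ^ l\<close>; the weight in
  \<open>y\<close> is 1 there.\<close>

definition msym :: "nat \<Rightarrow> real \<Rightarrow> complex \<Rightarrow> complex \<Rightarrow> real \<Rightarrow> real \<Rightarrow> complex" where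
  "msym k \<alpha> a b e s = of_real (wpow s \<alpha>) / ((of_real (s ^ k) - of_real e * a) * (of_real (s ^ k) - of_real e * b))"

text \<open>The average over the unit curve: each dilation orbit off the first axis meets exactly
  one of the lines \<open>y = 1\<close> and \<open>y = - 1\<close>, in one point.\<close>

definition cval :: "nat \<Rightarrow> nat \<Rightarrow> real \<Rightarrow> complex \<Rightarrow> complex \<Rightarrow> complex" where
  "cval k l \<alpha> a b = integral\<^sup>L lborel (msym k \<alpha> a b 1) + integral\<^sup>L lborel (msym k \<alpha> a b ((- 1) ^ l))"

lemma wpow_nonneg [simp]: "wpow s \<alpha> \<ge> 0" by (simp add: wpow_def)

lemma wpow_minus [simp]: "wpow (- s) \<alpha> = wpow s \<alpha>" by (simp add: wpow_def)

lemma wpow_measurable [measurable]: "(\<lambda>s. wpow s \<alpha>) \<in> borel_measurable borel"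
  unfolding wpow_def by measurable

lemma wpow_pos_eq: "s > 0 \<Longrightarrow> wpow s \<alpha> = s powr (2 * \<alpha>)" by (simp add: wpow_def)

lemma msym_measurable [measurable]: "msym k \<alpha> a b e \<in> borel_measurable borel"
  unfolding msym_def[abs_def] by measurable

lemma split_line:
  fixes F :: "real \<Rightarrow> complex"
  assumes p: "integrable lborel (\<lambda>s. indicator {0<..} s *\<^sub>R F s)"
    and m: "integrable lborel (\<lambda>s. indicator {0<..} s *\<^sub>R F (- s))"
    and [measurable]: "F \<in> borel_measurable borel"
  shows "integrable lborel F"
    and "integral\<^sup>L lborel F = integral\<^sup>L lborel (\<lambda>s. indicator {0<..} s *\<^sub>R F s) + integral\<^sup>L lborel (\<lambda>s. indicator {0<..} s *\<^sub>R F (- s))"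
proof -
  let ?m = "\<lambda>s. indicator {0<..} (0 + (-1) * s) *\<^sub>R F (- (0 + (-1) * s))"
  have mi: "integrable lborel ?m"
    by (rule lborel_integrable_real_affine[OF m]) simp
  have me: "integral\<^sup>L lborel (\<lambda>s. indicator {0<..} s *\<^sub>R F (- s)) = integral\<^sup>L lborel ?m"
    by (subst lborel_integral_real_affine[of "-1" _ 0]) simp_all
  have ae: "AE s in lborel. F s = indicator {0<..} s *\<^sub>R F s + ?m s"
    using AE_lborel_singleton[of "0::real"] by eventually_elim (auto simp: indicator_def)
  have i: "integrable lborel (\<lambda>s. indicator {0<..} s *\<^sub>R F s + ?m s)"
    by (rule Bochner_Integration.integrable_add[OF p mi])
  show "integrable lborel F"
    by (rule iffD2[OF integrable_cong_AE[OF _ _ ae] i]) simp_all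
  have "integral\<^sup>L lborel F = integral\<^sup>L lborel (\<lambda>s. indicator {0<..} s *\<^sub>R F s + ?m s)"
    by (rule integral_cong_AE[OF _ _ ae]) simp_all
  also have "\<dots> = integral\<^sup>L lborel (\<lambda>s. indicator {0<..} s *\<^sub>R F s) + integral\<^sup>L lborel ?m"
    by (rule Bochner_Integration.integral_add[OF p mi])
  finally show "integral\<^sup>L lborel F = integral\<^sup>L lborel (\<lambda>s. indicator {0<..} s *\<^sub>R F s) + integral\<^sup>L lborel (\<lambda>s. indicator {0<..} s *\<^sub>R F (- s))"
    unfolding me .
qed

text \<open>The signs for which \<open>- (e * a)\<close> stays off the slit: if both powers are
  even, \<open>a\<close> may be a negative number and \<open>e\<close> has to be 1.\<close>

definition unit_sign :: "nat \<Rightarrow> nat \<Rightarrow> real \<Rightarrow> bool" where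
  "unit_sign k l e \<longleftrightarrow> e = 1 \<or> e = - 1 \<and> (odd k \<or> odd l)"

lemma unit_sign_simps [simp]: "unit_sign k l 1" "unit_sign k l ((- 1) ^ l)"
  by (cases "even l"; simp add: unit_sign_def)+

lemma unit_sign_mult: "unit_sign k l e \<Longrightarrow> unit_sign k l ((- 1) ^ k * e)"
  by (cases "even k"; auto simp: unit_sign_def)

lemma ell_coeff_slit:
  assumes "ell_coeff k l a" "unit_sign k l e"
  shows "- (of_real e * a) \<notin> \<real>\<^sub>\<le>\<^sub>0"
  using assms by (auto simp: ell_coeff_def unit_sign_def complex_nonpos_Reals_iff)

text \<open>Reflecting the negative half-line multiplies \<open>e\<close> by
  \<open>(- 1) ^ k\<close>; the signs pulled out of the two denominators cancel.\<close>

lemma msym_integral: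
  assumes ell: "ell_coeff k l a" "ell_coeff k l b" and e: "unit_sign k l e"
    and \<alpha>: "0 \<le> \<alpha>" "2 * \<alpha> + 1 < 2 * real k"
  shows "integrable lborel (msym k \<alpha> a b e)"
    and "integral\<^sup>L lborel (msym k \<alpha> a b e) = mellin.J (2 * \<alpha>) k (- (of_real e * a)) (- (of_real e * b))
       + mellin.J (2 * \<alpha>) k (- (of_real ((- 1) ^ k * e) * a)) (- (of_real ((- 1) ^ k * e) * b))"
proof -
  interpret mellin "2 * \<alpha>" k by unfold_locales (use \<alpha> in auto)
  define e' where "e' = (- 1) ^ k * e"
  have e': "unit_sign k l e'" unfolding e'_def by (rule unit_sign_mult[OF e])
  have p: "indicator {0<..} s *\<^sub>R msym k \<alpha> a b e s = of_real (W s) / ((of_real (s ^ k) + - (of_real e * a)) * (of_real (s ^ k) + - (of_real e * b)))" for s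
    by (auto simp: msym_def W_def indicator_def wpow_pos_eq)
  have m: "indicator {0<..} s *\<^sub>R msym k \<alpha> a b e (- s) = of_real (W s) / ((of_real (s ^ k) + - (of_real e' * a)) * (of_real (s ^ k) + - (of_real e' * b)))" for s
  proof (cases "s > 0")
    case True
    have f: "of_real ((- s) ^ k) - of_real e * c = (- 1) ^ k * (of_real (s ^ k) + - (of_real e' * c))" for c
      by (cases "even k") (simp_all add: e'_def)
    have "(of_real ((- s) ^ k) - of_real e * a) * (of_real ((- s) ^ k) - of_real e * b) = ((- 1) ^ k * (- 1) ^ k) * ((of_real (s ^ k) + - (of_real e' * a)) * (of_real (s ^ k) + - (of_real e' * b)))"
      unfolding f by (simp only: mult_ac)
    also have "(- 1) ^ k * (- 1) ^ k = (1 :: complex)" by (cases "even k") auto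
    finally show ?thesis using True by (simp add: msym_def W_def wpow_pos_eq)
  qed (simp add: W_def)
  note sl = ell_coeff_slit[OF ell(1) e] ell_coeff_slit[OF ell(2) e] ell_coeff_slit[OF ell(1) e'] ell_coeff_slit[OF ell(2) e']
  have i: "integrable lborel (\<lambda>s. indicator {0<..} s *\<^sub>R msym k \<alpha> a b e s)" "integrable lborel (\<lambda>s. indicator {0<..} s *\<^sub>R msym k \<alpha> a b e (- s))"
    unfolding p m by (intro J_integrable sl)+
  show "integrable lborel (msym k \<alpha> a b e)" by (rule split_line(1)[OF i]) simp
  show "integral\<^sup>L lborel (msym k \<alpha> a b e) = J (- (of_real e * a)) (- (of_real e * b)) + J (- (of_real ((- 1) ^ k * e) * a)) (- (of_real ((- 1) ^ k * e) * b))"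
    unfolding split_line(2)[OF i msym_measurable] p m J_def e'_def ..
qed

text \<open>Four half-lines contribute. If both powers are even, all of them give the same non-zero
  value of \<open>J\<close>. Otherwise the arguments \<open>(- a, - b)\<close> and
  \<open>(a, b)\<close> occur twice each and \<open>J_odd_sum\<close> decides.\<close>

lemma cval_zero_iff:
  assumes ell: "ell_coeff k l a" "ell_coeff k l b" and \<alpha>: "0 \<le> \<alpha>" "2 * \<alpha> + 1 < 2 * real k"
  shows "cval k l \<alpha> a b = 0 \<longleftrightarrow> (odd k \<or> odd l) \<and> \<alpha> = (real k - 1) / 2 \<and> Im a \<noteq> 0 \<and> Im b \<noteq> 0 \<and> sgn (Im a) = sgn (Im b)"
proof -
  interpret mellin "2 * \<alpha>" k by unfold_locales (use \<alpha> in auto)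
  note I = msym_integral(2)[OF ell _ \<alpha>]
  have p0: "p = 0 \<longleftrightarrow> \<alpha> = (real k - 1) / 2"
  proof -
    have "p = 0 \<longleftrightarrow> (2 * \<alpha> + 1) / real k = 1" unfolding p_def by auto
    then show ?thesis using k0 by (auto simp: field_simps)
  qed
  show ?thesis
  proof (cases "even k \<and> even l")
    case True
    then have "cval k l \<alpha> a b = 4 * J (- a) (- b)"
      unfolding cval_def by (simp add: I[OF unit_sign_simps(1)])
    moreover have "J (- a) (- b) \<noteq> 0"
      using ell_coeff_slit[OF ell(1) unit_sign_simps(1)] ell_coeff_slit[OF ell(2) unit_sign_simps(1)]
      by (intro J_nonzero) auto
    ultimately show ?thesis using True by simp
  next
    case False
    then have ab: "Im a \<noteq> 0" "Im b \<noteq> 0" using ell by (auto simp: ell_coeff_def)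
    have "cval k l \<alpha> a b = 2 * (J (- a) (- b) + J a b)"
    proof (cases "even k")
      case True
      then have l: "odd l" using False by simp
      then show ?thesis unfolding cval_def using True I[OF unit_sign_simps(1)] I[OF unit_sign_simps(2)] by simp
    next
      case odd: False
      show ?thesis
        unfolding cval_def using odd I[OF unit_sign_simps(1)] I[OF unit_sign_simps(2)]
        by (cases "even l") simp_all
    qed
    then have "cval k l \<alpha> a b = 0 \<longleftrightarrow> p = 0 \<and> sg a = sg b" using J_odd_sum[OF ab] by (simp del: distrib_left_numeral)
    moreover have "sg a = sg b \<longleftrightarrow> sgn (Im a) = sgn (Im b)" using ab by (auto simp: sg_def sgn_if)
    ultimately show ?thesis using ab False p0 by auto
  qed
qed

subsection \<open>Test functions\<close>

lemma power_le_exp: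
  fixes x d :: real
  assumes "d > 0"
  obtains C where "\<And>x. x \<ge> 0 \<Longrightarrow> x ^ N \<le> C * exp (d * x)"
proof (cases "N = 0")
  case True
  then show ?thesis using assms by (intro that[of 1]) simp
next
  case False
  show ?thesis
  proof (rule that[of "(real N / d) ^ N"])
    fix x :: real assume "x \<ge> 0"
    have "x ^ N = (real N / d) ^ N * (d * x / real N) ^ N"
      using False assms by (simp add: power_mult_distrib[symmetric])
    also have "\<dots> \<le> (real N / d) ^ N * exp (d * x)"
    proof (rule mult_left_mono)
      have "(d * x / real N) ^ N \<le> (1 + d * x / real N) ^ N"
        using \<open>x \<ge> 0\<close> assms by (intro power_mono) auto
      also have "\<dots> \<le> exp (d * x)"
        using \<open>x \<ge> 0\<close> assms False by (intro exp_ge_one_plus_x_over_n_power_n) (auto intro: order_trans[of _ 0])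
      finally show "(d * x / real N) ^ N \<le> exp (d * x)" .
    qed (use assms in auto)
    finally show "x ^ N \<le> (real N / d) ^ N * exp (d * x)" .
  qed
qed

text \<open>By the chain rule a derivative of \<open>h j\<close> composed with \<open>Q\<close> is a
  polynomial times \<open>h (Suc j)\<close> composed with \<open>Q\<close>, so the module generated
  by all these compositions is closed under derivatives. Coercivity of \<open>Q\<close> turns
  exponential decay in \<open>q\<close> into rapid decay in the plane.\<close>

lemma schwartz_comp_exp_decay:
  fixes h :: "nat \<Rightarrow> real \<Rightarrow> real" and Q :: "real \<times> real \<Rightarrow> real"
  assumes h: "\<And>j q. (h j has_real_derivative h (Suc j) q) (at q)"
    and hb: "\<And>j. \<exists>C. \<forall>q\<ge>0. \<bar>h j q\<bar> \<le> C * exp (- d * q)" and d: "d > 0"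
    and Q: "(\<lambda>w. complex_of_real (Q w)) \<in> poly2" and Q0: "\<And>w. Q w \<ge> 0"
    and Qc: "c > 0" "\<And>w. c * (norm w - 3) \<le> Q w"
  shows "schwartz (\<lambda>w. of_real (h j (Q w)))"
proof (rule pmod_schwartz)
  let ?S = "range (\<lambda>j w. complex_of_real (h j (Q w)))"
  show "(\<lambda>w. of_real (h j (Q w))) \<in> pmod ?S" by (rule pmod.base) blast
  fix f assume "f \<in> ?S"
  then obtain j where f: "f = (\<lambda>w. of_real (h j (Q w)))" by blast
  have der: "\<exists>D. ((\<lambda>w. complex_of_real (Q w)) has_derivative D) (at w) \<and> (f has_derivative (\<lambda>v. of_real (h (Suc j) (Q w)) * D v)) (at w)" for w
  proof -
    obtain D where D: "((\<lambda>w. complex_of_real (Q w)) has_derivative D) (at w)"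
      using poly2_differentiable[OF Q] by (meson differentiable_def)
    \<comment> \<open>\<open>D\<close> takes real values because \<open>Q\<close> does; this lets
      the real chain rule be carried over to the complex-valued function.\<close>
    have re: "(Q has_derivative (\<lambda>v. Re (D v))) (at w)"
      using bounded_linear.has_derivative[OF bounded_linear_Re D] by simp
    have "((\<lambda>w. complex_of_real (Q w)) has_derivative (\<lambda>v. of_real (Re (D v)))) (at w)"
      by (rule bounded_linear.has_derivative[OF bounded_linear_of_real re])
    then have DR: "D = (\<lambda>v. of_real (Re (D v)))" by (rule has_derivative_unique[OF D])
    have "((\<lambda>w. h j (Q w)) has_derivative (\<lambda>v. h (Suc j) (Q w) * Re (D v))) (at w)"
      using has_derivative_compose[OF re, of "h j"] h[of j "Q w"] by (simp add: has_field_derivative_def)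
    from bounded_linear.has_derivative[OF bounded_linear_of_real this]
    have "(f has_derivative (\<lambda>v. of_real (h (Suc j) (Q w)) * of_real (Re (D v)))) (at w)"
      by (simp add: f)
    then show ?thesis using D DR by metis
  qed
  have "f differentiable (at z)" for z using der[of z] by (meson differentiable_def)
  moreover have "pd1 f \<in> pmod ?S"
  proof -
    have "pd1 f = (\<lambda>w. pd1 (\<lambda>w. complex_of_real (Q w)) w * of_real (h (Suc j) (Q w)))"
    proof
      fix w :: "real \<times> real"
      obtain x y where w: "w = (x, y)" by (cases w)
      obtain D where "((\<lambda>w. complex_of_real (Q w)) has_derivative D) (at (x, y))" "(f has_derivative (\<lambda>v. of_real (h (Suc j) (Q (x, y))) * D v)) (at (x, y))"
        using der by blast
      from this[THEN pd1_eq] show "pd1 f w = pd1 (\<lambda>w. complex_of_real (Q w)) w * of_real (h (Suc j) (Q w))"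
        by (simp add: w)
    qed
    also have "\<dots> \<in> pmod ?S" by (intro pmod.mult pmod.base conjunct1[OF poly2_pd[OF Q]]) blast
    finally show ?thesis .
  qed
  moreover have "pd2 f \<in> pmod ?S"
  proof -
    have "pd2 f = (\<lambda>w. pd2 (\<lambda>w. complex_of_real (Q w)) w * of_real (h (Suc j) (Q w)))"
    proof
      fix w :: "real \<times> real"
      obtain x y where w: "w = (x, y)" by (cases w)
      obtain D where "((\<lambda>w. complex_of_real (Q w)) has_derivative D) (at (x, y))" "(f has_derivative (\<lambda>v. of_real (h (Suc j) (Q (x, y))) * D v)) (at (x, y))"
        using der by blast
      from this[THEN pd2_eq] show "pd2 f w = pd2 (\<lambda>w. complex_of_real (Q w)) w * of_real (h (Suc j) (Q w))"
        by (simp add: w)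
    qed
    also have "\<dots> \<in> pmod ?S" by (intro pmod.mult pmod.base conjunct2[OF poly2_pd[OF Q]]) blast
    finally show ?thesis .
  qed
  moreover have "rapid f"
    unfolding rapid_def
  proof
    fix N
    obtain B where B: "\<And>q. q \<ge> 0 \<Longrightarrow> \<bar>h j q\<bar> \<le> B * exp (- d * q)" using hb by blast
    have B0: "B \<ge> 0" using order_trans[OF abs_ge_zero B[of 0]] by simp
    obtain A where A: "\<And>x. x \<ge> 0 \<Longrightarrow> x ^ N \<le> A * exp (d * c * x)"
      using power_le_exp[of "d * c" N] d Qc(1) by auto
    \<comment> \<open>The 1 of the weight and the 3 of the coercivity bound add up to 4.\<close>
    have "(1 + norm z) ^ N * norm (f z) \<le> A * B * exp (d * (4 * c))" for z
    proof -
      have n: "norm (f z) \<le> B * exp (- d * Q z)" using B[OF Q0] by (simp add: f)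
      have a: "(1 + norm z) ^ N \<le> A * exp (d * c * (1 + norm z))" by (rule A) simp
      have A0: "0 \<le> A * exp (d * c * (1 + norm z))" by (rule order_trans[OF _ a]) simp
      have "(1 + norm z) ^ N * norm (f z) \<le> (A * exp (d * c * (1 + norm z))) * (B * exp (- d * Q z))"
        by (intro mult_mono n a A0) auto
      also have "\<dots> = (A * exp (d * c * (1 + norm z)) * B) * exp (- d * Q z)" by simp
      also have "\<dots> \<le> (A * exp (d * c * (1 + norm z)) * B) * exp (- d * (c * (norm z - 3)))"
        using Qc(2)[of z] d A0 B0 by (intro mult_left_mono) auto
      also have "\<dots> = A * B * (exp (d * c * (1 + norm z)) * exp (- d * (c * (norm z - 3))))" by simp
      also have "\<dots> = A * B * exp (d * (4 * c))"
        by (simp add: exp_add[symmetric] algebra_simps del: exp_add)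
      finally show ?thesis .
    qed
    then show "\<exists>C. \<forall>z. (1 + norm z) ^ N * norm (f z) \<le> C" by blast
  qed
  ultimately show "(\<forall>z. f differentiable (at z)) \<and> rapid f \<and> pd1 f \<in> pmod ?S \<and> pd2 f \<in> pmod ?S" by blast
qed

text \<open>\<open>expint\<close> interpolates \<open>(exp (- \<epsilon> q) - exp (- q)) / q\<close> smoothly across \<open>q = 0\<close>.\<close>
definition expint :: "real \<Rightarrow> nat \<Rightarrow> real \<Rightarrow> real" where
  "expint \<epsilon> j q = integral {\<epsilon>..1} (\<lambda>t. (- t) ^ j * exp (- t * q))"

lemma expint_derivative: "(expint \<epsilon> j has_real_derivative expint \<epsilon> (Suc j) q) (at q)"
proof -
  have "((\<lambda>q. integral (cbox \<epsilon> 1) (\<lambda>t. (- t) ^ j * exp (- t * q))) has_real_derivative integral (cbox \<epsilon> 1) (\<lambda>t. (- t) ^ Suc j * exp (- t * q))) (at q within UNIV)"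
  proof (rule leibniz_rule_field_derivative)
    show "((\<lambda>q. (- t) ^ j * exp (- t * q)) has_real_derivative (- t) ^ Suc j * exp (- t * q)) (at q within UNIV)" for q t :: real
      by (auto intro!: derivative_eq_intros)
    show "(\<lambda>t. (- t) ^ j * exp (- t * q)) integrable_on cbox \<epsilon> 1" for q
      by (intro integrable_continuous continuous_intros)
    show "continuous_on (UNIV \<times> cbox \<epsilon> 1) (\<lambda>(q, t). (- t) ^ Suc j * exp (- t * q))"
      unfolding case_prod_beta by (intro continuous_intros)
  qed auto
  then show ?thesis by (simp add: expint_def[abs_def])
qed

lemma expint_bound:
  assumes "0 < \<epsilon>" "\<epsilon> < 1" "q \<ge> 0"
  shows "\<bar>expint \<epsilon> j q\<bar> \<le> exp (- \<epsilon> * q)"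
proof -
  have "norm (integral {\<epsilon>..1} (\<lambda>t. (- t) ^ j * exp (- t * q))) \<le> exp (- \<epsilon> * q) * (1 - \<epsilon>)"
  proof (rule integral_bound)
    show "continuous_on {\<epsilon>..1} (\<lambda>t. (- t) ^ j * exp (- t * q))" by (intro continuous_intros)
    fix t assume t: "t \<in> {\<epsilon>..1}"
    have "\<bar>t\<bar> ^ j \<le> 1" using t assms by (intro power_le_one) auto
    moreover have "exp (- t * q) \<le> exp (- \<epsilon> * q)" using t assms by (simp add: mult_right_mono)
    ultimately have "\<bar>t\<bar> ^ j * exp (- t * q) \<le> 1 * exp (- \<epsilon> * q)" by (intro mult_mono) auto
    then show "norm ((- t) ^ j * exp (- t * q)) \<le> exp (- \<epsilon> * q)" by (simp add: abs_mult power_abs)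
  qed (use assms in auto)
  also have "\<dots> \<le> exp (- \<epsilon> * q)" using assms by (simp add: mult_left_le)
  finally show ?thesis by (simp add: expint_def)
qed

lemma expint_0:
  assumes "0 < \<epsilon>" "\<epsilon> < 1"
  shows "q * expint \<epsilon> 0 q = exp (- \<epsilon> * q) - exp (- q)"
proof -
  have "((\<lambda>t. q * exp (- t * q)) has_integral (- exp (- 1 * q) - (- exp (- \<epsilon> * q)))) {\<epsilon>..1}"
  proof (rule fundamental_theorem_of_calculus)
    show "((\<lambda>t. - exp (- t * q)) has_vector_derivative q * exp (- t * q)) (at t within {\<epsilon>..1})" for t
      unfolding has_real_derivative_iff_has_vector_derivative[symmetric]
      by (auto intro!: derivative_eq_intros)
  qed (use assms in auto)
  then have "integral {\<epsilon>..1} (\<lambda>t. q * exp (- t * q)) = exp (- \<epsilon> * q) - exp (- q)"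
    by (auto dest: integral_unique)
  then show ?thesis by (simp add: expint_def)
qed

lemma schwartz_exp:
  fixes Q :: "real \<times> real \<Rightarrow> real"
  assumes "(\<lambda>w. complex_of_real (Q w)) \<in> poly2" "\<And>w. Q w \<ge> 0"
    and "c > 0" "\<And>w. c * (norm w - 3) \<le> Q w" and "d > 0"
  shows "schwartz (\<lambda>w. of_real (exp (- d * Q w)))"
proof -
  have "schwartz (\<lambda>w. of_real ((\<lambda>j q. (- d) ^ j * exp (- d * q)) 0 (Q w)))"
  proof (rule schwartz_comp_exp_decay[OF _ _ assms(5) assms(1-4)])
    show "((\<lambda>q. (- d) ^ j * exp (- d * q)) has_real_derivative (- d) ^ Suc j * exp (- d * q)) (at q)" for j q
      by (auto intro!: derivative_eq_intros)
    show "\<exists>C. \<forall>q\<ge>0. \<bar>(- d) ^ j * exp (- d * q)\<bar> \<le> C * exp (- d * q)" for j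
      by (intro exI[of _ "d ^ j"]) (use assms(5) in \<open>auto simp: abs_mult power_abs\<close>)
  qed
  then show ?thesis by simp
qed

lemma schwartz_expint:
  fixes Q :: "real \<times> real \<Rightarrow> real"
  assumes "(\<lambda>w. complex_of_real (Q w)) \<in> poly2" "\<And>w. Q w \<ge> 0"
    and "c > 0" "\<And>w. c * (norm w - 3) \<le> Q w" and "0 < \<epsilon>" "\<epsilon> < 1"
  shows "schwartz (\<lambda>w. of_real (expint \<epsilon> j (Q w)))"
proof (rule schwartz_comp_exp_decay[where h="expint \<epsilon>", OF expint_derivative _ assms(5) assms(1-4)])
  show "\<exists>C. \<forall>q\<ge>0. \<bar>expint \<epsilon> j q\<bar> \<le> C * exp (- \<epsilon> * q)" for j
    by (intro exI[of _ 1]) (use expint_bound[OF assms(5,6)] in auto)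
qed

section \<open>Dilations and weights\<close>

definition dil :: "real \<Rightarrow> real \<Rightarrow> real \<times> real \<Rightarrow> real \<times> real" where
  "dil A B w = (A * fst w, B * snd w)"

text \<open>The transform of a dilated function is dilated the opposite way and divided by the
  Jacobian, and integrating its modulus restores the Jacobian. Hence the right-hand side of the
  estimate does not notice dilations.\<close>

lemma L1norm_fourier2_dil:
  assumes [measurable]: "f \<in> borel_measurable borel" and AB: "A > 0" "B > 0"
  shows "L1norm (fourier2 (\<lambda>w. f (dil A B w))) = L1norm (fourier2 f)"
proof -
  have [measurable]: "dil A B \<in> borel \<rightarrow>\<^sub>M borel"
    unfolding dil_def[abs_def] by (intro borel_measurable_continuous_onI continuous_intros)
  have *: "fourier2 f v = of_real (A * B) * fourier2 (\<lambda>w. f (dil A B w)) (dil A B v)" for v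
  proof -
    have "fourier2 f v = \<bar>A * B\<bar> *\<^sub>R integral\<^sup>L lborel (\<lambda>z. f (0 + A * fst z, 0 + B * snd z) * fker (0 + A * fst z, 0 + B * snd z) v)"
      unfolding fourier2_eq by (rule plane_affine(1)) (use AB in auto)
    then show ?thesis using AB by (simp add: fourier2_eq dil_def fker_def scaleR_conv_of_real mult_ac)
  qed
  have "L1norm (fourier2 (\<lambda>w. f (dil A B w))) = \<bar>A * B\<bar> *\<^sub>R integral\<^sup>L lborel (\<lambda>v. norm (fourier2 (\<lambda>w. f (dil A B w)) (0 + A * fst v, 0 + B * snd v)))"
    unfolding L1norm_def by (rule plane_affine(1)) (use AB in auto)
  also have "\<dots> = L1norm (fourier2 f)"
    unfolding L1norm_def *[abs_def] using AB by (simp add: norm_mult dil_def)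
  finally show ?thesis .
qed

definition wght :: "real \<Rightarrow> real \<Rightarrow> real \<times> real \<Rightarrow> real" where
  "wght \<alpha> \<beta> w = wpow (fst w) \<alpha> * wpow (snd w) \<beta>"

lemma wght_nonneg [simp]: "wght \<alpha> \<beta> w \<ge> 0" by (simp add: wght_def)

lemma wght_measurable [measurable]: "wght \<alpha> \<beta> \<in> borel_measurable borel"
proof -
  note measurable_compose[OF borel_fst wpow_measurable, measurable] measurable_compose[OF borel_snd wpow_measurable, measurable]
  show ?thesis unfolding wght_def[abs_def] by measurable
qed

lemma wpow_growth:
  assumes "\<alpha> \<ge> 0" "\<bar>t\<bar> \<le> x" "x \<ge> 0"
  shows "wpow t \<alpha> \<le> (1 + x) ^ nat \<lceil>2 * \<alpha>\<rceil>"
proof (cases "\<alpha> = 0")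
  case False
  have "\<bar>t\<bar> powr (2 * \<alpha>) \<le> (1 + x) powr (2 * \<alpha>)" using assms by (intro powr_mono2) auto
  also have "\<dots> \<le> (1 + x) powr real (nat \<lceil>2 * \<alpha>\<rceil>)" using assms by (intro powr_mono) linarith+
  also have "\<dots> = (1 + x) ^ nat \<lceil>2 * \<alpha>\<rceil>" using assms by (intro powr_realpow) auto
  finally show ?thesis using False by (simp add: wpow_def)
qed (simp add: wpow_def)

lemma schwartz_weight_integrable:
  assumes u: "schwartz u" and "\<alpha> \<ge> 0" "\<beta> \<ge> 0"
  shows "integrable lborel (\<lambda>w. u w * of_real (wght \<alpha> \<beta> w))"
proof (rule Bochner_Integration.integrable_bound)
  let ?N = "nat \<lceil>2 * \<alpha>\<rceil> + nat \<lceil>2 * \<beta>\<rceil>"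
  show "integrable lborel (\<lambda>w. (1 + norm w) ^ ?N * norm (u w))" by (rule schwartz_integrable_moment[OF u])
  have [measurable]: "u \<in> borel_measurable borel" by (rule schwartz_borel[OF u])
  show "(\<lambda>w. u w * of_real (wght \<alpha> \<beta> w)) \<in> borel_measurable lborel" by simp
  have "wght \<alpha> \<beta> w \<le> (1 + norm w) ^ ?N" for w
    unfolding wght_def power_add using assms norm_coord_le[of w] by (intro mult_mono wpow_growth) auto
  then show "AE w in lborel. norm (u w * of_real (wght \<alpha> \<beta> w)) \<le> norm ((1 + norm w) ^ ?N * norm (u w))"
    using mult_right_mono[OF _ norm_ge_zero[of "u _"]] by (intro AE_I2) (simp add: norm_mult mult.commute[of "norm (u _)"])
qed

subsection \<open>Necessity\<close>

lemma powr_bounded_imp_zero: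
  fixes r M :: real
  assumes "\<And>t. t > 0 \<Longrightarrow> t powr r \<le> M"
  shows "r = 0"
proof (rule ccontr)
  assume "r \<noteq> 0"
  \<comment> \<open>The witness \<open>(abs M + 1) powr (1 / r)\<close> serves for either sign of
    \<open>r\<close>.\<close>
  then have "((\<bar>M\<bar> + 1) powr (1 / r)) powr r = \<bar>M\<bar> + 1" by (simp add: powr_powr)
  moreover have "((\<bar>M\<bar> + 1) powr (1 / r)) powr r \<le> M" by (rule assms) (simp add: add_nonneg_pos)
  ultimately show False by linarith
qed

lemma wpow_scale: "A > 0 \<Longrightarrow> wpow (A * x) \<alpha> = A powr (2 * \<alpha>) * wpow x \<alpha>"
  by (simp add: wpow_def abs_mult powr_mult)

text \<open>A square because each of the two test functions supplies one factor. It is close to 1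
  well inside the range from \<open>1\<close> to \<open>1 / \<epsilon>\<close>: this is the long
  range of scales.\<close>

definition Psi :: "real \<Rightarrow> real \<Rightarrow> real" where
  "Psi \<epsilon> q = (exp (- \<epsilon> * q) - exp (- q))\<^sup>2"

lemma Psi_nonneg [simp]: "Psi \<epsilon> q \<ge> 0" by (simp add: Psi_def)

lemma Psi_measurable [measurable]: "Psi \<epsilon> \<in> borel_measurable borel"
  unfolding Psi_def[abs_def] by measurable

text \<open>\<open>dy / y\<close> is the scale-invariant measure, so this measures how many scales
  \<open>Psi\<close> covers. The exponent is \<open>4 * l\<close> since \<open>Q\<close> has degree
  4 in the dilation parameter, which is \<open>y ^ l\<close> along an orbit.\<close>

definition Ieps :: "nat \<Rightarrow> real \<Rightarrow> real" where
  "Ieps l \<epsilon> = integral\<^sup>L lborel (\<lambda>y. indicator {0<..} y * (Psi \<epsilon> (y ^ (4 * l)) / y))"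

text \<open>The first bound gives convergence of \<open>Ieps\<close> at 0, the second at
  infinity.\<close>

lemma Psi_le:
  assumes "0 < \<epsilon>" "\<epsilon> < 1" "q \<ge> 0"
  shows "Psi \<epsilon> q \<le> q\<^sup>2" "Psi \<epsilon> q \<le> 1 / \<epsilon> / (1 + q)"
proof -
  have e: "exp (- q) \<le> exp (- \<epsilon> * q)" using assms by (simp add: mult_left_le_one_le)
  have "1 - exp (- q) \<le> q" using exp_ge_add_one_self[of "- q"] by linarith
  moreover have "exp (- \<epsilon> * q) \<le> 1" using assms by simp
  ultimately have "exp (- \<epsilon> * q) - exp (- q) \<le> q" by linarith
  then show "Psi \<epsilon> q \<le> q\<^sup>2" unfolding Psi_def using e by (intro power_mono) auto
  have "exp (- \<epsilon> * q) - exp (- q) \<le> exp (- \<epsilon> * q)" by simp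
  then have "Psi \<epsilon> q \<le> (exp (- \<epsilon> * q))\<^sup>2" unfolding Psi_def using e by (intro power_mono) auto
  also have "\<dots> \<le> exp (- \<epsilon> * q)"
    using assms by (simp add: power2_eq_square mult_left_le_one_le)
  also have "\<dots> \<le> 1 / (\<epsilon> * (1 + q))"
  proof -
    have "\<epsilon> * (1 + q) \<le> 1 + \<epsilon> * q" using assms by (simp add: algebra_simps)
    also have "\<dots> \<le> exp (\<epsilon> * q)" by (rule exp_ge_add_one_self)
    finally have "1 / exp (\<epsilon> * q) \<le> 1 / (\<epsilon> * (1 + q))" using assms by (intro divide_left_mono) auto
    then show ?thesis by (simp add: exp_minus divide_inverse)
  qed
  finally show "Psi \<epsilon> q \<le> 1 / \<epsilon> / (1 + q)" by simp
qed

lemma Psi_integrable: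
  assumes "0 < \<epsilon>" "\<epsilon> < 1" "l \<ge> 1"
  shows "integrable lborel (\<lambda>y. indicator {0<..} y * (Psi \<epsilon> (y ^ (4 * l)) / y))"
proof (rule Bochner_Integration.integrable_bound)
  show "integrable lborel (\<lambda>y. indicator {0..1} y + 1 / \<epsilon> * (indicator {1<..} y * y powr (- 2)) :: real)"
    by (intro Bochner_Integration.integrable_add integrable_mult_right integrable_powr_tail integrable_real_indicator) auto
  show "AE y in lborel. norm (indicator {0<..} y * (Psi \<epsilon> (y ^ (4 * l)) / y)) \<le> norm (indicator {0..1} y + 1 / \<epsilon> * (indicator {1<..} y * y powr (- 2)) :: real)"
  proof (intro AE_I2)
    fix y :: real
    consider "y \<le> 0" | "0 < y" "y \<le> 1" | "1 < y" by linarith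
    then show "norm (indicator {0<..} y * (Psi \<epsilon> (y ^ (4 * l)) / y)) \<le> norm (indicator {0..1} y + 1 / \<epsilon> * (indicator {1<..} y * y powr (- 2)) :: real)"
    proof cases
      case 2
      have "Psi \<epsilon> (y ^ (4 * l)) \<le> (y ^ (4 * l))\<^sup>2" using 2 by (intro Psi_le assms) auto
      also have "\<dots> = y ^ (8 * l)" by (simp add: power_mult[symmetric])
      also have "\<dots> \<le> y ^ 1" using 2 assms by (intro power_decreasing) auto
      finally show ?thesis using 2 by simp
    next
      case 3
      have "Psi \<epsilon> (y ^ (4 * l)) \<le> 1 / \<epsilon> / (1 + y ^ (4 * l))" using 3 by (intro Psi_le assms) auto
      also have "\<dots> \<le> 1 / \<epsilon> / y"
      proof (intro divide_left_mono)
        have "y ^ 1 \<le> y ^ (4 * l)" using 3 assms by (intro power_increasing) auto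
        then show "y \<le> 1 + y ^ (4 * l)" by simp
      qed (use 3 assms in \<open>auto simp: add_pos_nonneg\<close>)
      finally have "Psi \<epsilon> (y ^ (4 * l)) / y \<le> 1 / \<epsilon> / y / y" using 3 by (intro divide_right_mono) auto
      also have "\<dots> = 1 / \<epsilon> * y powr (- 2)" using 3 by (simp add: powr_minus powr_numeral power2_eq_square divide_inverse)
      finally show ?thesis using 3 assms by simp
    qed auto
  qed
qed measurable

text \<open>Replacing \<open>y\<close> by \<open>c * y\<close> with \<open>c ^ (4 * l) = q\<close>
  leaves \<open>dy / y\<close> unchanged.\<close>

lemma Psi_scaled:
  assumes "0 < \<epsilon>" "\<epsilon> < 1" "l \<ge> 1" "q > 0"
  shows "integrable lborel (\<lambda>y. indicator {0<..} y * (Psi \<epsilon> (y ^ (4 * l) * q) / y))"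
    and "integral\<^sup>L lborel (\<lambda>y. indicator {0<..} y * (Psi \<epsilon> (y ^ (4 * l) * q) / y)) = Ieps l \<epsilon>"
proof -
  define c where "c = q powr (1 / real (4 * l))"
  have c: "c > 0" "c ^ (4 * l) = q"
    using assms by (auto simp: c_def powr_powr powr_realpow[symmetric] simp del: of_nat_mult)
  have *: "indicator {0<..} (0 + c * y) * (Psi \<epsilon> ((0 + c * y) ^ (4 * l)) / (0 + c * y)) = (1 / c) * (indicator {0<..} y * (Psi \<epsilon> (y ^ (4 * l) * q) / y))" for y :: real
    using c by (auto simp: indicator_def zero_less_mult_iff power_mult_distrib mult.commute)
  have "integrable lborel (\<lambda>y. indicator {0<..} (0 + c * y) * (Psi \<epsilon> ((0 + c * y) ^ (4 * l)) / (0 + c * y)))"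
    by (rule lborel_integrable_real_affine[OF Psi_integrable[OF assms(1-3)]]) (use c in auto)
  then have "integrable lborel (\<lambda>y. c * ((1 / c) * (indicator {0<..} y * (Psi \<epsilon> (y ^ (4 * l) * q) / y))))"
    unfolding * by (rule integrable_mult_right)
  then show "integrable lborel (\<lambda>y. indicator {0<..} y * (Psi \<epsilon> (y ^ (4 * l) * q) / y))" using c(1) by simp
  have "Ieps l \<epsilon> = \<bar>c\<bar> *\<^sub>R integral\<^sup>L lborel (\<lambda>y. indicator {0<..} (0 + c * y) * (Psi \<epsilon> ((0 + c * y) ^ (4 * l)) / (0 + c * y)))"
    unfolding Ieps_def by (rule lborel_integral_real_affine) (use c in auto)
  then show "integral\<^sup>L lborel (\<lambda>y. indicator {0<..} y * (Psi \<epsilon> (y ^ (4 * l) * q) / y)) = Ieps l \<epsilon>"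
    unfolding * integral_mult_right_zero using c(1) by simp
qed

text \<open>For \<open>\<epsilon> = 1 / R ^ (4 * l)\<close> the integrand is at least
  \<open>m / y\<close> on \<open>{2..R}\<close>, so the integral is at least
  \<open>m * ln (R / 2)\<close>; \<open>R\<close> is chosen to make this equal to
  \<open>abs M\<close>.\<close>

lemma Ieps_unbounded:
  assumes "l \<ge> 1"
  obtains \<epsilon> where "0 < \<epsilon>" "\<epsilon> < 1" "Ieps l \<epsilon> \<ge> M"
proof -
  define m where "m = (exp (- 1) - exp (- 2) :: real)\<^sup>2"
  have m: "m > 0" by (simp add: m_def)
  define R where "R = 2 * exp (\<bar>M\<bar> / m)"
  have R: "R \<ge> 2" using m by (simp add: R_def)
  define \<epsilon> where "\<epsilon> = 1 / R ^ (4 * l)"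
  have "R ^ 1 \<le> R ^ (4 * l)" using R assms by (intro power_increasing) auto
  then have \<epsilon>: "0 < \<epsilon>" "\<epsilon> < 1" using R by (auto simp: \<epsilon>_def divide_simps)
  have "((\<lambda>y. m * (1 / y)) has_integral (m * ln R - m * ln 2)) {2..R}"
  proof (rule fundamental_theorem_of_calculus[OF R])
    fix y assume "y \<in> {2..R}"
    then show "((\<lambda>y. m * ln y) has_vector_derivative m * (1 / y)) (at y within {2..R})"
      unfolding has_real_derivative_iff_has_vector_derivative[symmetric]
      by (auto intro!: derivative_eq_intros)
  qed
  moreover have si: "set_integrable lborel {2..R} (\<lambda>y. m * (1 / y))"
    by (rule borel_integrable_atLeastAtMost') (auto intro!: continuous_intros)
  ultimately have "(LINT y:{2..R}|lborel. m * (1 / y)) = m * ln R - m * ln 2"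
    using set_borel_integral_eq_integral(2)[OF si] by (simp add: integral_unique)
  also have "\<dots> = \<bar>M\<bar>" using m by (simp add: R_def ln_mult algebra_simps)
  finally have "\<bar>M\<bar> = integral\<^sup>L lborel (\<lambda>y. indicator {2..R} y * (m * (1 / y)))"
    by (simp add: set_lebesgue_integral_def)
  also have "\<dots> \<le> Ieps l \<epsilon>"
    unfolding Ieps_def
  proof (rule integral_mono)
    show "integrable lborel (\<lambda>y. indicator {2..R} y * (m * (1 / y)))"
      using si by (simp add: set_integrable_def)
    show "integrable lborel (\<lambda>y. indicator {0<..} y * (Psi \<epsilon> (y ^ (4 * l)) / y))"
      by (rule Psi_integrable[OF \<epsilon> assms])
    fix y :: real
    show "indicator {2..R} y * (m * (1 / y)) \<le> indicator {0<..} y * (Psi \<epsilon> (y ^ (4 * l)) / y)"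
    proof (cases "y \<in> {2..R}")
      case True
      have "y ^ (4 * l) \<le> R ^ (4 * l)" using True by (intro power_mono) auto
      then have "\<epsilon> * y ^ (4 * l) \<le> 1" using R by (simp add: \<epsilon>_def)
      then have 1: "exp (- 1) \<le> exp (- \<epsilon> * y ^ (4 * l))" by simp
      have "y ^ 1 \<le> y ^ (4 * l)" using True assms by (intro power_increasing) auto
      then have 2: "exp (- (y ^ (4 * l))) \<le> exp (- 2)" using True by simp
      have "m \<le> Psi \<epsilon> (y ^ (4 * l))" unfolding m_def Psi_def by (intro power_mono diff_mono 1 2) auto
      then show ?thesis using True by (simp add: divide_right_mono)
    qed (auto simp: indicator_def)
  qed
  finally have "M \<le> Ieps l \<epsilon>" by simp
  then show ?thesis using that \<epsilon> by blast
qed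

text \<open>\<open>a\<close> and \<open>b\<close> stand for \<open>tau1 k l \<tau>\<close> and
  \<open>sigma1 k l \<sigma>\<close>.\<close>

locale elliptic_pair =
  fixes k l :: nat and \<alpha> \<beta> :: real and a b :: complex
  assumes k1: "k \<ge> 1" and l1: "l \<ge> 1" and \<alpha>0: "\<alpha> \<ge> 0" and \<beta>0: "\<beta> \<ge> 0"
    and ella: "ell_coeff k l a" and ellb: "ell_coeff k l b"
begin

abbreviation "Pa \<equiv> psym k l a"
abbreviation "Pb \<equiv> psym k l b"

text \<open>The product of \<open>Pa\<close>, \<open>Pb\<close> and their conjugates: a non-negative
  polynomial divisible by both symbols. Divisibility allows test functions to cancel a symbol
  without a quotient that is singular at the origin.\<close>

definition Q :: "real \<times> real \<Rightarrow> real" where "Q w = (norm (Pa w) * norm (Pb w))\<^sup>2"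

lemma Q_nonneg: "Q w \<ge> 0" by (simp add: Q_def)

lemma Q_complex: "complex_of_real (Q w) = (Pa w * cnj (Pa w)) * (Pb w * cnj (Pb w))"
  unfolding Q_def power_mult_distrib of_real_mult complex_norm_square ..

lemma Q_poly2: "(\<lambda>w. complex_of_real (Q w)) \<in> poly2"
  unfolding Q_complex by (intro poly2.mult poly2_cnj poly2_psym)

lemma Q_measurable [measurable]: "Q \<in> borel_measurable borel"
  unfolding Q_def[abs_def] by measurable

lemma Q_coercive:
  obtains c where "c > 0" "\<And>w. c * (norm w - 3) \<le> Q w"
proof -
  obtain c1 where c1: "c1 > 0" "\<And>w. c1 * (\<bar>fst w\<bar> ^ k + \<bar>snd w\<bar> ^ l) \<le> norm (Pa w)"
    using psym_coercive[OF ella] by blast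
  obtain c2 where c2: "c2 > 0" "\<And>w. c2 * (\<bar>fst w\<bar> ^ k + \<bar>snd w\<bar> ^ l) \<le> norm (Pb w)"
    using psym_coercive[OF ellb] by blast
  show ?thesis
  proof (rule that[of "(c1 * c2)\<^sup>2"])
    fix w :: "real \<times> real"
    define t where "t = \<bar>fst w\<bar> ^ k + \<bar>snd w\<bar> ^ l"
    have t0: "t \<ge> 0" by (simp add: t_def)
    have pw: "x - 1 \<le> x ^ n" if "x \<ge> 0" "n \<ge> 1" for x :: real and n
    proof (cases "x \<ge> 1")
      case True
      then show ?thesis using self_le_power[of x n] that by simp
    next
      case False
      then show ?thesis using that zero_le_power[of x n] by linarith
    qed
    have "norm w \<le> \<bar>fst w\<bar> + \<bar>snd w\<bar>" using norm_Pair_le[of "fst w" "snd w"] by simp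
    then have tw: "norm w - 2 \<le> t"
      using pw[of "\<bar>fst w\<bar>" k] pw[of "\<bar>snd w\<bar>" l] k1 l1 by (simp add: t_def)
    \<comment> \<open>The offset 3 comes from \<open>norm w - 2 \<le> t\<close> and
      \<open>t - 1 \<le> t ^ 4\<close>.\<close>
    have "(c1 * c2)\<^sup>2 * (norm w - 3) \<le> (c1 * c2)\<^sup>2 * t ^ 4"
      using tw pw[OF t0, of 4] by (intro mult_left_mono) auto
    also have "\<dots> = ((c1 * t) * (c2 * t))\<^sup>2" by (simp add: power2_eq_square power4_eq_xxxx)
    also have "\<dots> \<le> Q w"
      unfolding Q_def using c1 c2 t0 by (intro power_mono mult_mono) (auto simp: t_def)
    finally show "(c1 * c2)\<^sup>2 * (norm w - 3) \<le> Q w" .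
  qed (use c1 c2 in simp)
qed

lemma schwartz_exp_Q: "d > 0 \<Longrightarrow> schwartz (\<lambda>w. of_real (exp (- d * Q w)))"
  using Q_coercive schwartz_exp[OF Q_poly2 Q_nonneg] by metis

lemma schwartz_expint_Q: "0 < \<epsilon> \<Longrightarrow> \<epsilon> < 1 \<Longrightarrow> schwartz (\<lambda>w. of_real (expint \<epsilon> 0 (Q w)))"
  using Q_coercive schwartz_expint[OF Q_poly2 Q_nonneg] by metis

text \<open>The anisotropic dilation under which \<open>psym\<close> and \<open>Asym\<close> have
  degree 1.\<close>

abbreviation "del t \<equiv> dil (t powr (1 / real k)) (t powr (1 / real l))"

lemma root_powers: "t > 0 \<Longrightarrow> (t powr (1 / real k)) ^ k = t" "t > 0 \<Longrightarrow> (t powr (1 / real l)) ^ l = t"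
  using k1 l1 by (auto simp: powr_powr powr_realpow[symmetric])

lemma psym_del: "t > 0 \<Longrightarrow> psym k l c (del t w) = of_real t * psym k l c w"
  by (simp add: psym_def dil_def power_mult_distrib of_real_power[symmetric] root_powers algebra_simps del: of_real_power)

lemma Asym_del:
  assumes "t > 0"
  shows "Asym k l c (del t w) = of_real t * Asym k l c w"
proof -
  have "complex_of_real (t powr (1 / real k)) ^ k = of_real t" "complex_of_real (t powr (1 / real l)) ^ l = of_real t"
    using root_powers[OF assms] by (simp_all add: of_real_power[symmetric] del: of_real_power)
  then show ?thesis by (simp add: Asym_def dil_def power_mult_distrib algebra_simps)
qed

lemma Q_del: "t > 0 \<Longrightarrow> Q (del t w) = t ^ 4 * Q w"
  by (simp add: Q_def psym_del norm_mult power2_eq_square power4_eq_xxxx)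

text \<open>\<open>exp (- (t ^ 4) * Q w)\<close> is \<open>exp (- Q)\<close> taken at
  \<open>del t w\<close>. Dilation invariance removes \<open>del t\<close>, and the degree of the
  symbol produces the division by \<open>t\<close>.\<close>

lemma L1norm_exp_del:
  assumes "t > 0"
  shows "L1norm (fourier2 (\<lambda>w. of_real (exp (- (t ^ 4) * Q w)))) = L1norm (fourier2 (\<lambda>w. of_real (exp (- Q w))))"
    and "L1norm (fourier2 (\<lambda>w. Asym k l c w * of_real (exp (- (t ^ 4) * Q w)))) = L1norm (fourier2 (\<lambda>w. Asym k l c w * of_real (exp (- Q w)))) / t"
proof -
  have m: "(\<lambda>w. complex_of_real (exp (- Q w))) \<in> borel_measurable borel" by measurable
  have A: "Asym k l c \<in> borel_measurable borel"
    using poly2_differentiable[OF poly2_Asym]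
    by (intro borel_measurable_continuous_onI continuous_at_imp_continuous_on ballI differentiable_imp_continuous_within)
  have pos: "t powr (1 / real k) > 0" "t powr (1 / real l) > 0" using assms by auto
  show "L1norm (fourier2 (\<lambda>w. of_real (exp (- (t ^ 4) * Q w)))) = L1norm (fourier2 (\<lambda>w. of_real (exp (- Q w))))"
    using L1norm_fourier2_dil[OF m pos] Q_del[OF assms] by simp
  have "(\<lambda>w. Asym k l c w * of_real (exp (- (t ^ 4) * Q w))) = (\<lambda>w. of_real (1 / t) * (Asym k l c (del t w) * of_real (exp (- Q (del t w)))))"
    using assms by (simp add: Q_del Asym_del)
  then have "fourier2 (\<lambda>w. Asym k l c w * of_real (exp (- (t ^ 4) * Q w))) = (\<lambda>x. of_real (1 / t) * fourier2 (\<lambda>w. Asym k l c (del t w) * of_real (exp (- Q (del t w)))) x)"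
    by (simp only: fourier2_cmult[abs_def])
  then have "L1norm (fourier2 (\<lambda>w. Asym k l c w * of_real (exp (- (t ^ 4) * Q w)))) = (1 / t) * L1norm (fourier2 (\<lambda>w. Asym k l c (del t w) * of_real (exp (- Q (del t w)))))"
    using assms by (simp add: L1norm_def norm_mult norm_divide)
  also have "L1norm (fourier2 (\<lambda>w. Asym k l c (del t w) * of_real (exp (- Q (del t w))))) = L1norm (fourier2 (\<lambda>w. Asym k l c w * of_real (exp (- Q w))))"
    using L1norm_fourier2_dil[OF borel_measurable_times[OF A m] pos] by simp
  finally show "L1norm (fourier2 (\<lambda>w. Asym k l c w * of_real (exp (- (t ^ 4) * Q w)))) = L1norm (fourier2 (\<lambda>w. Asym k l c w * of_real (exp (- Q w)))) / t"
    by simp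
qed

lemma wght_del: "t > 0 \<Longrightarrow> wght \<alpha> \<beta> (del t w) = t powr (2 * \<alpha> / real k + 2 * \<beta> / real l) * wght \<alpha> \<beta> w"
  by (simp add: wght_def dil_def wpow_scale powr_powr powr_add)

lemma gauss_weight_pos: "integral\<^sup>L lborel (\<lambda>w. exp (- 2 * Q w) * wght \<alpha> \<beta> w) > 0" (is "?I > 0")
  and gauss_weight_integrable: "integrable lborel (\<lambda>w. exp (- 2 * Q w) * wght \<alpha> \<beta> w)"
proof -
  have "integrable lborel (\<lambda>w. complex_of_real (exp (- 2 * Q w) * wght \<alpha> \<beta> w))"
    using schwartz_weight_integrable[OF schwartz_exp_Q[of 2] \<alpha>0 \<beta>0] by simp
  then show i: "integrable lborel (\<lambda>w. exp (- 2 * Q w) * wght \<alpha> \<beta> w)"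
    using complex_of_real_integrable_eq by blast
  have "?I \<noteq> 0"
  proof
    assume "?I = 0"
    then have "AE w in lborel. exp (- 2 * Q w) * wght \<alpha> \<beta> w = 0"
      using integral_nonneg_eq_0_iff_AE[OF i] by simp
    then have "AE w in lborel. w \<notin> cbox (1 :: real, 1 :: real) (2, 2)"
    proof eventually_elim
      case (elim w)
      then show ?case by (auto simp: wght_def wpow_def cbox_Pair_eq split: if_splits)
    qed
    then have "emeasure lborel (cbox (1, 1) (2, 2) :: (real \<times> real) set) = 0"
      by (subst (asm) AE_iff_measurable[OF _ refl]) auto
    then show False by (simp add: emeasure_lborel_cbox_eq Basis_prod_def prod.union_disjoint)
  qed
  moreover have "?I \<ge> 0" by (intro integral_nonneg_AE) auto
  ultimately show "?I > 0" by (metis order_le_less)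
qed

text \<open>Both Fourier transforms are taken to be \<open>exp (- (t ^ 4) * Q)\<close>. The form
  then scales like \<open>t powr (- \<gamma>)\<close> and the product of the norms like
  \<open>t powr (- 2)\<close>, so \<open>t powr (2 - \<gamma>)\<close> is bounded for all
  \<open>t > 0\<close>.\<close>

lemma BE_homogeneity:
  assumes BE: "BE k l \<alpha> \<beta> \<sigma> \<tau>"
  shows "(2 * \<alpha> + 1) / real k + (2 * \<beta> + 1) / real l = 2"
proof -
  define \<gamma> where "\<gamma> = (2 * \<alpha> + 1) / real k + (2 * \<beta> + 1) / real l"
  define I where "I = integral\<^sup>L lborel (\<lambda>w. exp (- 2 * Q w) * wght \<alpha> \<beta> w)"
  have I: "I > 0" unfolding I_def by (rule gauss_weight_pos)
  obtain C where C: "\<And>u v. schwartz u \<Longrightarrow> schwartz v \<Longrightarrow>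
     norm (integral\<^sup>L lborel (\<lambda>z. u z * cnj (v z) * of_real (wpow (fst z) \<alpha> * wpow (snd z) \<beta>)))
       \<le> C * L1norm (fourier2 (\<lambda>z. Asym k l \<tau> z * u z)) * L1norm (fourier2 (\<lambda>z. Asym k l \<sigma> z * v z))"
    using BE_fourier_side[OF BE] by blast
  define N where "N c = L1norm (fourier2 (\<lambda>w. Asym k l c w * of_real (exp (- Q w))))" for c
  have "t powr (2 - \<gamma>) \<le> C * N \<tau> * N \<sigma> / I" if t: "t > 0" for t
  proof -
    let ?u = "\<lambda>w. complex_of_real (exp (- (t ^ 4) * Q w))"
    have s: "schwartz ?u" using t by (intro schwartz_exp_Q) simp
    have "I = \<bar>t powr (1 / real k) * t powr (1 / real l)\<bar> *\<^sub>R integral\<^sup>L lborel (\<lambda>z. (\<lambda>w. exp (- 2 * Q w) * wght \<alpha> \<beta> w) (0 + t powr (1 / real k) * fst z, 0 + t powr (1 / real l) * snd z))"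
      unfolding I_def by (rule plane_affine(1)) (use t in auto)
    also have "\<dots> = t powr (1 / real k + 1 / real l) * integral\<^sup>L lborel (\<lambda>z. exp (- 2 * Q (del t z)) * wght \<alpha> \<beta> (del t z))"
      using t by (simp add: powr_add dil_def)
    also have "(\<lambda>z. exp (- 2 * Q (del t z)) * wght \<alpha> \<beta> (del t z)) = (\<lambda>z. t powr (2 * \<alpha> / real k + 2 * \<beta> / real l) * (exp (- 2 * (t ^ 4 * Q z)) * wght \<alpha> \<beta> z))"
      using t by (intro ext) (simp add: Q_del wght_del)
    also have "t powr (1 / real k + 1 / real l) * integral\<^sup>L lborel \<dots> = t powr (1 / real k + 1 / real l) * (t powr (2 * \<alpha> / real k + 2 * \<beta> / real l) * integral\<^sup>L lborel (\<lambda>z. exp (- 2 * (t ^ 4 * Q z)) * wght \<alpha> \<beta> z))"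
      by (simp only: integral_mult_right_zero)
    also have "\<dots> = t powr \<gamma> * integral\<^sup>L lborel (\<lambda>z. exp (- 2 * (t ^ 4 * Q z)) * wght \<alpha> \<beta> z)"
      by (simp add: \<gamma>_def powr_add add_divide_distrib)
    finally have eq: "integral\<^sup>L lborel (\<lambda>z. exp (- 2 * (t ^ 4 * Q z)) * wght \<alpha> \<beta> z) = I * t powr (- \<gamma>)"
      using t by (simp add: powr_minus field_simps)
    have "(\<lambda>z. ?u z * cnj (?u z) * of_real (wpow (fst z) \<alpha> * wpow (snd z) \<beta>)) = (\<lambda>z. complex_of_real (exp (- 2 * (t ^ 4 * Q z)) * wght \<alpha> \<beta> z))"
      by (simp add: wght_def exp_add[symmetric] of_real_mult[symmetric] mult.commute[of "Q _"] del: exp_add of_real_mult)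
    then have "integral\<^sup>L lborel (\<lambda>z. ?u z * cnj (?u z) * of_real (wpow (fst z) \<alpha> * wpow (snd z) \<beta>)) = complex_of_real (I * t powr (- \<gamma>))"
      by (simp only: integral_complex_of_real eq)
    then have "norm (complex_of_real (I * t powr (- \<gamma>))) \<le> C * (N \<tau> / t) * (N \<sigma> / t)"
      using C[OF s s] unfolding L1norm_exp_del(2)[OF t] N_def by simp
    then have "I * t powr (- \<gamma>) \<le> C * N \<tau> * N \<sigma> / t\<^sup>2"
      using I by (simp add: norm_mult power2_eq_square)
    then have "I * (t\<^sup>2 * t powr (- \<gamma>)) \<le> C * N \<tau> * N \<sigma>" using t by (simp add: field_simps)
    also have "t\<^sup>2 * t powr (- \<gamma>) = t powr (2 - \<gamma>)" using t by (simp add: powr_diff powr_minus powr_numeral divide_inverse)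
    finally show ?thesis using I by (simp add: field_simps)
  qed
  from powr_bounded_imp_zero[OF this] show ?thesis by (simp add: \<gamma>_def)
qed

lemma psym_nonzero:
  assumes "ell_coeff k l c" "w \<noteq> 0"
  shows "psym k l c w \<noteq> 0"
proof -
  obtain d where d: "d > 0" "\<And>w. d * (\<bar>fst w\<bar> ^ k + \<bar>snd w\<bar> ^ l) \<le> norm (psym k l c w)"
    using psym_coercive[OF assms(1)] by blast
  have "fst w \<noteq> 0 \<or> snd w \<noteq> 0" using assms(2) by (auto simp: prod_eq_iff)
  then have "\<bar>fst w\<bar> ^ k + \<bar>snd w\<bar> ^ l > 0"
    by (auto intro: add_pos_nonneg add_nonneg_pos)
  then have "0 < d * (\<bar>fst w\<bar> ^ k + \<bar>snd w\<bar> ^ l)" using d by simp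
  then show ?thesis using d(2)[of w] by auto
qed

text \<open>The multiplier through which the form pairs the transforms of the two differential
  expressions. At the origin, a null set, division by zero makes it 0.\<close>

definition symb :: "real \<times> real \<Rightarrow> complex" where
  "symb w = of_real (wght \<alpha> \<beta> w) / (Pa w * Pb w)"

lemma symb_measurable [measurable]: "symb \<in> borel_measurable borel"
  unfolding symb_def[abs_def] by measurable

lemma schwartz_product_integrable:
  assumes u: "schwartz u" and v: "schwartz v"
  shows "integrable lborel (\<lambda>w. u w * cnj (v w) * of_real (wght \<alpha> \<beta> w))"
proof -
  obtain B where B: "B \<ge> 0" "\<And>z. norm (v z) \<le> B"
    using rapidD[OF schwartz_rapid[OF v], of 0] unfolding power_0 mult_1 by blast
  have [measurable]: "u \<in> borel_measurable borel" "v \<in> borel_measurable borel"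
    using u v by (auto intro: schwartz_borel)
  have [measurable]: "(\<lambda>w. cnj (v w)) \<in> borel_measurable borel"
    by (rule measurable_compose[OF _ borel_measurable_continuous_onI[OF continuous_on_cnj[OF continuous_on_id]]]) simp
  show ?thesis
  proof (rule Bochner_Integration.integrable_bound)
    show "integrable lborel (\<lambda>w. B *\<^sub>R (u w * of_real (wght \<alpha> \<beta> w)))"
      by (intro integrable_scaleR_right schwartz_weight_integrable u \<alpha>0 \<beta>0)
    show "(\<lambda>w. u w * cnj (v w) * of_real (wght \<alpha> \<beta> w)) \<in> borel_measurable lborel" by simp
    show "AE w in lborel. norm (u w * cnj (v w) * of_real (wght \<alpha> \<beta> w)) \<le> norm (B *\<^sub>R (u w * of_real (wght \<alpha> \<beta> w)))"
    proof (intro AE_I2)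
      fix w
      have "norm (v w) * (norm (u w) * wght \<alpha> \<beta> w) \<le> B * (norm (u w) * wght \<alpha> \<beta> w)"
        by (intro mult_right_mono B) auto
      then show "norm (u w * cnj (v w) * of_real (wght \<alpha> \<beta> w)) \<le> norm (B *\<^sub>R (u w * of_real (wght \<alpha> \<beta> w)))"
        using B(1) by (simp add: norm_mult mult_ac)
    qed
  qed
qed

lemma AE_nonzero_plane: "AE w in lborel. w \<noteq> (0 :: real \<times> real)"
  by (rule AE_lborel_singleton)

lemma BE_average_bound:
  assumes BE: "BE k l \<alpha> \<beta> \<sigma> \<tau>" and a: "a = tau1 k l \<tau>" and b: "b = sigma1 k l \<sigma>"
  obtains M where "\<And>\<epsilon>. 0 < \<epsilon> \<Longrightarrow> \<epsilon> < 1 \<Longrightarrow> integrable lborel (\<lambda>w. of_real (Psi \<epsilon> (Q w)) * symb w)"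
    "\<And>\<epsilon>. 0 < \<epsilon> \<Longrightarrow> \<epsilon> < 1 \<Longrightarrow> norm (integral\<^sup>L lborel (\<lambda>w. of_real (Psi \<epsilon> (Q w)) * symb w)) \<le> M"
proof -
  obtain C where C: "\<And>u v. schwartz u \<Longrightarrow> schwartz v \<Longrightarrow>
     norm (integral\<^sup>L lborel (\<lambda>z. u z * cnj (v z) * of_real (wpow (fst z) \<alpha> * wpow (snd z) \<beta>)))
       \<le> C * L1norm (fourier2 (\<lambda>z. Asym k l \<tau> z * u z)) * L1norm (fourier2 (\<lambda>z. Asym k l \<sigma> z * v z))"
    using BE_fourier_side[OF BE] by blast
  define N where "N = (2 * pi) ^ k * (2 * L1norm (fourier2 (\<lambda>w. of_real (exp (- Q w)))))"
  have N0: "N \<ge> 0" by (simp add: N_def L1norm_nonneg)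
  have main: "integrable lborel (\<lambda>w. of_real (Psi \<epsilon> (Q w)) * symb w) \<and>
      norm (integral\<^sup>L lborel (\<lambda>w. of_real (Psi \<epsilon> (Q w)) * symb w)) \<le> \<bar>C\<bar> * N * N" if \<epsilon>: "0 < \<epsilon>" "\<epsilon> < 1" for \<epsilon>
  proof -
    \<comment> \<open>\<open>u\<close> and \<open>v\<close> are chosen such that the symbols turn them into a multiple of \<open>F\<close>, and the inverse Fourier transforms
      of the two terms of \<open>F\<close> are dilates of each other, so their \<open>L\<^sub>1\<close> norms do not depend on \<open>\<epsilon>\<close>\<close>
    define E where "E w = complex_of_real (expint \<epsilon> 0 (Q w))" for w
    define F where "F w = complex_of_real (exp (- \<epsilon> * Q w)) - complex_of_real (exp (- Q w))" for w
    define u where "u w = (cnj (Pa w) * (Pb w * cnj (Pb w))) * E w" for w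
    define v where "v w = (Pb w * (Pa w * cnj (Pa w))) * E w" for w
    have QE: "of_real (Q w) * E w = F w" for w
      using expint_0[OF \<epsilon>, of "Q w"] unfolding E_def F_def by (simp only: of_real_mult[symmetric] of_real_diff[symmetric])
    have u: "schwartz u" and v: "schwartz v"
      unfolding u_def v_def E_def
      by (intro schwartz_poly_mult schwartz_expint_Q poly2.mult poly2_cnj poly2_psym \<epsilon>)+
    have F: "L1norm (fourier2 (\<lambda>w. (2 * pi * \<i>) ^ k * F w)) \<le> N"
    proof -
      define t where "t = \<epsilon> powr (1 / 4)"
      have t: "t > 0" "t ^ 4 = \<epsilon>" using \<epsilon> by (auto simp: t_def powr_powr powr_realpow[symmetric])
      have s: "schwartz (\<lambda>w. complex_of_real (exp (- \<epsilon> * Q w)))" "schwartz (\<lambda>w. complex_of_real (exp (- Q w)))"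
        using schwartz_exp_Q[OF \<epsilon>(1)] schwartz_exp_Q[of 1] by simp_all
      note fi = s[THEN schwartz_fourier2, THEN schwartz_integrable]
      have fe: "fourier2 (\<lambda>w. (2 * pi * \<i>) ^ k * F w) = (\<lambda>x. (2 * pi * \<i>) ^ k * (fourier2 (\<lambda>w. complex_of_real (exp (- \<epsilon> * Q w))) x - fourier2 (\<lambda>w. complex_of_real (exp (- Q w))) x))"
        unfolding fourier2_cmult[abs_def] F_def
        by (intro ext arg_cong[where f="\<lambda>x. _ * x"] fourier2_diff s[THEN schwartz_integrable])
      have "L1norm (fourier2 (\<lambda>w. (2 * pi * \<i>) ^ k * F w)) = (2 * pi) ^ k * integral\<^sup>L lborel (\<lambda>x. norm (fourier2 (\<lambda>w. complex_of_real (exp (- \<epsilon> * Q w))) x - fourier2 (\<lambda>w. complex_of_real (exp (- Q w))) x))"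
        unfolding L1norm_def fe by (simp add: norm_mult norm_power)
      also have "integral\<^sup>L lborel (\<lambda>x. norm (fourier2 (\<lambda>w. complex_of_real (exp (- \<epsilon> * Q w))) x - fourier2 (\<lambda>w. complex_of_real (exp (- Q w))) x))
         \<le> integral\<^sup>L lborel (\<lambda>x. norm (fourier2 (\<lambda>w. complex_of_real (exp (- \<epsilon> * Q w))) x) + norm (fourier2 (\<lambda>w. complex_of_real (exp (- Q w))) x))"
        using fi by (intro integral_mono integrable_norm Bochner_Integration.integrable_diff Bochner_Integration.integrable_add norm_triangle_ineq4)
      also have "\<dots> = L1norm (fourier2 (\<lambda>w. complex_of_real (exp (- \<epsilon> * Q w)))) + L1norm (fourier2 (\<lambda>w. complex_of_real (exp (- Q w))))"
        unfolding L1norm_def using fi by (intro Bochner_Integration.integral_add integrable_norm)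
      also have "\<dots> = 2 * L1norm (fourier2 (\<lambda>w. complex_of_real (exp (- Q w))))"
        using L1norm_exp_del(1)[OF t(1)] t(2) by simp
      finally show ?thesis unfolding N_def by (simp add: mult_left_mono)
    qed
    have au: "Asym k l \<tau> w * u w = (2 * pi * \<i>) ^ k * F w" for w
      unfolding QE[symmetric] Q_complex Asym_eq_psym(1)[OF k1] u_def a[symmetric] by (simp add: mult_ac)
    have "Asym k l \<sigma> w = (2 * pi * \<i>) ^ k * cnj (Pb w)" for w
      using arg_cong[OF Asym_eq_psym(2)[OF k1, of l \<sigma> w], of cnj] unfolding b[symmetric] by simp
    then have av: "Asym k l \<sigma> w * v w = (2 * pi * \<i>) ^ k * F w" for w
      unfolding QE[symmetric] Q_complex v_def by (simp add: mult_ac)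
    \<comment> \<open>Away from the origin both symbols are non-zero, and \<open>u * cnj v\<close>
      is \<open>Psi\<close> divided by their product.\<close>
    have ae: "AE w in lborel. u w * cnj (v w) * of_real (wght \<alpha> \<beta> w) = of_real (Psi \<epsilon> (Q w)) * symb w"
      using AE_nonzero_plane
    proof eventually_elim
      case (elim w)
      have nz: "Pa w \<noteq> 0" "Pb w \<noteq> 0" using psym_nonzero elim ella ellb by auto
      have "cnj (E w) = E w" by (simp add: E_def)
      then have "u w * cnj (v w) * (Pa w * Pb w) = (of_real (Q w) * E w) * (of_real (Q w) * E w)"
        unfolding u_def v_def Q_complex by (simp add: mult_ac)
      also have "\<dots> = of_real (Psi \<epsilon> (Q w))"
        unfolding QE F_def Psi_def by (simp add: power2_eq_square)
      finally have "u w * cnj (v w) = of_real (Psi \<epsilon> (Q w)) / (Pa w * Pb w)" using nz by (simp add: field_simps)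
      then show ?case by (simp add: symb_def)
    qed
    note i = schwartz_product_integrable[OF u v]
    have m: "(\<lambda>w. of_real (Psi \<epsilon> (Q w)) * symb w) \<in> borel_measurable lborel" by measurable
    have "norm (integral\<^sup>L lborel (\<lambda>w. of_real (Psi \<epsilon> (Q w)) * symb w)) = norm (integral\<^sup>L lborel (\<lambda>z. u z * cnj (v z) * of_real (wpow (fst z) \<alpha> * wpow (snd z) \<beta>)))"
      using integral_cong_AE[OF borel_measurable_integrable[OF i] m ae] by (simp add: wght_def)
    also have "\<dots> \<le> C * L1norm (fourier2 (\<lambda>z. (2 * pi * \<i>) ^ k * F z)) * L1norm (fourier2 (\<lambda>z. (2 * pi * \<i>) ^ k * F z))"
      using C[OF u v] unfolding au av .
    also have "\<dots> \<le> \<bar>C\<bar> * L1norm (fourier2 (\<lambda>z. (2 * pi * \<i>) ^ k * F z)) * L1norm (fourier2 (\<lambda>z. (2 * pi * \<i>) ^ k * F z))"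
      by (intro mult_right_mono L1norm_nonneg) auto
    also have "\<dots> \<le> \<bar>C\<bar> * N * N" using F N0 by (intro mult_mono L1norm_nonneg mult_nonneg_nonneg) auto
    finally show ?thesis
      using iffD1[OF integrable_cong_AE[OF borel_measurable_integrable[OF i] m ae] i] by blast
  qed
  show ?thesis using main by (intro that[of "\<bar>C\<bar> * N * N"]) auto
qed

end

section \<open>Slices of the symbol along dilation orbits\<close>

locale critical_pair = elliptic_pair +
  assumes crit: "(2 * \<alpha> + 1) / real k + (2 * \<beta> + 1) / real l = 2"
begin

definition esgn :: "real \<Rightarrow> real" where "esgn y = (if y > 0 then 1 else (- 1) ^ l)"

text \<open>\<open>(rad y * s, y)\<close> is the image of \<open>(s, sgn y)\<close> under the
  dilation with parameter \<open>abs y ^ l\<close>, so \<open>s\<close> labels the orbit.\<close>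

definition rad :: "real \<Rightarrow> real" where "rad y = \<bar>y\<bar> powr (real l / real k)"

lemma rad_pos: "y \<noteq> 0 \<Longrightarrow> rad y > 0" by (simp add: rad_def)

lemma rad_power: "y \<noteq> 0 \<Longrightarrow> rad y ^ k = \<bar>y\<bar> ^ l"
  using k1 by (simp add: rad_def powr_powr powr_realpow[symmetric])

lemma esgn_power: "y \<noteq> 0 \<Longrightarrow> y ^ l = esgn y * \<bar>y\<bar> ^ l"
  by (cases "y > 0") (auto simp: esgn_def power_mult_distrib[symmetric])

lemma psym_slice:
  assumes "y \<noteq> 0"
  shows "psym k l c (rad y * s, y) = of_real (\<bar>y\<bar> ^ l) * (of_real (s ^ k) - of_real (esgn y) * c)"
proof -
  have "complex_of_real (rad y) ^ k = of_real (\<bar>y\<bar> ^ l)" "complex_of_real y ^ l = of_real (esgn y * \<bar>y\<bar> ^ l)"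
    using rad_power[OF assms] esgn_power[OF assms] by (metis of_real_power)+
  then show ?thesis by (simp add: psym_def power_mult_distrib algebra_simps)
qed

definition qe :: "real \<Rightarrow> real \<Rightarrow> real" where
  "qe e s = (norm (of_real (s ^ k) - of_real e * a) * norm (of_real (s ^ k) - of_real e * b))\<^sup>2"

lemma Q_slice:
  assumes "y \<noteq> 0"
  shows "Q (rad y * s, y) = \<bar>y\<bar> ^ (4 * l) * qe (esgn y) s"
proof -
  have "\<bar>y\<bar> ^ (4 * l) = (\<bar>y\<bar> ^ l * \<bar>y\<bar> ^ l)\<^sup>2"
  proof -
    have "4 * l = (l + l) + (l + l)" by simp
    then show ?thesis by (simp only: power_add power2_eq_square)
  qed
  then show ?thesis
    unfolding Q_def qe_def psym_slice[OF assms] norm_mult norm_of_real by (simp add: power_mult_distrib mult_ac power_abs)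
qed

text \<open>The Jacobian \<open>rad y\<close>, the weight and the two symbols combine to a power of
  \<open>abs y\<close>; the critical relation makes its exponent \<open>- 1\<close>, which is the
  scale-invariant density.\<close>

lemma symb_slice:
  assumes "y \<noteq> 0"
  shows "of_real (rad y) * symb (rad y * s, y) = of_real (1 / \<bar>y\<bar>) * msym k \<alpha> a b (esgn y) s"
proof -
  have k0: "real k > 0" and l0: "real l > 0" using k1 l1 by auto
  have y: "\<bar>y\<bar> > 0" using assms by simp
  have e: "real l / real k + real l / real k * (2 * \<alpha>) + 2 * \<beta> - 2 * real l = - 1"
  proof -
    have "real l * ((2 * \<alpha> + 1) / real k + (2 * \<beta> + 1) / real l) = real l * 2" unfolding crit ..
    moreover have "real l * ((2 * \<alpha> + 1) / real k) = real l / real k + real l / real k * (2 * \<alpha>)"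
      by (simp add: add_divide_distrib distrib_left)
    moreover have "real l * ((2 * \<beta> + 1) / real l) = 2 * \<beta> + 1" using l0 by simp
    ultimately show ?thesis unfolding distrib_left by linarith
  qed
  have wy: "wpow y \<beta> = \<bar>y\<bar> powr (2 * \<beta>)" using y by (simp add: wpow_def)
  have "rad y * wght \<alpha> \<beta> (rad y * s, y) = (\<bar>y\<bar> powr (real l / real k) * \<bar>y\<bar> powr (real l / real k * (2 * \<alpha>)) * \<bar>y\<bar> powr (2 * \<beta>)) * wpow s \<alpha>"
    by (simp add: wght_def wpow_scale[OF rad_pos[OF assms]] wy) (simp add: rad_def powr_powr)
  also have "\<bar>y\<bar> powr (real l / real k) * \<bar>y\<bar> powr (real l / real k * (2 * \<alpha>)) * \<bar>y\<bar> powr (2 * \<beta>) = \<bar>y\<bar> powr (- 1 + 2 * real l)"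
    unfolding powr_add[symmetric] using e by (intro arg_cong[where f="\<lambda>x. _ powr x"]) linarith
  also have "- 1 + 2 * real l = real l + real l - 1" by simp
  also have "\<bar>y\<bar> powr (real l + real l - 1) = \<bar>y\<bar> ^ l * \<bar>y\<bar> ^ l / \<bar>y\<bar>"
    using y unfolding powr_diff powr_add by (simp add: powr_realpow)
  finally have r: "rad y * wght \<alpha> \<beta> (rad y * s, y) = \<bar>y\<bar> ^ l * \<bar>y\<bar> ^ l / \<bar>y\<bar> * wpow s \<alpha>" .
  have "of_real (rad y) * symb (rad y * s, y) = of_real (rad y * wght \<alpha> \<beta> (rad y * s, y)) / (psym k l a (rad y * s, y) * psym k l b (rad y * s, y))"
    by (simp add: symb_def)
  also have "\<dots> = of_real (1 / \<bar>y\<bar>) * msym k \<alpha> a b (esgn y) s"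
  proof -
    have "of_real (Y * Y / z * w) / ((of_real Y * A) * (of_real Y * B)) = of_real (1 / z) * (of_real w / (A * B))"
      if "Y \<noteq> 0" for Y z w :: real and A B :: complex
      using that by (cases "A = 0 \<or> B = 0 \<or> z = 0") (auto simp: field_simps)
    from this[of "\<bar>y\<bar> ^ l"] show ?thesis
      unfolding r psym_slice[OF assms] msym_def using assms by simp
  qed
  finally show ?thesis .
qed

lemma slice_integral:
  fixes h :: "real \<Rightarrow> complex"
  assumes "y \<noteq> 0"
  shows "integral\<^sup>L lborel (\<lambda>x. h x * symb (x, y)) = of_real (1 / \<bar>y\<bar>) * integral\<^sup>L lborel (\<lambda>s. h (rad y * s) * msym k \<alpha> a b (esgn y) s)"
proof -
  have r: "rad y > 0" by (rule rad_pos[OF assms])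
  have "integral\<^sup>L lborel (\<lambda>x. h x * symb (x, y)) = \<bar>rad y\<bar> *\<^sub>R integral\<^sup>L lborel (\<lambda>s. h (0 + rad y * s) * symb (0 + rad y * s, y))"
    by (rule lborel_integral_real_affine) (use r in simp)
  also have "\<dots> = of_real (rad y) * integral\<^sup>L lborel (\<lambda>s. h (rad y * s) * symb (rad y * s, y))"
    using r by (simp add: scaleR_conv_of_real)
  also have "\<dots> = integral\<^sup>L lborel (\<lambda>s. h (rad y * s) * (of_real (rad y) * symb (rad y * s, y)))"
    unfolding integral_mult_right_zero[symmetric] by (simp add: mult_ac)
  also have "\<dots> = integral\<^sup>L lborel (\<lambda>s. of_real (1 / \<bar>y\<bar>) * (h (rad y * s) * msym k \<alpha> a b (esgn y) s))"
    unfolding symb_slice[OF assms] by (simp only: mult_ac)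
  also have "\<dots> = of_real (1 / \<bar>y\<bar>) * integral\<^sup>L lborel (\<lambda>s. h (rad y * s) * msym k \<alpha> a b (esgn y) s)"
    by (rule integral_mult_right_zero)
  finally show ?thesis .
qed

lemma \<alpha>k: "2 * \<alpha> + 1 < 2 * real k"
proof -
  have "(2 * \<beta> + 1) / real l > 0" using \<beta>0 l1 by (intro divide_pos_pos) auto
  then have "(2 * \<alpha> + 1) / real k < 2" using crit by linarith
  then show ?thesis using k1 by (simp add: field_simps)
qed

lemma msym_integrable:
  assumes "e = 1 \<or> e = (- 1) ^ l"
  shows "integrable lborel (msym k \<alpha> a b e)"
  using assms by (intro msym_integral(1)[OF ella ellb _ \<alpha>0 \<alpha>k]) auto

lemma sym_lower:
  assumes "ell_coeff k l c"
  obtains d where "d > 0" "\<And>e s. e = 1 \<or> e = (- 1) ^ l \<Longrightarrow> d * (\<bar>s\<bar> ^ k + 1) \<le> norm (of_real (s ^ k) - of_real e * c)"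
proof -
  obtain d where d: "d > 0" "\<And>w. d * (\<bar>fst w\<bar> ^ k + \<bar>snd w\<bar> ^ l) \<le> norm (psym k l c w)"
    using psym_coercive[OF assms(1)] by blast
  have "d * (\<bar>s\<bar> ^ k + 1) \<le> norm (of_real (s ^ k) - of_real e * c)" if "e = 1 \<or> e = (- 1) ^ l" for e s
    using that d(2)[of "(s, 1)"] d(2)[of "(s, - 1)"] by (auto simp: psym_def mult.commute)
  then show ?thesis using d that by blast
qed

lemma qe_pos:
  assumes "e = 1 \<or> e = (- 1) ^ l"
  shows "qe e s > 0"
proof -
  have "norm (of_real (s ^ k) - of_real e * c) > 0" if c: "ell_coeff k l c" for c
  proof -
    obtain d where d: "d > 0" "\<And>e s. e = 1 \<or> e = (- 1) ^ l \<Longrightarrow> d * (\<bar>s\<bar> ^ k + 1) \<le> norm (of_real (s ^ k) - of_real e * c)"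
      using sym_lower[OF c] by blast
    have "0 < d * (\<bar>s\<bar> ^ k + 1)" using d(1) by (simp add: add_nonneg_pos)
    then show ?thesis using d(2)[OF assms] by (rule less_le_trans)
  qed
  from this[OF ella] this[OF ellb] show ?thesis unfolding qe_def by (intro zero_less_power mult_pos_pos)
qed

lemma qe_measurable [measurable]: "qe e \<in> borel_measurable borel"
  unfolding qe_def[abs_def] by measurable

text \<open>After exchanging the integrals, the inner one is that of \<open>Psi_scaled\<close> with
  \<open>q = qe e s\<close>. Its value is the same for all \<open>s\<close>, and the double integral
  factorises.\<close>

lemma half_average:
  assumes \<epsilon>: "0 < \<epsilon>" "\<epsilon> < 1" and e: "e = 1 \<or> e = (- 1) ^ l"
  shows "integral\<^sup>L lborel (\<lambda>y. indicator {0<..} y *\<^sub>R (of_real (1 / y) * integral\<^sup>L lborel (\<lambda>s. of_real (Psi \<epsilon> (y ^ (4 * l) * qe e s)) * msym k \<alpha> a b e s)))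
    = of_real (Ieps l \<epsilon>) * integral\<^sup>L lborel (msym k \<alpha> a b e)"
proof -
  define g where "g s y = indicator {0<..} y * (Psi \<epsilon> (y ^ (4 * l) * qe e s) / y)" for s y :: real
  note gi = Psi_scaled[OF \<epsilon> l1 qe_pos[OF e], folded g_def]
  have g0: "g s y \<ge> 0" for s y by (auto simp: g_def indicator_def)
  have [measurable]: "(\<lambda>z. g (fst z) (snd z)) \<in> borel_measurable (lborel \<Otimes>\<^sub>M lborel)"
    unfolding g_def by measurable
  have I: "integrable (lborel \<Otimes>\<^sub>M lborel) (\<lambda>(s, y). msym k \<alpha> a b e s * of_real (g s y))"
  proof (rule lborel_pair.Fubini_integrable)
    show "(\<lambda>(s, y). msym k \<alpha> a b e s * of_real (g s y)) \<in> borel_measurable (lborel \<Otimes>\<^sub>M lborel)"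
      unfolding case_prod_unfold by measurable
    have "(\<lambda>s. integral\<^sup>L lborel (\<lambda>y. norm ((\<lambda>(s, y). msym k \<alpha> a b e s * of_real (g s y)) (s, y)))) = (\<lambda>s. norm (msym k \<alpha> a b e s) * Ieps l \<epsilon>)"
      by (simp add: norm_mult g0 gi)
    then show "integrable lborel (\<lambda>s. integral\<^sup>L lborel (\<lambda>y. norm ((\<lambda>(s, y). msym k \<alpha> a b e s * of_real (g s y)) (s, y))))"
      using msym_integrable[OF e] by simp
    show "AE s in lborel. integrable lborel (\<lambda>y. (\<lambda>(s, y). msym k \<alpha> a b e s * of_real (g s y)) (s, y))"
      using gi(1) by (intro AE_I2) simp
  qed
  have "integral\<^sup>L lborel (\<lambda>y. indicator {0<..} y *\<^sub>R (of_real (1 / y) * integral\<^sup>L lborel (\<lambda>s. of_real (Psi \<epsilon> (y ^ (4 * l) * qe e s)) * msym k \<alpha> a b e s)))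
     = integral\<^sup>L lborel (\<lambda>y. integral\<^sup>L lborel (\<lambda>s. msym k \<alpha> a b e s * of_real (g s y)))"
  proof (rule Bochner_Integration.integral_cong[OF refl])
    fix y :: real
    have "indicator {0<..} y *\<^sub>R (of_real (1 / y) * integral\<^sup>L lborel (\<lambda>s. of_real (Psi \<epsilon> (y ^ (4 * l) * qe e s)) * msym k \<alpha> a b e s))
      = of_real (indicator {0<..} y / y) * integral\<^sup>L lborel (\<lambda>s. of_real (Psi \<epsilon> (y ^ (4 * l) * qe e s)) * msym k \<alpha> a b e s)"
      by (simp add: scaleR_conv_of_real)
    also have "\<dots> = integral\<^sup>L lborel (\<lambda>s. of_real (indicator {0<..} y / y) * (of_real (Psi \<epsilon> (y ^ (4 * l) * qe e s)) * msym k \<alpha> a b e s))"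
      by (rule integral_mult_right_zero[symmetric])
    finally show "indicator {0<..} y *\<^sub>R (of_real (1 / y) * integral\<^sup>L lborel (\<lambda>s. of_real (Psi \<epsilon> (y ^ (4 * l) * qe e s)) * msym k \<alpha> a b e s)) = integral\<^sup>L lborel (\<lambda>s. msym k \<alpha> a b e s * of_real (g s y))"
      by (simp add: g_def mult_ac)
  qed
  also have "\<dots> = integral\<^sup>L lborel (\<lambda>s. integral\<^sup>L lborel (\<lambda>y. msym k \<alpha> a b e s * of_real (g s y)))"
    by (rule lborel_pair.Fubini_integral[OF I])
  also have "\<dots> = integral\<^sup>L lborel (\<lambda>s. msym k \<alpha> a b e s * of_real (Ieps l \<epsilon>))"
    by (simp only: integral_mult_right_zero integral_complex_of_real gi)
  finally show ?thesis by (simp add: mult.commute)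
qed

lemma average_eq:
  assumes \<epsilon>: "0 < \<epsilon>" "\<epsilon> < 1" and i: "integrable lborel (\<lambda>w. of_real (Psi \<epsilon> (Q w)) * symb w)"
  shows "integral\<^sup>L lborel (\<lambda>w. of_real (Psi \<epsilon> (Q w)) * symb w) = of_real (Ieps l \<epsilon>) * cval k l \<alpha> a b"
proof -
  define F where "F y = integral\<^sup>L lborel (\<lambda>x. of_real (Psi \<epsilon> (Q (x, y))) * symb (x, y))" for y
  have i': "integrable (lborel \<Otimes>\<^sub>M lborel) (case_prod (\<lambda>x y. of_real (Psi \<epsilon> (Q (x, y))) * symb (x, y)))"
    using i by (simp add: lborel_prod case_prod_unfold)
  have Fi: "integrable lborel F" unfolding F_def by (rule lborel_pair.integrable_snd[OF i'])
  have IF: "integral\<^sup>L lborel (\<lambda>w. of_real (Psi \<epsilon> (Q w)) * symb w) = integral\<^sup>L lborel F"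
    unfolding F_def using lborel_pair.integral_snd[OF i'] by (simp add: lborel_prod case_prod_unfold)
  have Fy: "F y = of_real (1 / \<bar>y\<bar>) * integral\<^sup>L lborel (\<lambda>s. of_real (Psi \<epsilon> (\<bar>y\<bar> ^ (4 * l) * qe (esgn y) s)) * msym k \<alpha> a b (esgn y) s)" if "y \<noteq> 0" for y
    unfolding F_def slice_integral[OF that] Q_slice[OF that] ..
  have Fm: "F \<in> borel_measurable borel" using Fi by auto
  have p: "integrable lborel (\<lambda>y. indicator {0<..} y *\<^sub>R F y)"
    using integrable_mult_indicator[OF _ Fi, of "{0<..}"] by simp
  have "integrable lborel (\<lambda>y. F (0 + (- 1) * y))" by (rule lborel_integrable_real_affine[OF Fi]) simp
  then have m: "integrable lborel (\<lambda>y. indicator {0<..} y *\<^sub>R F (- y))"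
    using integrable_mult_indicator[of "{0<..}" lborel "\<lambda>y. F (- y)"] by simp
  have 1: "(\<lambda>y. indicator {0<..} y *\<^sub>R F y) = (\<lambda>y. indicator {0<..} y *\<^sub>R (of_real (1 / y) * integral\<^sup>L lborel (\<lambda>s. of_real (Psi \<epsilon> (y ^ (4 * l) * qe 1 s)) * msym k \<alpha> a b 1 s)))"
    by (intro ext) (auto simp: indicator_def Fy esgn_def)
  have 2: "(\<lambda>y. indicator {0<..} y *\<^sub>R F (- y)) = (\<lambda>y. indicator {0<..} y *\<^sub>R (of_real (1 / y) * integral\<^sup>L lborel (\<lambda>s. of_real (Psi \<epsilon> (y ^ (4 * l) * qe ((- 1) ^ l) s)) * msym k \<alpha> a b ((- 1) ^ l) s)))"
    by (intro ext) (auto simp: indicator_def Fy esgn_def)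
  show ?thesis
    unfolding IF split_line(2)[OF p m Fm] 1 2 cval_def
    using half_average[OF \<epsilon>] by (simp add: distrib_left)
qed

end

context elliptic_pair
begin

lemma necessity:
  assumes BE: "BE k l \<alpha> \<beta> \<sigma> \<tau>" and a: "a = tau1 k l \<tau>" and b: "b = sigma1 k l \<sigma>"
  shows "(2 * \<alpha> + 1) / real k + (2 * \<beta> + 1) / real l = 2" and "cval k l \<alpha> a b = 0"
proof -
  show crit: "(2 * \<alpha> + 1) / real k + (2 * \<beta> + 1) / real l = 2" by (rule BE_homogeneity[OF BE])
  interpret critical_pair k l \<alpha> \<beta> a b by unfold_locales (rule crit)
  obtain M where M: "\<And>\<epsilon>. 0 < \<epsilon> \<Longrightarrow> \<epsilon> < 1 \<Longrightarrow> integrable lborel (\<lambda>w. of_real (Psi \<epsilon> (Q w)) * symb w)"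
    "\<And>\<epsilon>. 0 < \<epsilon> \<Longrightarrow> \<epsilon> < 1 \<Longrightarrow> norm (integral\<^sup>L lborel (\<lambda>w. of_real (Psi \<epsilon> (Q w)) * symb w)) \<le> M"
    using BE_average_bound[OF BE a b] by blast
  show "cval k l \<alpha> a b = 0"
  proof (rule ccontr)
    assume nz: "cval k l \<alpha> a b \<noteq> 0"
    obtain \<epsilon> where \<epsilon>: "0 < \<epsilon>" "\<epsilon> < 1" "Ieps l \<epsilon> \<ge> (\<bar>M\<bar> + 1) / norm (cval k l \<alpha> a b)"
      using Ieps_unbounded[OF l1] by blast
    have "\<bar>M\<bar> + 1 \<le> Ieps l \<epsilon> * norm (cval k l \<alpha> a b)" using \<epsilon>(3) nz by (simp add: field_simps)
    also have "\<dots> \<le> norm (of_real (Ieps l \<epsilon>) * cval k l \<alpha> a b)"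
      unfolding norm_mult norm_of_real by (intro mult_right_mono) auto
    also have "\<dots> \<le> M" using M(2)[OF \<epsilon>(1,2)] unfolding average_eq[OF \<epsilon>(1,2) M(1)[OF \<epsilon>(1,2)]] .
    finally show False by linarith
  qed
qed

end

subsection \<open>Sufficiency\<close>

text \<open>Half a power of \<open>x\<close> instead of a full one: for \<open>k = 1\<close> the
  first absolute moment of the symbol on a line diverges, but the moment of order one half is
  finite.\<close>

lemma norm_cis_minus_one: "norm (cis x - 1) \<le> sqrt (2 * \<bar>x\<bar>)"
proof -
  have "(norm (cis x - 1))\<^sup>2 = (cos x - 1)\<^sup>2 + (sin x)\<^sup>2"
    by (simp add: cmod_power2)
  also have "\<dots> = 2 - 2 * cos x"
    using sin_cos_squared_add[of x] by (simp add: power2_diff)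
  also have "\<dots> = 2 * (2 * (sin (x / 2))\<^sup>2)"
    using cos_double_sin[of "x / 2"] by simp
  also have "(sin (x / 2))\<^sup>2 \<le> 1 * \<bar>x / 2\<bar>"
  proof -
    have "\<bar>sin (x / 2)\<bar> * \<bar>sin (x / 2)\<bar> \<le> 1 * \<bar>x / 2\<bar>"
      by (intro mult_mono abs_sin_x_le_abs_x) auto
    then show ?thesis by (simp add: power2_eq_square abs_mult[symmetric])
  qed
  finally have "(norm (cis x - 1))\<^sup>2 \<le> 2 * \<bar>x\<bar>" by simp
  then show ?thesis by (rule real_le_rsqrt)
qed

text \<open>Integration by parts against the oscillating factor. The line is cut at 0 because the
  weight is \<open>abs s ^ (k - 1)\<close>, which for even \<open>k\<close> is a polynomial only on
  each half-line; the price is the boundary term \<open>f0\<close>.\<close>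

lemma oscillatory_half_line:
  fixes f f' :: "real \<Rightarrow> complex"
  assumes der: "\<And>s. s > 0 \<Longrightarrow> (f has_vector_derivative f' s) (at s)"
    and cont: "\<And>s. s > 0 \<Longrightarrow> isCont f' s"
    and fi: "integrable lborel (\<lambda>s. indicator {0<..} s *\<^sub>R f s)"
    and f'i: "integrable lborel (\<lambda>s. indicator {0<..} s *\<^sub>R f' s)"
    and f0: "(f \<longlongrightarrow> f0) (at_right 0)" and finf: "(f \<longlongrightarrow> 0) at_top"
  shows "2 * pi * \<bar>t\<bar> * norm (integral\<^sup>L lborel (\<lambda>s. indicator {0<..} s *\<^sub>R (cis (- 2 * pi * t * s) * f s)))
    \<le> norm f0 + integral\<^sup>L lborel (\<lambda>s. norm (indicator {0<..} s *\<^sub>R f' s))"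
proof -
  define c where "c = - 2 * pi * t"
  have cis_der: "((\<lambda>s. cis (c * s)) has_vector_derivative (\<i> * c) * cis (c * s)) (at s)" for s
  proof -
    have "((\<lambda>s. exp (\<i> * c * of_real s)) has_vector_derivative (\<i> * c) * exp (\<i> * c * of_real s)) (at s)"
      by (rule has_vector_derivative_real_field) (auto intro!: derivative_eq_intros)
    then show ?thesis by (simp add: cis_conv_exp mult_ac)
  qed
  have cis_cont: "isCont (\<lambda>s. cis (c * s)) s" for s
    using has_vector_derivative_continuous[OF cis_der] .
  have cisi: "integrable lborel (\<lambda>s. cis (c * s) * g s)" if "integrable lborel g" for g :: "real \<Rightarrow> complex"
    by (rule Bochner_Integration.integrable_bound[OF that]) (use that in \<open>auto simp: norm_mult\<close>)
  note ci = cisi[OF fi] cisi[OF f'i]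
  let ?F = "\<lambda>s. cis (c * s) * f s"
  let ?G = "\<lambda>s. cis (c * s) * f' s + (\<i> * c) * cis (c * s) * f s"
  have lim0: "(?F \<longlongrightarrow> 1 * f0) (at_right 0)"
  proof (intro tendsto_mult f0)
    have "((\<lambda>s. cis (c * s)) \<longlongrightarrow> cis (c * 0)) (at_right 0)"
      using cis_cont[of 0] by (auto simp: isCont_def intro: tendsto_mono[OF at_le])
    then show "((\<lambda>s. cis (c * s)) \<longlongrightarrow> 1) (at_right 0)" by simp
  qed
  have liminf: "(?F \<longlongrightarrow> 0) at_top"
    by (rule Lim_null_comparison[OF _ tendsto_norm_zero[OF finf]]) (simp add: norm_mult)
  have eq: "indicator {0<..} s *\<^sub>R ?G s = cis (c * s) * (indicator {0<..} s *\<^sub>R f' s) + (\<i> * c) * (cis (c * s) * (indicator {0<..} s *\<^sub>R f s))" for s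
    by (auto simp: indicator_def algebra_simps)
  have Gi: "integrable lborel (\<lambda>s. indicator {0<..} s *\<^sub>R ?G s)"
    unfolding eq by (intro Bochner_Integration.integrable_add integrable_mult_right ci)
  have ein: "einterval 0 \<infinity> = {0<..}" by (auto simp: einterval_def zero_ereal_def)
  have "(LBINT s=0..\<infinity>. ?G s) = 0 - 1 * f0"
  proof (rule interval_integral_FTC_integrable[of _ _ ?F])
    show "(?F has_vector_derivative ?G s) (at s)" if "0 < ereal s" for s
      using has_vector_derivative_mult[OF cis_der der] that by (simp add: add.commute)
    show "isCont ?G s" if "0 < ereal s" for s
    proof -
      have "s > 0" using that by simp
      have "isCont f s" using der[OF \<open>s > 0\<close>] by (rule has_vector_derivative_continuous)
      then show ?thesis using cont[OF \<open>s > 0\<close>] cis_cont by (intro continuous_intros) auto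
    qed
    show "set_integrable lborel (einterval 0 \<infinity>) ?G" using Gi by (simp add: set_integrable_def ein)
    show "((?F \<circ> real_of_ereal) \<longlongrightarrow> 1 * f0) (at_right 0)"
      using lim0 by (simp add: ereal_tendsto_simps zero_ereal_def)
    show "((?F \<circ> real_of_ereal) \<longlongrightarrow> 0) (at_left \<infinity>)"
      using liminf by (simp add: ereal_tendsto_simps)
  qed simp
  then have "integral\<^sup>L lborel (\<lambda>s. indicator {0<..} s *\<^sub>R ?G s) = - f0"
    by (simp add: interval_lebesgue_integral_def set_lebesgue_integral_def ein)
  then have "integral\<^sup>L lborel (\<lambda>s. cis (c * s) * (indicator {0<..} s *\<^sub>R f' s)) + (\<i> * c) * integral\<^sup>L lborel (\<lambda>s. cis (c * s) * (indicator {0<..} s *\<^sub>R f s)) = - f0"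
    unfolding eq by (subst (asm) Bochner_Integration.integral_add[OF ci(2) integrable_mult_right[OF ci(1)]])
      (simp only: integral_mult_right_zero)
  then have "(\<i> * c) * integral\<^sup>L lborel (\<lambda>s. cis (c * s) * (indicator {0<..} s *\<^sub>R f s)) = - f0 - integral\<^sup>L lborel (\<lambda>s. cis (c * s) * (indicator {0<..} s *\<^sub>R f' s))"
    by (simp add: algebra_simps)
  then have "norm ((\<i> * c) * integral\<^sup>L lborel (\<lambda>s. cis (c * s) * (indicator {0<..} s *\<^sub>R f s))) \<le> norm f0 + norm (integral\<^sup>L lborel (\<lambda>s. cis (c * s) * (indicator {0<..} s *\<^sub>R f' s)))"
    using norm_triangle_ineq4[of "- f0"] by simp
  also have "norm (integral\<^sup>L lborel (\<lambda>s. cis (c * s) * (indicator {0<..} s *\<^sub>R f' s))) \<le> integral\<^sup>L lborel (\<lambda>s. norm (cis (c * s) * (indicator {0<..} s *\<^sub>R f' s)))"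
    by (rule integral_norm_bound)
  also have "\<dots> = integral\<^sup>L lborel (\<lambda>s. norm (indicator {0<..} s *\<^sub>R f' s))" by (simp add: norm_mult)
  finally have "norm ((\<i> * c) * integral\<^sup>L lborel (\<lambda>s. cis (c * s) * (indicator {0<..} s *\<^sub>R f s))) \<le> norm f0 + integral\<^sup>L lborel (\<lambda>s. norm (indicator {0<..} s *\<^sub>R f' s))"
    by simp
  moreover have "norm (\<i> * complex_of_real c) = 2 * pi * \<bar>t\<bar>" by (simp add: norm_mult c_def abs_mult)
  ultimately show ?thesis by (simp add: norm_mult c_def)
qed

text \<open>Up to sign, the integral is a difference of two values of the bounded function
  \<open>Si\<close>. Scaling removes the frequency \<open>c\<close>, whence the uniformity in all
  three parameters.\<close>

lemma sin_over_id_bounded: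
  obtains S :: real where "S \<ge> 0" "\<And>c A B. 0 < A \<Longrightarrow> \<bar>integral\<^sup>L lborel (\<lambda>x. indicator {A<..<B} x * (sin (c * x) / x))\<bar> \<le> S"
proof -
  obtain S0 where S0: "\<And>T. \<bar>Si T\<bar> \<le> S0" using bounded_Si by blast
  have S00: "S0 \<ge> 0" using S0[of 0] by linarith
  have "\<bar>integral\<^sup>L lborel (\<lambda>x. indicator {A<..<B} x * (sin (c * x) / x))\<bar> \<le> 2 * S0" if "0 < A" for c A B :: real
  proof (cases "A < B")
    case False
    then have "{A<..<B} = {}" by auto
    then show ?thesis using S00 by simp
  next
    case True
    have b: "\<bar>LBINT t=ereal 0..ereal T. sin (t * c) / t\<bar> \<le> S0" if "T \<ge> 0" for T
    proof -
      have "\<bar>sgn c * Si (T * \<bar>c\<bar>)\<bar> \<le> \<bar>Si (T * \<bar>c\<bar>)\<bar>"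
        unfolding abs_mult by (rule mult_left_le_one_le) (auto simp: sgn_if)
      then show ?thesis
        using LBINT_I0c_sin_scale_divide[OF that, of c] S0[of "T * \<bar>c\<bar>"]
        by (simp only: zero_ereal_def[symmetric])
    qed
    have ii: "interval_lebesgue_integrable lborel 0 (ereal B) (\<lambda>t. sin (t * c) / t)"
    proof -
      \<comment> \<open>Integrability up to 0: off 0 the integrand agrees with a multiple of the
        continuous function \<open>sinc\<close>.\<close>
      have "set_integrable lborel {0..B} (\<lambda>t. c * sinc (t * c))"
        by (rule borel_integrable_atLeastAtMost') (intro continuous_intros)
      then have "set_integrable lborel {0<..<B} (\<lambda>t. c * sinc (t * c))"
        by (rule set_integrable_subset) auto
      then have "set_integrable lborel {0<..<B} (\<lambda>t. sin (t * c) / t)"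
        unfolding set_integrable_def
        by (rule Bochner_Integration.integrable_cong[THEN iffD1, rotated 2]) (auto simp: indicator_def)
      then show ?thesis using that True by (simp add: interval_lebesgue_integrable_def zero_ereal_def)
    qed
    have "(LBINT t=0..ereal A. sin (t * c) / t) + (LBINT t=ereal A..ereal B. sin (t * c) / t) = (LBINT t=0..ereal B. sin (t * c) / t)"
      by (rule interval_integral_sum) (use ii that True in \<open>simp add: min_def max_def zero_ereal_def\<close>)
    then have "\<bar>LBINT t=ereal A..ereal B. sin (t * c) / t\<bar> \<le> 2 * S0"
      using b[of A] b[of B] that True by (simp add: zero_ereal_def)
    then show ?thesis
      using True by (simp add: interval_lebesgue_integral_def set_lebesgue_integral_def mult.commute)
  qed
  then show ?thesis using that[of "2 * S0"] S00 by simp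
qed

lemma integrable_powr_near_zero:
  fixes r :: real
  assumes "r > 0"
  shows "integrable lborel (\<lambda>s. indicator {0<..<1} s * s powr (r - 1))"
proof -
  have "set_integrable lborel (einterval 0 1) (\<lambda>s. s powr (r - 1))"
  proof (rule interval_integral_FTC_nonneg(1)[where F="\<lambda>s. s powr r / r"])
    show "DERIV (\<lambda>s. s powr r / r) x :> x powr (r - 1)" if "0 < ereal x" for x
    proof -
      have "x > 0" using that by simp
      then show ?thesis using assms by (auto intro!: derivative_eq_intros)
    qed
    show "isCont (\<lambda>s. s powr (r - 1)) x" if "0 < ereal x" for x
    proof -
      have "x > 0" using that by simp
      then show ?thesis by (auto intro!: continuous_intros)
    qed
    have "((\<lambda>s. s powr r / r) \<longlongrightarrow> 0 powr r / r) (at_right 0)"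
    proof (rule tendsto_divide)
      have "continuous_on {0..} (\<lambda>s. s powr r)" using assms by (intro continuous_on_powr') (auto intro!: continuous_intros)
      then have "((\<lambda>s. s powr r) \<longlongrightarrow> 0 powr r) (at 0 within {0..})"
        unfolding continuous_on_def by blast
      then show "((\<lambda>s. s powr r) \<longlongrightarrow> 0 powr r) (at_right 0)"
        by (rule tendsto_within_subset) auto
    qed (use assms in auto)
    then show "(((\<lambda>s. s powr r / r) \<circ> real_of_ereal) \<longlongrightarrow> 0 powr r / r) (at_right 0)"
      by (simp add: ereal_tendsto_simps zero_ereal_def)
    have "((\<lambda>s. s powr r / r) \<longlongrightarrow> 1 powr r / r) (at_left 1)"
      using assms by (intro tendsto_intros) auto
    then show "(((\<lambda>s. s powr r / r) \<circ> real_of_ereal) \<longlongrightarrow> 1 powr r / r) (at_left 1)"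
      by (simp add: ereal_tendsto_simps one_ereal_def)
  qed auto
  moreover have "einterval 0 1 = {0<..<1}" by (auto simp: einterval_def one_ereal_def zero_ereal_def)
  ultimately show ?thesis by (simp add: set_integrable_def)
qed

text \<open>For \<open>t > 0\<close> this is the minimum of \<open>sqrt t\<close> and
  \<open>1 / t\<close>, the two available bounds for the transform of a slice.\<close>

definition bmin :: "real \<Rightarrow> real" where "bmin t = (if t < 1 then sqrt t else 1 / t)"

text \<open>Against \<open>dv / v\<close> the power \<open>\<theta> / 2\<close> converges at 0 and
  the power \<open>- \<theta>\<close> at infinity.\<close>

lemma bmin_integrable:
  assumes "\<theta> > 0"
  shows "integrable lborel (\<lambda>v. indicator {0<..} v * (bmin (v powr \<theta>) / v))"
proof (rule Bochner_Integration.integrable_bound)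
  show "integrable lborel (\<lambda>v. indicator {0<..<1} v * v powr (\<theta> / 2 - 1) + indicator {1<..} v * v powr (- \<theta> - 1) + indicator {1} v :: real)"
    using assms by (intro Bochner_Integration.integrable_add integrable_powr_near_zero integrable_powr_tail integrable_real_indicator) auto
  show "(\<lambda>v. indicator {0<..} v * (bmin (v powr \<theta>) / v)) \<in> borel_measurable lborel"
    unfolding bmin_def by measurable
  show "AE v in lborel. norm (indicator {0<..} v * (bmin (v powr \<theta>) / v)) \<le> norm (indicator {0<..<1} v * v powr (\<theta> / 2 - 1) + indicator {1<..} v * v powr (- \<theta> - 1) + indicator {1} v :: real)"
  proof (intro AE_I2)
    fix v :: real
    consider "v \<le> 0" | "0 < v" "v < 1" | "v = 1" | "1 < v" by linarith
    then show "norm (indicator {0<..} v * (bmin (v powr \<theta>) / v)) \<le> norm (indicator {0<..<1} v * v powr (\<theta> / 2 - 1) + indicator {1<..} v * v powr (- \<theta> - 1) + indicator {1} v :: real)"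
    proof cases
      case 2
      then have "v powr \<theta> < 1" using powr_less_mono2[OF assms, of v 1] by simp
      moreover have "sqrt (v powr \<theta>) = v powr (\<theta> / 2)" using 2 by (simp add: powr_half_sqrt[symmetric] powr_powr)
      ultimately show ?thesis using 2 by (simp add: bmin_def powr_diff)
    next
      case 4
      then have "v powr \<theta> > 1" using powr_less_mono2[OF assms, of 1 v] by simp
      moreover have "v powr (- \<theta> - 1) = 1 / v powr \<theta> / v" using 4 by (simp add: powr_diff powr_minus_divide)
      ultimately show ?thesis using 4 by (simp add: bmin_def)
    qed (auto simp: bmin_def)
  qed
qed

text \<open>Scale invariance of \<open>dv / v\<close> once more; it makes the error term in the
  kernel bound independent of the first frequency.\<close>

lemma bmin_scaled:
  assumes \<theta>: "\<theta> > 0" and X: "X > 0"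
  shows "integrable lborel (\<lambda>v. indicator {0<..} v * (bmin (X * v powr \<theta>) / v))"
    and "integral\<^sup>L lborel (\<lambda>v. indicator {0<..} v * (bmin (X * v powr \<theta>) / v)) = integral\<^sup>L lborel (\<lambda>v. indicator {0<..} v * (bmin (v powr \<theta>) / v))"
proof -
  define c where "c = X powr (1 / \<theta>)"
  have c: "c > 0" "c powr \<theta> = X" using X \<theta> by (auto simp: c_def powr_powr)
  have *: "indicator {0<..} (0 + c * v) * (bmin ((0 + c * v) powr \<theta>) / (0 + c * v)) = (1 / c) * (indicator {0<..} v * (bmin (X * v powr \<theta>) / v))" for v :: real
    using c by (auto simp: indicator_def zero_less_mult_iff powr_mult)
  have "integrable lborel (\<lambda>v. indicator {0<..} (0 + c * v) * (bmin ((0 + c * v) powr \<theta>) / (0 + c * v)))"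
    by (rule lborel_integrable_real_affine[OF bmin_integrable[OF \<theta>]]) (use c in auto)
  then have "integrable lborel (\<lambda>v. c * ((1 / c) * (indicator {0<..} v * (bmin (X * v powr \<theta>) / v))))"
    unfolding * by (rule integrable_mult_right)
  then show "integrable lborel (\<lambda>v. indicator {0<..} v * (bmin (X * v powr \<theta>) / v))" using c(1) by simp
  have "integral\<^sup>L lborel (\<lambda>v. indicator {0<..} v * (bmin (v powr \<theta>) / v)) = \<bar>c\<bar> *\<^sub>R integral\<^sup>L lborel (\<lambda>v. indicator {0<..} (0 + c * v) * (bmin ((0 + c * v) powr \<theta>) / (0 + c * v)))"
    by (rule lborel_integral_real_affine) (use c in auto)
  then show "integral\<^sup>L lborel (\<lambda>v. indicator {0<..} v * (bmin (X * v powr \<theta>) / v)) = integral\<^sup>L lborel (\<lambda>v. indicator {0<..} v * (bmin (v powr \<theta>) / v))"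
    unfolding * integral_mult_right_zero using c(1) by simp
qed

section \<open>Fourier transforms of the slices\<close>

locale sufficient_pair = elliptic_pair +
  assumes \<alpha>_eq: "\<alpha> = (real k - 1) / 2" and \<beta>_eq: "\<beta> = (real l - 1) / 2"
    and c0: "cval k l \<alpha> a b = 0"
begin

sublocale critical_pair
proof unfold_locales
  have "2 * \<alpha> + 1 = real k" "2 * \<beta> + 1 = real l" by (simp_all add: \<alpha>_eq \<beta>_eq field_simps)
  then show "(2 * \<alpha> + 1) / real k + (2 * \<beta> + 1) / real l = 2" using k1 l1 by simp
qed

definition isgn :: "real \<Rightarrow> bool" where "isgn e \<longleftrightarrow> e = 1 \<or> e = (- 1) ^ l"

lemma isgn_simps [simp]: "isgn 1" "isgn ((- 1) ^ l)" "isgn (esgn y)"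
  by (simp_all add: isgn_def esgn_def)

lemma wpow_eq: "wpow s \<alpha> = \<bar>s\<bar> ^ (k - 1)"
proof (cases "k = 1")
  case True
  then show ?thesis by (simp add: wpow_def \<alpha>_eq)
next
  case False
  then have "\<alpha> \<noteq> 0" "2 * \<alpha> = real (k - 1)" using k1 by (auto simp: \<alpha>_eq of_nat_diff)
  then have "wpow s \<alpha> = \<bar>s\<bar> powr real (k - 1)" by (simp only: wpow_def if_False)
  also have "\<dots> = \<bar>s\<bar> ^ (k - 1)"
  proof (cases "s = 0")
    case True
    then show ?thesis using False k1 by simp
  next
    case False
    then show ?thesis by (intro powr_realpow) simp
  qed
  finally show ?thesis .
qed

text \<open>\<open>\<delta>\<close>, equal to \<open>1\<close> or \<open>- 1\<close>, selects the
  half-line. The argument is complex so that the rules for complex derivatives apply.\<close>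

definition Ac :: "real \<Rightarrow> real \<Rightarrow> complex \<Rightarrow> complex \<Rightarrow> complex" where
  "Ac \<delta> e c z = (of_real \<delta> * z) ^ k - of_real e * c"

definition fh :: "real \<Rightarrow> real \<Rightarrow> real \<Rightarrow> complex" where
  "fh \<delta> e s = of_real s ^ (k - 1) / (Ac \<delta> e a (of_real s) * Ac \<delta> e b (of_real s))"

text \<open>The derivative of \<open>fh \<delta> e\<close> in the form in which the quotient rule
  delivers it.\<close>

definition fh' :: "real \<Rightarrow> real \<Rightarrow> real \<Rightarrow> complex" where
  "fh' \<delta> e s = (of_nat (k - 1) * of_real s ^ (k - 1 - 1) * (Ac \<delta> e a (of_real s) * Ac \<delta> e b (of_real s))
     - of_real s ^ (k - 1) * (of_nat k * (of_real \<delta> * of_real s) ^ (k - 1) * of_real \<delta> * Ac \<delta> e b (of_real s)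
         + of_nat k * (of_real \<delta> * of_real s) ^ (k - 1) * of_real \<delta> * Ac \<delta> e a (of_real s)))
     / ((Ac \<delta> e a (of_real s) * Ac \<delta> e b (of_real s)) * (Ac \<delta> e a (of_real s) * Ac \<delta> e b (of_real s)))"

lemma fh_msym:
  assumes "s > 0" "\<delta> = 1 \<or> \<delta> = - 1"
  shows "msym k \<alpha> a b e (\<delta> * s) = fh \<delta> e s"
proof -
  have "\<bar>\<delta> * s\<bar> = s" using assms by auto
  then show ?thesis unfolding msym_def fh_def Ac_def wpow_eq by simp
qed

lemma Ac_lower:
  obtains d where "d > 0"
    "\<And>e \<delta> s. isgn e \<Longrightarrow> \<delta> = 1 \<or> \<delta> = - 1 \<Longrightarrow> d * (1 + \<bar>s\<bar> ^ k) \<le> norm (Ac \<delta> e a (of_real s))"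
    "\<And>e \<delta> s. isgn e \<Longrightarrow> \<delta> = 1 \<or> \<delta> = - 1 \<Longrightarrow> d * (1 + \<bar>s\<bar> ^ k) \<le> norm (Ac \<delta> e b (of_real s))"
proof -
  obtain d1 where d1: "d1 > 0" "\<And>e s. e = 1 \<or> e = (- 1) ^ l \<Longrightarrow> d1 * (\<bar>s\<bar> ^ k + 1) \<le> norm (of_real (s ^ k) - of_real e * a)"
    using sym_lower[OF ella] by blast
  obtain d2 where d2: "d2 > 0" "\<And>e s. e = 1 \<or> e = (- 1) ^ l \<Longrightarrow> d2 * (\<bar>s\<bar> ^ k + 1) \<le> norm (of_real (s ^ k) - of_real e * b)"
    using sym_lower[OF ellb] by blast
  have A: "Ac \<delta> e c (of_real s) = of_real ((\<delta> * s) ^ k) - of_real e * c" for \<delta> e c s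
    by (simp add: Ac_def)
  have abs: "\<bar>\<delta> * s\<bar> = \<bar>s\<bar>" if "\<delta> = 1 \<or> \<delta> = - 1" for \<delta> s :: real using that by auto
  have le: "min d1 d2 * (1 + \<bar>s\<bar> ^ k) \<le> d1 * (\<bar>s\<bar> ^ k + 1)" "min d1 d2 * (1 + \<bar>s\<bar> ^ k) \<le> d2 * (\<bar>s\<bar> ^ k + 1)" for s
    by (simp_all add: add.commute mult_right_mono)
  show ?thesis
  proof (rule that[of "min d1 d2"])
    fix e \<delta> s :: real assume "isgn e" and \<delta>: "\<delta> = 1 \<or> \<delta> = - 1"
    then have e: "e = 1 \<or> e = (- 1) ^ l" by (simp add: isgn_def)
    show "min d1 d2 * (1 + \<bar>s\<bar> ^ k) \<le> norm (Ac \<delta> e a (of_real s))"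
      using order_trans[OF le(1)[of s]] d1(2)[OF e, of "\<delta> * s"] unfolding A abs[OF \<delta>] by blast
    show "min d1 d2 * (1 + \<bar>s\<bar> ^ k) \<le> norm (Ac \<delta> e b (of_real s))"
      using order_trans[OF le(2)[of s]] d2(2)[OF e, of "\<delta> * s"] unfolding A abs[OF \<delta>] by blast
  qed (use d1 d2 in simp)
qed

lemma power_integrable:
  assumes "n + 1 < 2 * k"
  shows "integrable lborel (\<lambda>s. indicator {0<..} s * (s ^ n / (1 + s ^ k)\<^sup>2) :: real)"
proof -
  interpret m: mellin "real n" k by unfold_locales (use assms in auto)
  have eq: "m.W s / (1 + s ^ k)\<^sup>2 = indicator {0<..} s * (s ^ n / (1 + s ^ k)\<^sup>2)" for s
    by (auto simp: m.W_def indicator_def powr_realpow)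
  show ?thesis using m.W_integrable unfolding eq .
qed

text \<open>The moment of order one half: \<open>q = k - 1 / 2\<close> satisfies
  \<open>q + 1 < 2 * k\<close> for every \<open>k \<ge> 1\<close>.\<close>

lemma sqrt_power_integrable:
  "integrable lborel (\<lambda>s. indicator {0<..} s * (sqrt s * (s ^ (k - 1) / (1 + s ^ k)\<^sup>2)) :: real)"
proof -
  interpret m: mellin "real k - 1 / 2" k by unfold_locales (use k1 in auto)
  have eq: "m.W s / (1 + s ^ k)\<^sup>2 = indicator {0<..} s * (sqrt s * (s ^ (k - 1) / (1 + s ^ k)\<^sup>2))" for s
  proof (cases "s > 0")
    case True
    have "real k - 1 / 2 = 1 / 2 + real (k - 1)" using k1 by (simp add: of_nat_diff)
    then have "s powr (real k - 1 / 2) = sqrt s * s ^ (k - 1)"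
      using True by (simp only: powr_add powr_realpow powr_half_sqrt less_imp_le)
    then show ?thesis using True by (simp add: m.W_def)
  qed (simp add: m.W_def)
  show ?thesis using m.W_integrable unfolding eq .
qed

lemma power_pred_le: "s > 0 \<Longrightarrow> s ^ (k - 1) \<le> 1 + s ^ k" for s :: real
proof (cases "s \<ge> 1")
  case True
  then have "s ^ (k - 1) \<le> s ^ k" by (intro power_increasing) auto
  then show ?thesis by simp
next
  case False
  assume "s > 0"
  then have "s ^ (k - 1) \<le> 1" "0 \<le> s ^ k" using False by (auto intro: power_le_one)
  then show ?thesis by simp
qed

text \<open>Each factor in a denominator is at least \<open>d * (1 + s ^ k)\<close>. Differentiating
  a symbol produces a third such factor, which \<open>power_pred_le\<close> trades against the
  additional power of \<open>s\<close> in the numerator.\<close>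

lemma fh_le:
  obtains D where "D > 0" "\<And>\<delta> e s. isgn e \<Longrightarrow> \<delta> = 1 \<or> \<delta> = - 1 \<Longrightarrow> s > 0 \<Longrightarrow> norm (fh \<delta> e s) \<le> D * (s ^ (k - 1) / (1 + s ^ k)\<^sup>2)"
    "\<And>\<delta> e s. isgn e \<Longrightarrow> \<delta> = 1 \<or> \<delta> = - 1 \<Longrightarrow> s > 0 \<Longrightarrow> norm (fh' \<delta> e s) \<le> D * (s ^ (k - 2) / (1 + s ^ k)\<^sup>2) + D * (s ^ (k - 1) / (1 + s ^ k)\<^sup>2)"
    "\<And>\<delta> e s. isgn e \<Longrightarrow> \<delta> = 1 \<or> \<delta> = - 1 \<Longrightarrow> Ac \<delta> e a (of_real s) * Ac \<delta> e b (of_real s) \<noteq> 0"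
proof -
  obtain d where d: "d > 0"
    "\<And>e \<delta> s. isgn e \<Longrightarrow> \<delta> = 1 \<or> \<delta> = - 1 \<Longrightarrow> d * (1 + \<bar>s\<bar> ^ k) \<le> norm (Ac \<delta> e a (of_real s))"
    "\<And>e \<delta> s. isgn e \<Longrightarrow> \<delta> = 1 \<or> \<delta> = - 1 \<Longrightarrow> d * (1 + \<bar>s\<bar> ^ k) \<le> norm (Ac \<delta> e b (of_real s))"
    using Ac_lower by blast
  \<comment> \<open>The summands dominate, in this order, the coefficients from \<open>fh\<close>,
    from the derivative of its numerator and from the derivatives of the two symbols.\<close>
  define D where "D = 1 / d\<^sup>2 + real k / d\<^sup>2 + 2 * real k / d ^ 3"
  have D: "D > 0" "1 / d\<^sup>2 \<le> D" "real (k - 1) / d\<^sup>2 \<le> D" "2 * real k / d ^ 3 \<le> D"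
  proof -
    have p: "0 < 1 / d\<^sup>2" "0 \<le> real k / d\<^sup>2" "0 \<le> 2 * real k / d ^ 3" "real (k - 1) / d\<^sup>2 \<le> real k / d\<^sup>2"
      using d(1) by (auto intro: divide_right_mono)
    then show "D > 0" "1 / d\<^sup>2 \<le> D" "real (k - 1) / d\<^sup>2 \<le> D" "2 * real k / d ^ 3 \<le> D"
      unfolding D_def by linarith+
  qed
  show ?thesis
  proof (rule that[OF D(1)])
    fix \<delta> e s :: real assume e: "isgn e" and \<delta>: "\<delta> = 1 \<or> \<delta> = - 1"
    have "0 < d * (1 + \<bar>s\<bar> ^ k)" using d(1) by (simp add: add_pos_nonneg)
    then show "Ac \<delta> e a (of_real s) * Ac \<delta> e b (of_real s) \<noteq> 0"
      using d(2)[OF e \<delta>, of s] d(3)[OF e \<delta>, of s] by (metis mult_eq_0_iff norm_zero not_le)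
  next
    fix \<delta> e s :: real assume e: "isgn e" and \<delta>: "\<delta> = 1 \<or> \<delta> = - 1" and s: "s > 0"
    define U where "U = 1 + s ^ k"
    define x where "x = norm (Ac \<delta> e a (of_real s))"
    define y where "y = norm (Ac \<delta> e b (of_real s))"
    have U: "U > 0" using s by (simp add: U_def add_pos_nonneg)
    have x: "d * U \<le> x" and y: "d * U \<le> y"
      using d(2)[OF e \<delta>, of s] d(3)[OF e \<delta>, of s] s by (simp_all add: U_def x_def y_def)
    have dU: "0 < d * U" using d(1) U by simp
    have xy0: "x > 0" "y > 0" using x y dU by linarith+
    have xy: "(d * U) * (d * U) \<le> x * y" using x y dU by (intro mult_mono) auto
    have xxy: "(d * U) * ((d * U) * (d * U)) \<le> x * (x * y)" "(d * U) * ((d * U) * (d * U)) \<le> y * (x * y)"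
      using x y xy dU xy0 by (intro mult_mono; simp)+
    have "norm (fh \<delta> e s) = s ^ (k - 1) / (x * y)"
      using s by (simp add: fh_def norm_divide norm_mult norm_power x_def y_def)
    also have "\<dots> \<le> s ^ (k - 1) / ((d * U) * (d * U))"
      using s xy dU by (intro divide_left_mono) (auto simp: xy0)
    also have "\<dots> = 1 / d\<^sup>2 * (s ^ (k - 1) / U\<^sup>2)" by (simp add: power2_eq_square mult_ac)
    also have "\<dots> \<le> D * (s ^ (k - 1) / U\<^sup>2)" using s by (intro mult_right_mono D) auto
    finally show "norm (fh \<delta> e s) \<le> D * (s ^ (k - 1) / (1 + s ^ k)\<^sup>2)" by (simp add: U_def)
    \<comment> \<open>For \<open>k = 1\<close> the truncated exponent \<open>k - 2\<close> is 0, and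
      the coefficient \<open>real (k - 1)\<close> vanishes.\<close>
    define P where "P = real (k - 1) * s ^ (k - 2)"
    define q where "q = s ^ (k - 1) * (real k * s ^ (k - 1))"
    have Pq: "P \<ge> 0" "q \<ge> 0" using s by (auto simp: P_def q_def)
    have \<delta>n: "\<bar>\<delta>\<bar> = 1" using \<delta> by auto
    have "norm (fh' \<delta> e s) \<le> (P * (x * y) + (q * y + q * x)) / ((x * y) * (x * y))"
    proof -
      have n1: "norm (of_nat (k - 1) * complex_of_real s ^ (k - 1 - 1) * (Ac \<delta> e a (of_real s) * Ac \<delta> e b (of_real s))) = P * (x * y)"
        using s by (simp add: norm_mult norm_power P_def x_def y_def numeral_2_eq_2)
      have n2: "norm (complex_of_real s ^ (k - 1) * (of_nat k * (of_real \<delta> * of_real s) ^ (k - 1) * of_real \<delta> * Ac \<delta> e b (of_real s)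
         + of_nat k * (of_real \<delta> * of_real s) ^ (k - 1) * of_real \<delta> * Ac \<delta> e a (of_real s))) \<le> q * y + q * x"
      proof -
        have "norm (complex_of_real s ^ (k - 1) * (of_nat k * (of_real \<delta> * of_real s) ^ (k - 1) * of_real \<delta> * Ac \<delta> e b (of_real s)
         + of_nat k * (of_real \<delta> * of_real s) ^ (k - 1) * of_real \<delta> * Ac \<delta> e a (of_real s)))
          \<le> s ^ (k - 1) * (norm (of_nat k * (complex_of_real \<delta> * of_real s) ^ (k - 1) * of_real \<delta> * Ac \<delta> e b (of_real s))
         + norm (of_nat k * (complex_of_real \<delta> * of_real s) ^ (k - 1) * of_real \<delta> * Ac \<delta> e a (of_real s)))"
          using s by (subst norm_mult) (auto simp: norm_power intro!: mult_left_mono norm_triangle_ineq)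
        also have "\<dots> = q * y + q * x"
          using s \<delta>n by (simp add: norm_mult norm_power q_def x_def y_def algebra_simps power_mult_distrib)
        finally show ?thesis .
      qed
      have "norm (fh' \<delta> e s) = norm (of_nat (k - 1) * of_real s ^ (k - 1 - 1) * (Ac \<delta> e a (of_real s) * Ac \<delta> e b (of_real s))
     - of_real s ^ (k - 1) * (of_nat k * (of_real \<delta> * of_real s) ^ (k - 1) * of_real \<delta> * Ac \<delta> e b (of_real s)
         + of_nat k * (of_real \<delta> * of_real s) ^ (k - 1) * of_real \<delta> * Ac \<delta> e a (of_real s))) / ((x * y) * (x * y))"
        unfolding fh'_def norm_divide by (simp only: norm_mult x_def y_def)
      also have "\<dots> \<le> (P * (x * y) + (q * y + q * x)) / ((x * y) * (x * y))"
        using xy0 by (intro divide_right_mono order_trans[OF norm_triangle_ineq4] add_mono n2 eq_refl[OF n1]) auto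
      finally show ?thesis .
    qed
    also have "\<dots> = P / (x * y) + (q / (x * (x * y)) + q / (y * (x * y)))"
      using xy0 by (simp add: field_simps)
    also have "\<dots> \<le> P / ((d * U) * (d * U)) + (q / ((d * U) * ((d * U) * (d * U))) + q / ((d * U) * ((d * U) * (d * U))))"
      using Pq xy xxy dU xy0 by (intro add_mono divide_left_mono) auto
    also have "\<dots> = real (k - 1) / d\<^sup>2 * (s ^ (k - 2) / U\<^sup>2) + 2 * real k / d ^ 3 * (s ^ (k - 1) / U\<^sup>2) * (s ^ (k - 1) / U)"
      by (simp add: P_def q_def power2_eq_square power3_eq_cube mult_ac)
    also have "\<dots> \<le> D * (s ^ (k - 2) / U\<^sup>2) + D * (s ^ (k - 1) / U\<^sup>2)"
    proof (intro add_mono)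
      show "real (k - 1) / d\<^sup>2 * (s ^ (k - 2) / U\<^sup>2) \<le> D * (s ^ (k - 2) / U\<^sup>2)"
        using s by (intro mult_right_mono D) auto
      have "s ^ (k - 1) / U \<le> 1" using power_pred_le[OF s] U by (simp add: U_def)
      then have "2 * real k / d ^ 3 * (s ^ (k - 1) / U\<^sup>2) * (s ^ (k - 1) / U) \<le> 2 * real k / d ^ 3 * (s ^ (k - 1) / U\<^sup>2)"
        using s d(1) U by (intro mult_left_le) auto
      also have "\<dots> \<le> D * (s ^ (k - 1) / U\<^sup>2)" using s by (intro mult_right_mono D) auto
      finally show "2 * real k / d ^ 3 * (s ^ (k - 1) / U\<^sup>2) * (s ^ (k - 1) / U) \<le> D * (s ^ (k - 1) / U\<^sup>2)" .
    qed
    finally show "norm (fh' \<delta> e s) \<le> D * (s ^ (k - 2) / (1 + s ^ k)\<^sup>2) + D * (s ^ (k - 1) / (1 + s ^ k)\<^sup>2)"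
      by (simp add: U_def)
  qed
qed

definition H :: "real \<Rightarrow> real \<Rightarrow> real \<Rightarrow> complex" where
  "H \<delta> e t = integral\<^sup>L lborel (\<lambda>s. indicator {0<..} s *\<^sub>R (cis (- 2 * pi * t * s) * fh \<delta> e s))"

lemma Ac_measurable [measurable]: "(\<lambda>s. Ac \<delta> e c (of_real s)) \<in> borel_measurable borel"
  unfolding Ac_def by measurable

lemma fh_measurable [measurable]: "fh \<delta> e \<in> borel_measurable borel" "fh' \<delta> e \<in> borel_measurable borel"
  unfolding fh_def[abs_def] fh'_def[abs_def] by measurable

text \<open>Two complementary bounds: the moment of order one half gives Hoelder continuity at 0,
  and integration by parts gives decay like \<open>1 / t\<close>.\<close>

lemma H_bounds:
  assumes e: "isgn e" and \<delta>: "\<delta> = 1 \<or> \<delta> = - 1"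
  obtains C where "C \<ge> 0" "\<And>t. norm (H \<delta> e t - H \<delta> e 0) \<le> C * sqrt \<bar>t\<bar>" "\<And>t. \<bar>t\<bar> * norm (H \<delta> e t) \<le> C"
    "\<And>t. integrable lborel (\<lambda>s. indicator {0<..} s *\<^sub>R (cis (- 2 * pi * t * s) * fh \<delta> e s))"
proof -
  obtain D where D: "D > 0" "\<And>s. s > 0 \<Longrightarrow> norm (fh \<delta> e s) \<le> D * (s ^ (k - 1) / (1 + s ^ k)\<^sup>2)"
    "\<And>s. s > 0 \<Longrightarrow> norm (fh' \<delta> e s) \<le> D * (s ^ (k - 2) / (1 + s ^ k)\<^sup>2) + D * (s ^ (k - 1) / (1 + s ^ k)\<^sup>2)"
    and nz: "\<And>s. Ac \<delta> e a (of_real s) * Ac \<delta> e b (of_real s) \<noteq> 0"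
    using fh_le e \<delta> by metis
  have i1: "integrable lborel (\<lambda>s. indicator {0<..} s * (s ^ (k - 1) / (1 + s ^ k)\<^sup>2) :: real)"
    and i2: "integrable lborel (\<lambda>s. indicator {0<..} s * (s ^ (k - 2) / (1 + s ^ k)\<^sup>2) :: real)"
    using k1 by (intro power_integrable; simp)+
  have fi: "integrable lborel (\<lambda>s. indicator {0<..} s *\<^sub>R fh \<delta> e s)"
  proof (rule Bochner_Integration.integrable_bound[OF integrable_mult_right[OF i1, of D]])
    show "AE s in lborel. norm (indicator {0<..} s *\<^sub>R fh \<delta> e s) \<le> norm (D * (indicator {0<..} s * (s ^ (k - 1) / (1 + s ^ k)\<^sup>2)))"
      using order_trans[OF D(2) abs_ge_self] by (intro AE_I2) (simp add: indicator_def)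
  qed measurable
  have f'i: "integrable lborel (\<lambda>s. indicator {0<..} s *\<^sub>R fh' \<delta> e s)"
  proof (rule Bochner_Integration.integrable_bound)
    show "integrable lborel (\<lambda>s. D * (indicator {0<..} s * (s ^ (k - 2) / (1 + s ^ k)\<^sup>2)) + D * (indicator {0<..} s * (s ^ (k - 1) / (1 + s ^ k)\<^sup>2)))"
      by (intro Bochner_Integration.integrable_add integrable_mult_right i1 i2)
    show "AE s in lborel. norm (indicator {0<..} s *\<^sub>R fh' \<delta> e s) \<le> norm (D * (indicator {0<..} s * (s ^ (k - 2) / (1 + s ^ k)\<^sup>2)) + D * (indicator {0<..} s * (s ^ (k - 1) / (1 + s ^ k)\<^sup>2)))"
      using order_trans[OF D(3) abs_ge_self] by (intro AE_I2) (simp add: indicator_def)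
  qed measurable
  have Hi: "integrable lborel (\<lambda>s. indicator {0<..} s *\<^sub>R (cis (- 2 * pi * t * s) * fh \<delta> e s))" for t
    by (rule Bochner_Integration.integrable_bound[OF fi]) (auto simp: norm_mult indicator_def)
  define B where "B = norm (fh \<delta> e 0) + integral\<^sup>L lborel (\<lambda>s. norm (indicator {0<..} s *\<^sub>R fh' \<delta> e s))"
  have B0: "B \<ge> 0" unfolding B_def by (intro add_nonneg_nonneg integral_nonneg_AE) auto
  have b2: "\<bar>t\<bar> * norm (H \<delta> e t) \<le> B" for t
  proof -
    have der: "(fh \<delta> e has_vector_derivative fh' \<delta> e s) (at s)" for s
    proof -
      have dA: "(Ac \<delta> e c has_field_derivative of_nat k * (of_real \<delta> * z) ^ (k - 1) * of_real \<delta>) (at z)" for c z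
        unfolding Ac_def[abs_def] by (auto intro!: derivative_eq_intros)
      have dN: "((\<lambda>z. z ^ (k - 1)) has_field_derivative of_nat (k - 1) * z ^ (k - 1 - 1)) (at z)" for z :: complex
        by (auto intro!: derivative_eq_intros)
      have "((\<lambda>z. z ^ (k - 1) / (Ac \<delta> e a z * Ac \<delta> e b z)) has_field_derivative fh' \<delta> e s) (at (of_real s))"
        unfolding fh'_def by (rule DERIV_divide[OF dN DERIV_mult[OF dA dA] nz])
      from has_vector_derivative_real_field[OF this] show ?thesis by (simp add: fh_def[abs_def])
    qed
    have cont: "isCont (fh' \<delta> e) s" for s
    proof -
      have cA: "isCont (\<lambda>s. Ac \<delta> e c (of_real s)) s" for c
        unfolding Ac_def by (intro continuous_intros)
      show ?thesis unfolding fh'_def[abs_def] using nz[of s] by (intro continuous_intros cA) auto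
    qed
    have l0: "(fh \<delta> e \<longlongrightarrow> fh \<delta> e 0) (at_right 0)"
      using has_vector_derivative_continuous[OF der[of 0]] by (auto simp: isCont_def intro: tendsto_mono[OF at_le])
    have li: "(fh \<delta> e \<longlongrightarrow> 0) at_top"
    proof (rule Lim_null_comparison)
      show "\<forall>\<^sub>F s in at_top. norm (fh \<delta> e s) \<le> D * (1 / s)"
        using eventually_ge_at_top[of 1]
      proof eventually_elim
        case (elim s)
        then have s: "s > 0" by simp
        have U: "s \<le> 1 + s ^ k" using self_le_power[of s k] elim k1 by simp
        have "s ^ (k - 1) / (1 + s ^ k)\<^sup>2 \<le> (1 + s ^ k) / (1 + s ^ k)\<^sup>2"
          using power_pred_le[OF s] by (intro divide_right_mono) auto
        also have "\<dots> = 1 / (1 + s ^ k)" using U s by (simp add: power2_eq_square)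
        also have "\<dots> \<le> 1 / s" using U s by (intro divide_left_mono) auto
        finally have "D * (s ^ (k - 1) / (1 + s ^ k)\<^sup>2) \<le> D * (1 / s)" using D(1) by (intro mult_left_mono) auto
        then show ?case using D(2)[OF s] by linarith
      qed
      show "((\<lambda>s. D * (1 / s)) \<longlongrightarrow> 0) at_top" by real_asymp
    qed
    have "2 * pi * \<bar>t\<bar> * norm (H \<delta> e t) \<le> B"
      unfolding H_def B_def by (rule oscillatory_half_line[OF der cont fi f'i l0 li])
    moreover have "1 * (\<bar>t\<bar> * norm (H \<delta> e t)) \<le> (2 * pi) * (\<bar>t\<bar> * norm (H \<delta> e t))"
      by (intro mult_right_mono) (use pi_ge_two in auto)
    ultimately show ?thesis by (simp add: mult.assoc)
  qed
  define I where "I = integral\<^sup>L lborel (\<lambda>s. indicator {0<..} s * (sqrt s * (s ^ (k - 1) / (1 + s ^ k)\<^sup>2)) :: real)"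
  define S where "S = sqrt (4 * pi) * D * I"
  have "I \<ge> 0" unfolding I_def by (intro integral_nonneg_AE AE_I2) (auto simp: indicator_def)
  then have S0: "S \<ge> 0" unfolding S_def using D(1) by (intro mult_nonneg_nonneg) auto
  have b1: "norm (H \<delta> e t - H \<delta> e 0) \<le> S * sqrt \<bar>t\<bar>" for t
  proof -
    have diff: "H \<delta> e t - H \<delta> e 0 = integral\<^sup>L lborel (\<lambda>s. indicator {0<..} s *\<^sub>R (cis (- 2 * pi * t * s) * fh \<delta> e s) - indicator {0<..} s *\<^sub>R (cis (- 2 * pi * 0 * s) * fh \<delta> e s))"
      unfolding H_def by (rule Bochner_Integration.integral_diff[symmetric]) (rule Hi)+
    have "norm (H \<delta> e t - H \<delta> e 0) \<le> integral\<^sup>L lborel (\<lambda>s. (sqrt (4 * pi) * D * sqrt \<bar>t\<bar>) * (indicator {0<..} s * (sqrt s * (s ^ (k - 1) / (1 + s ^ k)\<^sup>2))))"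
      unfolding diff
    proof (rule order_trans[OF integral_norm_bound integral_mono])
      show "integrable lborel (\<lambda>s. norm (indicator {0<..} s *\<^sub>R (cis (- 2 * pi * t * s) * fh \<delta> e s) - indicator {0<..} s *\<^sub>R (cis (- 2 * pi * 0 * s) * fh \<delta> e s)))"
        by (intro integrable_norm Bochner_Integration.integrable_diff Hi)
      show "integrable lborel (\<lambda>s. (sqrt (4 * pi) * D * sqrt \<bar>t\<bar>) * (indicator {0<..} s * (sqrt s * (s ^ (k - 1) / (1 + s ^ k)\<^sup>2))))"
        by (rule integrable_mult_right[OF sqrt_power_integrable])
      fix s :: real
      show "norm (indicator {0<..} s *\<^sub>R (cis (- 2 * pi * t * s) * fh \<delta> e s) - indicator {0<..} s *\<^sub>R (cis (- 2 * pi * 0 * s) * fh \<delta> e s))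
        \<le> (sqrt (4 * pi) * D * sqrt \<bar>t\<bar>) * (indicator {0<..} s * (sqrt s * (s ^ (k - 1) / (1 + s ^ k)\<^sup>2)))"
      proof (cases "s > 0")
        case True
        have "norm (indicator {0<..} s *\<^sub>R (cis (- 2 * pi * t * s) * fh \<delta> e s) - indicator {0<..} s *\<^sub>R (cis (- 2 * pi * 0 * s) * fh \<delta> e s))
          = norm (cis (- 2 * pi * t * s) - 1) * norm (fh \<delta> e s)"
          using True by (simp add: norm_mult[symmetric] left_diff_distrib)
        also have "\<dots> \<le> sqrt (2 * \<bar>- 2 * pi * t * s\<bar>) * (D * (s ^ (k - 1) / (1 + s ^ k)\<^sup>2))"
          by (intro mult_mono norm_cis_minus_one D True) auto
        also have "sqrt (2 * \<bar>- 2 * pi * t * s\<bar>) = sqrt (4 * pi) * sqrt \<bar>t\<bar> * sqrt s"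
          using True by (simp add: abs_mult real_sqrt_mult[symmetric] del: real_sqrt_mult)
        finally show ?thesis using True by (simp add: mult_ac)
      qed simp
    qed
    also have "\<dots> = (sqrt (4 * pi) * D * sqrt \<bar>t\<bar>) * I" unfolding I_def by (rule integral_mult_right_zero)
    also have "\<dots> = S * sqrt \<bar>t\<bar>" by (simp add: S_def)
    finally show ?thesis .
  qed
  show ?thesis
  proof (rule that[of "B + S"])
    show "B + S \<ge> 0" using B0 S0 by simp
    show "norm (H \<delta> e t - H \<delta> e 0) \<le> (B + S) * sqrt \<bar>t\<bar>" for t
      using b1[of t] B0 by (simp add: distrib_right add_increasing)
    show "\<bar>t\<bar> * norm (H \<delta> e t) \<le> B + S" for t using b2[of t] S0 by linarith
  qed (rule Hi)
qed

text \<open>The Fourier transform, in the first variable, of the symbol on the line with sign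
  \<open>e\<close>. Its value at 0 is the integral of the symbol, so the values for the two lines
  add up to \<open>cval\<close>.\<close>

definition M :: "real \<Rightarrow> real \<Rightarrow> complex" where
  "M e t = integral\<^sup>L lborel (\<lambda>s. cis (- 2 * pi * t * s) * msym k \<alpha> a b e s)"

lemma M_eq_H:
  assumes e: "isgn e"
  shows "M e t = H 1 e t + H (- 1) e (- t)"
proof -
  have p: "indicator {0<..} s *\<^sub>R (cis (- 2 * pi * t * s) * msym k \<alpha> a b e s) = indicator {0<..} s *\<^sub>R (cis (- 2 * pi * t * s) * fh 1 e s)" for s
    using fh_msym[of s 1 e] by (auto simp: indicator_def)
  have m: "indicator {0<..} s *\<^sub>R (cis (- 2 * pi * t * (- s)) * msym k \<alpha> a b e (- s)) = indicator {0<..} s *\<^sub>R (cis (- 2 * pi * (- t) * s) * fh (- 1) e s)" for s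
    using fh_msym[of s "- 1" e] by (auto simp: indicator_def)
  obtain i1: "\<And>t. integrable lborel (\<lambda>s. indicator {0<..} s *\<^sub>R (cis (- 2 * pi * t * s) * fh 1 e s))"
    using H_bounds[OF e disjI1[OF refl]] by metis
  obtain i2: "\<And>t. integrable lborel (\<lambda>s. indicator {0<..} s *\<^sub>R (cis (- 2 * pi * t * s) * fh (- 1) e s))"
    using H_bounds[OF e disjI2[OF refl]] by metis
  have "M e t = integral\<^sup>L lborel (\<lambda>s. indicator {0<..} s *\<^sub>R (cis (- 2 * pi * t * s) * msym k \<alpha> a b e s))
     + integral\<^sup>L lborel (\<lambda>s. indicator {0<..} s *\<^sub>R (cis (- 2 * pi * t * (- s)) * msym k \<alpha> a b e (- s)))"
    unfolding M_def
  proof (rule split_line(2))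
    show "integrable lborel (\<lambda>s. indicator {0<..} s *\<^sub>R (cis (- 2 * pi * t * s) * msym k \<alpha> a b e s))"
      unfolding p by (rule i1)
    show "integrable lborel (\<lambda>s. indicator {0<..} s *\<^sub>R (cis (- 2 * pi * t * (- s)) * msym k \<alpha> a b e (- s)))"
      unfolding m by (rule i2)
  qed measurable
  then show ?thesis unfolding p m H_def .
qed

lemma M_bounds:
  obtains C where "C \<ge> 0" "\<And>e t. isgn e \<Longrightarrow> norm (M e t - M e 0) \<le> C * sqrt \<bar>t\<bar>" "\<And>e t. isgn e \<Longrightarrow> \<bar>t\<bar> * norm (M e t) \<le> C"
proof -
  have "\<exists>C\<ge>0. (\<forall>t. norm (M e t - M e 0) \<le> C * sqrt \<bar>t\<bar>) \<and> (\<forall>t. \<bar>t\<bar> * norm (M e t) \<le> C)" if e: "isgn e" for e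
  proof -
    obtain C1 where C1: "C1 \<ge> 0" "\<And>t. norm (H 1 e t - H 1 e 0) \<le> C1 * sqrt \<bar>t\<bar>" "\<And>t. \<bar>t\<bar> * norm (H 1 e t) \<le> C1"
      using H_bounds[OF e disjI1[OF refl]] by metis
    obtain C2 where C2: "C2 \<ge> 0" "\<And>t. norm (H (- 1) e t - H (- 1) e 0) \<le> C2 * sqrt \<bar>t\<bar>" "\<And>t. \<bar>t\<bar> * norm (H (- 1) e t) \<le> C2"
      using H_bounds[OF e disjI2[OF refl]] by metis
    have "norm (M e t - M e 0) \<le> (C1 + C2) * sqrt \<bar>t\<bar>" for t
    proof -
      have "M e t - M e 0 = (H 1 e t - H 1 e 0) + (H (- 1) e (- t) - H (- 1) e 0)" by (simp add: M_eq_H[OF e])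
      then show ?thesis using norm_triangle_ineq[of "H 1 e t - H 1 e 0" "H (- 1) e (- t) - H (- 1) e 0"] C1(2)[of t] C2(2)[of "- t"]
        by (simp add: distrib_right)
    qed
    moreover have "\<bar>t\<bar> * norm (M e t) \<le> C1 + C2" for t
    proof -
      have "\<bar>t\<bar> * norm (M e t) \<le> \<bar>t\<bar> * (norm (H 1 e t) + norm (H (- 1) e (- t)))"
        unfolding M_eq_H[OF e] by (intro mult_left_mono norm_triangle_ineq) auto
      then show ?thesis using C1(3)[of t] C2(3)[of "- t"] by (simp add: distrib_left)
    qed
    ultimately show ?thesis using C1(1) C2(1) by (intro exI[of _ "C1 + C2"]) auto
  qed
  from this[OF isgn_simps(1)] this[OF isgn_simps(2)] obtain C1 C2 where
    C1: "C1 \<ge> 0" "\<And>t. norm (M 1 t - M 1 0) \<le> C1 * sqrt \<bar>t\<bar>" "\<And>t. \<bar>t\<bar> * norm (M 1 t) \<le> C1" and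
    C2: "C2 \<ge> 0" "\<And>t. norm (M ((- 1) ^ l) t - M ((- 1) ^ l) 0) \<le> C2 * sqrt \<bar>t\<bar>" "\<And>t. \<bar>t\<bar> * norm (M ((- 1) ^ l) t) \<le> C2"
    by blast
  have mono: "C1 * sqrt \<bar>t\<bar> \<le> (C1 + C2) * sqrt \<bar>t\<bar>" "C2 * sqrt \<bar>t\<bar> \<le> (C1 + C2) * sqrt \<bar>t\<bar>" for t
    using C1(1) C2(1) by (intro mult_right_mono; simp)+
  show ?thesis
  proof (rule that[of "C1 + C2"])
    show "0 \<le> C1 + C2" using C1(1) C2(1) by simp
    fix e t assume "isgn e"
    then have e: "e = 1 \<or> e = (- 1) ^ l" by (simp add: isgn_def)
    have 1: "norm (M 1 t - M 1 0) \<le> (C1 + C2) * sqrt \<bar>t\<bar>"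
        "norm (M ((- 1) ^ l) t - M ((- 1) ^ l) 0) \<le> (C1 + C2) * sqrt \<bar>t\<bar>"
      by (rule order_trans[OF C1(2) mono(1)] order_trans[OF C2(2) mono(2)])+
    have 2: "\<bar>t\<bar> * norm (M 1 t) \<le> C1 + C2" "\<bar>t\<bar> * norm (M ((- 1) ^ l) t) \<le> C1 + C2"
      using C1(1) C2(1) C1(3)[of t] C2(3)[of t] by linarith+
    show "norm (M e t - M e 0) \<le> (C1 + C2) * sqrt \<bar>t\<bar>" using e 1 by metis
    show "\<bar>t\<bar> * norm (M e t) \<le> C1 + C2" using e 2 by metis
  qed
qed

text \<open>It is through this cancellation that the vanishing average enters the kernel
  bound.\<close>

lemma M_zero_sum: "M 1 0 + M ((- 1) ^ l) 0 = 0"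
  using c0 by (simp add: M_def cval_def)

end

section \<open>Truncations of the symbol and the kernel\<close>

lemma AE_snd_nonzero: "AE w in (lborel :: (real \<times> real) measure). snd w \<noteq> 0"
proof -
  have "emeasure (lborel \<Otimes>\<^sub>M lborel) ((UNIV :: real set) \<times> {0 :: real}) = emeasure lborel (UNIV :: real set) * emeasure lborel {0 :: real}"
    by (rule lborel.emeasure_pair_measure_Times) auto
  then have z: "emeasure lborel ((UNIV :: real set) \<times> {0 :: real}) = 0" by (simp add: lborel_prod)
  have "closed ((UNIV :: real set) \<times> {0 :: real})" by (intro closed_Times) auto
  then have "(UNIV :: real set) \<times> {0 :: real} \<in> null_sets lborel" using z by (intro null_setsI) auto
  then show ?thesis by (rule AE_I') auto
qed

context critical_pair
begin

lemma slice_norm: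
  assumes "y \<noteq> 0"
  shows "integrable lborel (\<lambda>x. symb (x, y))"
    and "integral\<^sup>L lborel (\<lambda>x. norm (symb (x, y))) = 1 / \<bar>y\<bar> * integral\<^sup>L lborel (\<lambda>s. norm (msym k \<alpha> a b (esgn y) s))"
proof -
  have r: "rad y > 0" by (rule rad_pos[OF assms])
  have e: "esgn y = 1 \<or> esgn y = (- 1) ^ l" by (simp add: esgn_def)
  have eq: "symb (rad y * s, y) = of_real (1 / \<bar>y\<bar> / rad y) * msym k \<alpha> a b (esgn y) s" for s
  proof -
    have "symb (rad y * s, y) = of_real (1 / rad y) * (of_real (rad y) * symb (rad y * s, y))"
      using r by simp
    then show ?thesis unfolding symb_slice[OF assms] by (simp add: mult_ac)
  qed
  have "integrable lborel (\<lambda>s. symb (0 + rad y * s, y))"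
    using msym_integrable[OF e] by (simp add: eq)
  then show "integrable lborel (\<lambda>x. symb (x, y))"
    using lborel_integrable_real_affine_iff[of "rad y" "\<lambda>x. symb (x, y)" 0] r by simp
  have "integral\<^sup>L lborel (\<lambda>x. norm (symb (x, y))) = \<bar>rad y\<bar> *\<^sub>R integral\<^sup>L lborel (\<lambda>s. norm (symb (0 + rad y * s, y)))"
    by (rule lborel_integral_real_affine) (use r in simp)
  also have "\<dots> = 1 / \<bar>y\<bar> * integral\<^sup>L lborel (\<lambda>s. norm (msym k \<alpha> a b (esgn y) s))"
  proof -
    have "norm (symb (0 + rad y * s, y)) = 1 / \<bar>y\<bar> / rad y * norm (msym k \<alpha> a b (esgn y) s)" for s
      using r by (simp add: eq norm_mult norm_divide)
    then have "integral\<^sup>L lborel (\<lambda>s. norm (symb (0 + rad y * s, y))) = 1 / \<bar>y\<bar> / rad y * integral\<^sup>L lborel (\<lambda>s. norm (msym k \<alpha> a b (esgn y) s))"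
      by (simp only: integral_mult_right_zero)
    then show ?thesis using r by simp
  qed
  finally show "integral\<^sup>L lborel (\<lambda>x. norm (symb (x, y))) = 1 / \<bar>y\<bar> * integral\<^sup>L lborel (\<lambda>s. norm (msym k \<alpha> a b (esgn y) s))" .
qed

text \<open>Cutting in the second variable is enough: a slice at height \<open>y \<noteq> 0\<close>
  is integrable with norm of order \<open>1 / abs y\<close>, so divergence occurs only for
  \<open>y\<close> near 0 and near infinity.\<close>

definition strip :: "real \<Rightarrow> real \<Rightarrow> (real \<times> real) set" where
  "strip r R = {w. r < \<bar>snd w\<bar> \<and> \<bar>snd w\<bar> < R}"

definition msymb :: "real \<Rightarrow> real \<Rightarrow> real \<times> real \<Rightarrow> complex" where
  "msymb r R w = indicator (strip r R) w *\<^sub>R symb w"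

lemma strip_sets [measurable]: "strip r R \<in> sets borel"
proof -
  have "open (strip r R)" unfolding strip_def by (intro open_Collect_conj open_Collect_less continuous_intros)
  then show ?thesis by simp
qed

lemma msymb_measurable [measurable]: "msymb r R \<in> borel_measurable borel"
  unfolding msymb_def[abs_def] by measurable

lemma msymb_integrable:
  assumes r: "r > 0"
  shows "integrable lborel (msymb r R)"
proof -
  \<comment> \<open>The variables are swapped because \<open>Fubini_integrable\<close> integrates
    over the second one first and the slices are taken at fixed \<open>y\<close>.\<close>
  define g where "g = (\<lambda>(y, x). msymb r R (x, y))"
  define N where "N = integral\<^sup>L lborel (\<lambda>s. norm (msym k \<alpha> a b 1 s)) + integral\<^sup>L lborel (\<lambda>s. norm (msym k \<alpha> a b ((- 1) ^ l) s))"
  have Np: "0 \<le> integral\<^sup>L lborel (\<lambda>s. norm (msym k \<alpha> a b e s))" for e by (intro integral_nonneg_AE) auto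
  have Ne: "integral\<^sup>L lborel (\<lambda>s. norm (msym k \<alpha> a b (esgn y) s)) \<le> N" for y
    using Np[of 1] Np[of "(- 1) ^ l"] by (simp add: N_def esgn_def)
  have meas: "msymb r R \<in> borel_measurable (lborel \<Otimes>\<^sub>M lborel)"
    by (simp add: lborel_prod)
  have gm: "g \<in> borel_measurable (lborel \<Otimes>\<^sub>M lborel)"
    unfolding g_def by (rule measurable_pair_swap[OF meas])
  have gn: "norm (g (y, x)) = (if r < \<bar>y\<bar> \<and> \<bar>y\<bar> < R then norm (symb (x, y)) else 0)" for x y
    by (simp add: g_def msymb_def strip_def indicator_def)
  have slice: "integral\<^sup>L lborel (\<lambda>x. norm (g (y, x))) \<le> indicator {- R..R} y * (N / r)"
    and slice0: "0 \<le> integral\<^sup>L lborel (\<lambda>x. norm (g (y, x)))" for y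
  proof -
    show "0 \<le> integral\<^sup>L lborel (\<lambda>x. norm (g (y, x)))" by (intro integral_nonneg_AE) auto
    show "integral\<^sup>L lborel (\<lambda>x. norm (g (y, x))) \<le> indicator {- R..R} y * (N / r)"
    proof (cases "r < \<bar>y\<bar> \<and> \<bar>y\<bar> < R")
      case True
      then have y: "y \<noteq> 0" using r by auto
      have "integral\<^sup>L lborel (\<lambda>x. norm (g (y, x))) = 1 / \<bar>y\<bar> * integral\<^sup>L lborel (\<lambda>s. norm (msym k \<alpha> a b (esgn y) s))"
        using True slice_norm(2)[OF y] by (simp add: gn)
      also have "\<dots> \<le> 1 / r * N" using True r Ne Np by (intro mult_mono divide_left_mono) auto
      finally have "integral\<^sup>L lborel (\<lambda>x. norm (g (y, x))) \<le> N / r" by simp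
      moreover have "y \<in> {- R..R}" using True by auto
      ultimately show ?thesis by simp
    next
      case False
      have "N \<ge> 0" using Np[of 1] Np[of "(- 1) ^ l"] by (simp add: N_def)
      moreover have "integral\<^sup>L lborel (\<lambda>x. norm (g (y, x))) = 0"
        unfolding gn if_not_P[OF False] by simp
      ultimately show ?thesis using r by (simp add: indicator_def)
    qed
  qed
  have "integrable (lborel \<Otimes>\<^sub>M lborel) g"
  proof (rule lborel_pair.Fubini_integrable[OF gm])
    show "integrable lborel (\<lambda>y. integral\<^sup>L lborel (\<lambda>x. norm (g (y, x))))"
    proof (rule Bochner_Integration.integrable_bound)
      show "integrable lborel (\<lambda>y. indicator {- R..R} y * (N / r) :: real)"
        by (intro integrable_mult_left integrable_real_indicator) (auto simp: emeasure_lborel_Icc_eq)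
      show "(\<lambda>y. integral\<^sup>L lborel (\<lambda>x. norm (g (y, x)))) \<in> borel_measurable lborel"
        by (rule lborel.borel_measurable_lebesgue_integral) (use gm in measurable)
      show "AE y in lborel. norm (integral\<^sup>L lborel (\<lambda>x. norm (g (y, x)))) \<le> norm (indicator {- R..R} y * (N / r))"
        using slice slice0 by (intro AE_I2) (metis abs_of_nonneg order_trans real_norm_def)
    qed
    show "AE y in lborel. integrable lborel (\<lambda>x. g (y, x))"
      using AE_lborel_singleton[of "0::real"]
    proof eventually_elim
      case (elim y)
      then show ?case using slice_norm(1)[OF elim] by (simp add: g_def msymb_def strip_def indicator_def)
    qed
  qed
  then have "integrable (lborel \<Otimes>\<^sub>M lborel) (msymb r R)"
    unfolding g_def by (rule iffD1[OF lborel_pair.integrable_product_swap_iff])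
  then show ?thesis by (simp add: lborel_prod)
qed

end

context sufficient_pair
begin

definition \<theta> :: real where "\<theta> = real l / real k"

lemma \<theta>_pos: "\<theta> > 0" using k1 l1 by (simp add: \<theta>_def)

text \<open>The joint contribution of the heights \<open>y\<close> and \<open>- y\<close> to the
  Fourier transform at \<open>(X, Y)\<close>. Rescaling a slice to its line turns the frequency
  \<open>X\<close> into \<open>X * y powr \<theta>\<close>.\<close>

definition Ker :: "real \<Rightarrow> real \<Rightarrow> real \<Rightarrow> complex" where
  "Ker X Y y = of_real (1 / y) * (cis (- 2 * pi * (y * Y)) * M 1 (X * y powr \<theta>) + cis (2 * pi * (y * Y)) * M ((- 1) ^ l) (X * y powr \<theta>))"

lemma fourier2_msymb:
  assumes r: "r > 0"
  shows "integrable lborel (\<lambda>y. indicator {r<..<R} y *\<^sub>R Ker X Y y)"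
    and "fourier2 (msymb r R) (X, Y) = integral\<^sup>L lborel (\<lambda>y. indicator {r<..<R} y *\<^sub>R Ker X Y y)"
proof -
  define F where "F y = integral\<^sup>L lborel (\<lambda>x. msymb r R (x, y) * fker (x, y) (X, Y))" for y
  have i: "integrable lborel (\<lambda>z. msymb r R z * fker z (X, Y))"
    by (rule integrable_fker[OF msymb_integrable[OF r]])
  then have i': "integrable (lborel \<Otimes>\<^sub>M lborel) (case_prod (\<lambda>x y. msymb r R (x, y) * fker (x, y) (X, Y)))"
    by (simp add: lborel_prod case_prod_unfold)
  have Fi: "integrable lborel F" unfolding F_def by (rule lborel_pair.integrable_snd[OF i'])
  have IF: "fourier2 (msymb r R) (X, Y) = integral\<^sup>L lborel F"
    unfolding F_def fourier2_eq using lborel_pair.integral_snd[OF i'] by (simp add: lborel_prod case_prod_unfold)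
  have Fy: "F y = (if r < \<bar>y\<bar> \<and> \<bar>y\<bar> < R then cis (- 2 * pi * (y * Y)) * (of_real (1 / \<bar>y\<bar>) * M (esgn y) (X * \<bar>y\<bar> powr \<theta>)) else 0)" for y
  proof (cases "r < \<bar>y\<bar> \<and> \<bar>y\<bar> < R")
    case True
    then have y: "y \<noteq> 0" using r by auto
    have "msymb r R (x, y) * fker (x, y) (X, Y) = cis (- 2 * pi * (y * Y)) * (cis (- 2 * pi * (x * X)) * symb (x, y))" for x
    proof -
      have "fker (x, y) (X, Y) = cis (- 2 * pi * (y * Y)) * cis (- 2 * pi * (x * X))"
        by (simp add: fker_def cis_mult algebra_simps)
      then show ?thesis using True by (simp add: msymb_def strip_def)
    qed
    then have "F y = cis (- 2 * pi * (y * Y)) * integral\<^sup>L lborel (\<lambda>x. cis (- 2 * pi * (x * X)) * symb (x, y))"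
      unfolding F_def by (simp only: integral_mult_right_zero)
    also have "integral\<^sup>L lborel (\<lambda>x. cis (- 2 * pi * (x * X)) * symb (x, y)) = of_real (1 / \<bar>y\<bar>) * M (esgn y) (X * \<bar>y\<bar> powr \<theta>)"
      unfolding slice_integral[OF y] M_def by (simp only: rad_def \<theta>_def mult_ac)
    finally show ?thesis using True by simp
  next
    case False
    then show ?thesis unfolding F_def by (auto simp: msymb_def strip_def)
  qed
  have Fm: "F \<in> borel_measurable borel" using Fi by auto
  have p: "integrable lborel (\<lambda>y. indicator {0<..} y *\<^sub>R F y)"
    using integrable_mult_indicator[OF _ Fi, of "{0<..}"] by simp
  have "integrable lborel (\<lambda>y. F (0 + (- 1) * y))" by (rule lborel_integrable_real_affine[OF Fi]) simp
  then have m: "integrable lborel (\<lambda>y. indicator {0<..} y *\<^sub>R F (- y))"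
    using integrable_mult_indicator[of "{0<..}" lborel "\<lambda>y. F (- y)"] by simp
  have eq: "indicator {0<..} y *\<^sub>R F y + indicator {0<..} y *\<^sub>R F (- y) = indicator {r<..<R} y *\<^sub>R Ker X Y y" for y
  proof (cases "y > 0")
    case True
    then show ?thesis unfolding Fy by (simp add: Ker_def esgn_def indicator_def algebra_simps)
  next
    case False
    then show ?thesis using r by (simp add: indicator_def)
  qed
  show "integrable lborel (\<lambda>y. indicator {r<..<R} y *\<^sub>R Ker X Y y)"
    using Bochner_Integration.integrable_add[OF p m] unfolding eq .
  show "fourier2 (msymb r R) (X, Y) = integral\<^sup>L lborel (\<lambda>y. indicator {r<..<R} y *\<^sub>R Ker X Y y)"
    unfolding IF split_line(2)[OF p m Fm] Bochner_Integration.integral_add[OF p m, symmetric] eq ..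
qed

text \<open>Replacing \<open>M e (X * y powr \<theta>)\<close> by \<open>M e 0\<close> where the argument is small costs an absolutely
  convergent scale-invariant integral. The remaining main terms for positive and negative frequencies
  combine, by \<open>M_zero_sum\<close>, to a truncated sine integral.\<close>
lemma kernel_bounded:
  obtains B where "B \<ge> 0" "\<And>r R w. r > 0 \<Longrightarrow> norm (fourier2 (msymb r R) w) \<le> B"
proof -
  obtain C where C: "C \<ge> 0" "\<And>e t. isgn e \<Longrightarrow> norm (M e t - M e 0) \<le> C * sqrt \<bar>t\<bar>" "\<And>e t. isgn e \<Longrightarrow> \<bar>t\<bar> * norm (M e t) \<le> C"
    using M_bounds by blast
  obtain S :: real where S: "S \<ge> 0" "\<And>c A B. 0 < A \<Longrightarrow> \<bar>integral\<^sup>L lborel (\<lambda>x. indicator {A<..<B} x * (sin (c * x) / x))\<bar> \<le> S"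
    by (rule sin_over_id_bounded) (rule that)
  define I where "I = integral\<^sup>L lborel (\<lambda>v. indicator {0<..} v * (bmin (v powr \<theta>) / v))"
  have b0: "bmin t \<ge> 0" if "t \<ge> 0" for t using that by (simp add: bmin_def)
  have I0: "I \<ge> 0" unfolding I_def by (intro integral_nonneg_AE AE_I2) (auto simp: indicator_def b0)
  \<comment> \<open>The error left after the main term is removed for arguments below 1; the two
    regimes match the two bounds of \<open>M_bounds\<close>.\<close>
  define N where "N e t = M e t - (if \<bar>t\<bar> < 1 then M e 0 else 0)" for e t
  have N: "norm (N e t) \<le> C * bmin \<bar>t\<bar>" if "isgn e" for e t
  proof (cases "\<bar>t\<bar> < 1")
    case True
    then show ?thesis using C(2)[OF that, of t] by (simp add: N_def bmin_def)
  next
    case False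
    then show ?thesis using C(3)[OF that, of t] by (simp add: N_def bmin_def field_simps)
  qed
  have main: "norm (fourier2 (msymb r R) (X, Y)) \<le> 2 * C * I + 2 * norm (M 1 0) * S" if r: "r > 0" for r R X Y
  proof -
    \<comment> \<open>For \<open>X \<noteq> 0\<close> the condition
      \<open>abs (X * y powr \<theta>) < 1\<close> is an upper bound on \<open>y\<close>, so the
      main term still lives on an interval; for \<open>X = 0\<close> it always holds.\<close>
    define R' where "R' = (if X = 0 then R else min R (\<bar>X\<bar> powr (- 1 / \<theta>)))"
    have R': "y < R' \<longleftrightarrow> y < R \<and> \<bar>X * y powr \<theta>\<bar> < 1" if "y > 0" for y
    proof (cases "X = 0")
      case False
      have "y < \<bar>X\<bar> powr (- 1 / \<theta>) \<longleftrightarrow> y powr \<theta> < (\<bar>X\<bar> powr (- 1 / \<theta>)) powr \<theta>"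
        using that \<theta>_pos by (meson less_eq_real_def linorder_not_le powr_ge_zero powr_less_mono2 powr_mono2)
      also have "(\<bar>X\<bar> powr (- 1 / \<theta>)) powr \<theta> = 1 / \<bar>X\<bar>"
      proof -
        have "(- 1 / \<theta>) * \<theta> = - 1" using \<theta>_pos by simp
        then show ?thesis unfolding powr_powr using False by (simp add: powr_minus_divide)
      qed
      also have "y powr \<theta> < 1 / \<bar>X\<bar> \<longleftrightarrow> \<bar>X * y powr \<theta>\<bar> < 1"
        using False by (simp add: abs_mult field_simps)
      finally show ?thesis using False by (simp add: R'_def)
    qed (simp add: R'_def)
    \<comment> \<open>The two main terms have opposite coefficients, so their exponentials combine
      to a sine.\<close>
    define T2 where "T2 y = (- 2 * \<i> * M 1 0) * of_real (indicator {r<..<R'} y * (sin (2 * pi * Y * y) / y))" for y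
    define T1 where "T1 y = indicator {r<..<R} y *\<^sub>R Ker X Y y - T2 y" for y
    have si: "integrable lborel (\<lambda>y. indicator {r<..<R'} y * (sin (2 * pi * Y * y) / y))"
    proof (rule Bochner_Integration.integrable_bound)
      show "integrable lborel (\<lambda>y. indicator {r<..<R'} y * (1 / r) :: real)"
        by (intro integrable_mult_left integrable_real_indicator emeasure_bounded_finite) auto
      show "AE y in lborel. norm (indicator {r<..<R'} y * (sin (2 * pi * Y * y) / y)) \<le> norm (indicator {r<..<R'} y * (1 / r))"
      proof (intro AE_I2)
        fix y :: real
        show "norm (indicator {r<..<R'} y * (sin (2 * pi * Y * y) / y)) \<le> norm (indicator {r<..<R'} y * (1 / r))"
        proof (cases "y \<in> {r<..<R'}")
          case True
          have "\<bar>sin (2 * pi * Y * y)\<bar> / \<bar>y\<bar> \<le> 1 / r" using True r by (intro frac_le) auto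
          then show ?thesis using True r by simp
        qed simp
      qed
    qed measurable
    have T2i: "integrable lborel T2"
      unfolding T2_def[abs_def] by (intro integrable_mult_right integrable_of_real si)
    have T1i: "integrable lborel T1"
      unfolding T1_def[abs_def] by (intro Bochner_Integration.integrable_diff fourier2_msymb(1)[OF r] T2i)
    have T2n: "norm (integral\<^sup>L lborel T2) \<le> 2 * norm (M 1 0) * S"
    proof -
      have "integral\<^sup>L lborel T2 = (- 2 * \<i> * M 1 0) * of_real (integral\<^sup>L lborel (\<lambda>y. indicator {r<..<R'} y * (sin (2 * pi * Y * y) / y)))"
        unfolding T2_def[abs_def] by (simp only: integral_mult_right_zero integral_complex_of_real)
      then have "norm (integral\<^sup>L lborel T2) = 2 * norm (M 1 0) * \<bar>integral\<^sup>L lborel (\<lambda>y. indicator {r<..<R'} y * (sin (2 * pi * Y * y) / y))\<bar>"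
        by (simp only: norm_mult norm_of_real) simp
      then show ?thesis using S(2)[OF r, of R' "2 * pi * Y"] by (simp add: mult_left_mono)
    qed
    have T1_eq: "T1 y = indicator {r<..<R} y *\<^sub>R (of_real (1 / y) * (cis (- 2 * pi * (y * Y)) * N 1 (X * y powr \<theta>) + cis (2 * pi * (y * Y)) * N ((- 1) ^ l) (X * y powr \<theta>)))" for y
    proof (cases "y \<in> {r<..<R}")
      case True
      then have y: "y > 0" using r by simp
      have M0: "M ((- 1) ^ l) 0 = - M 1 0" using M_zero_sum by (simp add: add_eq_0_iff)
      have cs: "cis (- 2 * pi * (y * Y)) - cis (2 * pi * (y * Y)) = - 2 * \<i> * of_real (sin (2 * pi * Y * y))"
        by (simp add: complex_eq_iff mult_ac)
      show ?thesis
      proof (cases "\<bar>X * y powr \<theta>\<bar> < 1")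
        case small: True
        then have "y \<in> {r<..<R'}" using True R'[OF y] by simp
        then have "T2 y = of_real (1 / y) * ((cis (- 2 * pi * (y * Y)) - cis (2 * pi * (y * Y))) * M 1 0)"
          unfolding cs by (simp add: T2_def)
        then show ?thesis using True small unfolding T1_def Ker_def N_def M0
          by (simp add: algebra_simps)
      next
        case large: False
        then have "y \<notin> {r<..<R'}" using R'[OF y] by simp
        then have "T2 y = 0" by (simp add: T2_def)
        then show ?thesis using True large unfolding T1_def Ker_def N_def by simp
      qed
    next
      case False
      then have "y \<notin> {r<..<R'}" using R'[of y] r by auto
      then show ?thesis using False by (simp add: T1_def T2_def)
    qed
    have T1n: "norm (integral\<^sup>L lborel T1) \<le> 2 * C * I"
    proof (cases "X = 0")
      case True
      \<comment> \<open>Scaling \<open>bmin\<close> by \<open>X\<close> is impossible here, but the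
        error vanishes identically.\<close>
      have N0: "N e 0 = 0" for e by (simp add: N_def)
      have "T1 y = 0" for y unfolding T1_eq by (simp add: True N0)
      then have "T1 = (\<lambda>_. 0)" by (rule ext)
      then show ?thesis using C(1) I0 by simp
    next
      case False
      then have X: "\<bar>X\<bar> > 0" by simp
      have "norm (integral\<^sup>L lborel T1) \<le> integral\<^sup>L lborel (\<lambda>y. (2 * C) * (indicator {0<..} y * (bmin (\<bar>X\<bar> * y powr \<theta>) / y)))"
      proof (rule order_trans[OF integral_norm_bound integral_mono])
        show "integrable lborel (\<lambda>y. norm (T1 y))" using T1i by (rule integrable_norm)
        show "integrable lborel (\<lambda>y. (2 * C) * (indicator {0<..} y * (bmin (\<bar>X\<bar> * y powr \<theta>) / y)))"
          by (intro integrable_mult_right bmin_scaled(1) \<theta>_pos X)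
        fix y :: real
        show "norm (T1 y) \<le> (2 * C) * (indicator {0<..} y * (bmin (\<bar>X\<bar> * y powr \<theta>) / y))"
        proof (cases "y \<in> {r<..<R}")
          case True
          then have y: "y > 0" using r by simp
          let ?N1 = "N 1 (X * y powr \<theta>)" and ?N2 = "N ((- 1) ^ l) (X * y powr \<theta>)"
          have "norm (T1 y) = 1 / y * norm (cis (- 2 * pi * (y * Y)) * ?N1 + cis (2 * pi * (y * Y)) * ?N2)"
            unfolding T1_eq using True y by (simp add: norm_divide norm_mult)
          also have "\<dots> \<le> 1 / y * (norm ?N1 + norm ?N2)"
            using y norm_triangle_ineq[of "cis (- 2 * pi * (y * Y)) * ?N1" "cis (2 * pi * (y * Y)) * ?N2"]
            by (intro mult_left_mono) (auto simp: norm_mult)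
          also have "\<dots> \<le> 1 / y * (C * bmin (\<bar>X\<bar> * y powr \<theta>) + C * bmin (\<bar>X\<bar> * y powr \<theta>))"
            using y N[OF isgn_simps(1), of "X * y powr \<theta>"] N[OF isgn_simps(2), of "X * y powr \<theta>"]
            by (intro mult_left_mono add_mono) (auto simp: abs_mult)
          finally show ?thesis using y by simp
        next
          case False
          have "0 \<le> (2 * C) * (indicator {0<..} y * (bmin (\<bar>X\<bar> * y powr \<theta>) / y))"
            using C(1) b0[of "\<bar>X\<bar> * y powr \<theta>"] by (auto simp: indicator_def)
          then show ?thesis using False by (simp add: T1_eq)
        qed
      qed
      then show ?thesis
        unfolding integral_mult_right_zero bmin_scaled(2)[OF \<theta>_pos X] I_def .
    qed
    have "fourier2 (msymb r R) (X, Y) = integral\<^sup>L lborel (\<lambda>y. T1 y + T2 y)"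
      unfolding fourier2_msymb(2)[OF r] by (simp add: T1_def)
    also have "\<dots> = integral\<^sup>L lborel T1 + integral\<^sup>L lborel T2"
      by (rule Bochner_Integration.integral_add[OF T1i T2i])
    finally show ?thesis
      using norm_triangle_ineq[of "integral\<^sup>L lborel T1" "integral\<^sup>L lborel T2"] T1n T2n by simp
  qed
  show ?thesis
  proof (rule that[of "2 * C * I + 2 * norm (M 1 0) * S"])
    show "0 \<le> 2 * C * I + 2 * norm (M 1 0) * S" using C(1) I0 S(1) by simp
    show "norm (fourier2 (msymb r R) w) \<le> 2 * C * I + 2 * norm (M 1 0) * S" if "r > 0" for r R w
      using main[OF that, of R "fst w" "snd w"] by simp
  qed
qed

text \<open>With both transforms moved onto the multiplier, the form becomes the double integral of
  \<open>fourier2 (msymb r R) (z + v)\<close> against \<open>F z\<close> and \<open>G' v\<close>. A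
  bounded kernel then gives the product of the two norms.\<close>

lemma bilinear_bound:
  assumes F: "integrable lborel F" and G: "integrable lborel G" and r: "r > 0"
    and B: "\<And>w. norm (fourier2 (msymb r R) w) \<le> B"
  shows "norm (integral\<^sup>L lborel (\<lambda>w. msymb r R w * cnj (fourier2 G w) * fourier2 F w)) \<le> B * L1norm F * L1norm G"
proof -
  \<comment> \<open>Reflection combined with conjugation has the effect of conjugating the Fourier
    transform.\<close>
  define G' where "G' z = cnj (G (- z))" for z
  have neg: "- z = (0 + (- 1) * fst z, 0 + (- 1) * snd z)" for z :: "real \<times> real" by (cases z) simp
  have Gm [measurable]: "G \<in> borel_measurable borel" and Fm [measurable]: "F \<in> borel_measurable borel" using F G by auto
  have G'i: "integrable lborel G'"
    using plane_affine(2)[where f=G and a="- 1" and b="- 1" and s=0 and t=0, OF Gm _ _ G]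
    unfolding G'_def[abs_def] by (intro integrable_cnj) (simp add: neg)
  have G'1: "L1norm G' = L1norm G"
    unfolding L1norm_def G'_def
    by (subst plane_affine(1)[where f="\<lambda>z. norm (G z)" and a="- 1" and b="- 1" and s=0 and t=0]) (simp_all add: neg)
  have FG': "fourier2 G' w = cnj (fourier2 G w)" for w
  proof -
    have "fourier2 G' w = integral\<^sup>L lborel (\<lambda>z. cnj (G (- z) * fker (- z) w))"
      unfolding fourier2_eq G'_def by (simp add: cnj_fker)
    also have "\<dots> = cnj (integral\<^sup>L lborel (\<lambda>z. G (- z) * fker (- z) w))" by (rule Bochner_Integration.integral_cnj)
    also have "integral\<^sup>L lborel (\<lambda>z. G (- z) * fker (- z) w) = fourier2 G w"
      unfolding fourier2_eq
      by (subst plane_affine(1)[where f="\<lambda>z. G z * fker z w" and a="- 1" and b="- 1" and s=0 and t=0]) (simp_all add: neg)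
    finally show ?thesis .
  qed
  note mi = msymb_integrable[OF r, of R]
  have mG: "integrable lborel (\<lambda>w. msymb r R w * fourier2 G' w)" by (rule integrable_mult_fourier2[OF mi G'i])
  have bd: "norm (fourier2 (\<lambda>w. msymb r R w * fourier2 G' w) z) \<le> B * L1norm G" for z
  proof -
    have "fourier2 (\<lambda>w. msymb r R w * fourier2 G' w) z = integral\<^sup>L lborel (\<lambda>w. (msymb r R w * fker w z) * fourier2 G' w)"
      by (simp add: fourier2_eq mult_ac)
    also have "\<dots> = integral\<^sup>L lborel (\<lambda>v. fourier2 (\<lambda>w. msymb r R w * fker w z) v * G' v)"
      by (rule fourier2_multiplication[OF integrable_fker[OF mi] G'i])
    also have "(\<lambda>v. fourier2 (\<lambda>w. msymb r R w * fker w z) v * G' v) = (\<lambda>v. fourier2 (msymb r R) (z + v) * G' v)"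
      by (simp add: fourier2_eq fker_add mult.assoc)
    finally have e: "fourier2 (\<lambda>w. msymb r R w * fourier2 G' w) z = integral\<^sup>L lborel (\<lambda>v. fourier2 (msymb r R) (z + v) * G' v)" .
    have "norm (integral\<^sup>L lborel (\<lambda>v. fourier2 (msymb r R) (z + v) * G' v)) \<le> integral\<^sup>L lborel (\<lambda>v. B * norm (G' v))"
    proof (rule Bochner_Integration.integral_norm_bound_integral)
      show "integrable lborel (\<lambda>v. B * norm (G' v))" using G'i by simp
      have [measurable]: "(\<lambda>v. fourier2 (msymb r R) (z + v)) \<in> borel_measurable borel"
        by (rule measurable_compose[OF _ fourier2_borel[OF msymb_measurable]]) simp
      have [measurable]: "G' \<in> borel_measurable borel" using G'i by auto
      show le: "norm (fourier2 (msymb r R) (z + v) * G' v) \<le> B * norm (G' v)" for v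
        unfolding norm_mult by (intro mult_right_mono B) auto
      show "integrable lborel (\<lambda>v. fourier2 (msymb r R) (z + v) * G' v)"
        by (rule Bochner_Integration.integrable_bound[of lborel "\<lambda>v. B * norm (G' v)"])
          (use G'i order_trans[OF le abs_ge_self] in \<open>auto intro!: AE_I2\<close>)
    qed
    also have "\<dots> = B * L1norm G'" by (simp add: L1norm_def)
    also have "\<dots> = B * L1norm G" unfolding G'1 ..
    finally show ?thesis unfolding e .
  qed
  have "integral\<^sup>L lborel (\<lambda>w. msymb r R w * cnj (fourier2 G w) * fourier2 F w) = integral\<^sup>L lborel (\<lambda>z. fourier2 (\<lambda>w. msymb r R w * fourier2 G' w) z * F z)"
    unfolding FG'[symmetric] by (rule fourier2_multiplication[OF mG F])
  also have "norm \<dots> \<le> integral\<^sup>L lborel (\<lambda>z. (B * L1norm G) * norm (F z))"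
  proof (rule Bochner_Integration.integral_norm_bound_integral)
    show "integrable lborel (\<lambda>z. (B * L1norm G) * norm (F z))" using F by simp
    show le: "norm (fourier2 (\<lambda>w. msymb r R w * fourier2 G' w) z * F z) \<le> (B * L1norm G) * norm (F z)" for z
      unfolding norm_mult by (intro mult_right_mono bd) auto
    show "integrable lborel (\<lambda>z. fourier2 (\<lambda>w. msymb r R w * fourier2 G' w) z * F z)"
      using integrable_mult_fourier2[OF F mG] by (simp add: mult.commute)
  qed
  also have "\<dots> = B * L1norm F * L1norm G" by (simp add: L1norm_def)
  finally show ?thesis .
qed

text \<open>For Schwartz functions the full integrand \<open>h\<close> is integrable, so the form is
  the limit of its truncations by dominated convergence, and each truncation obeys the uniform
  kernel bound.\<close>

lemma sufficiency:
  assumes a: "a = tau1 k l \<tau>" and b: "b = sigma1 k l \<sigma>"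
  shows "BE k l \<alpha> \<beta> \<sigma> \<tau>"
proof -
  obtain B where B: "B \<ge> 0" "\<And>r R w. r > 0 \<Longrightarrow> norm (fourier2 (msymb r R) w) \<le> B"
    using kernel_bounded by blast
  have "norm (W2_inner \<alpha> \<beta> f g) \<le> B * L1norm (Lop k l \<tau> f) * L1norm (Lop k l \<sigma> g)" if f: "schwartz f" and g: "schwartz g" for f g
  proof -
    define h where "h w = fourier2 f w * cnj (fourier2 g w) * of_real (wght \<alpha> \<beta> w)" for w
    have hi: "integrable lborel h"
      unfolding h_def by (intro schwartz_product_integrable schwartz_fourier2 f g)
    have W: "W2_inner \<alpha> \<beta> f g = integral\<^sup>L lborel h"
      by (simp add: W2_inner_def h_def[abs_def] wght_def case_prod_unfold)
    let ?F = "Lop k l \<tau> f" and ?G = "Lop k l \<sigma> g"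
    have FGi: "integrable lborel ?F" "integrable lborel ?G" by (intro schwartz_integrable schwartz_Lop f g)+
    define P where "P = (2 * pi * \<i>) ^ k * cnj ((2 * pi * \<i>) ^ k)"
    have "P = complex_of_real ((2 * pi) ^ k * (2 * pi) ^ k)"
      unfolding P_def complex_norm_square[symmetric] by (simp add: norm_power norm_mult power2_eq_square)
    then have "norm P = (2 * pi) ^ k * (2 * pi) ^ k" by (simp only: norm_of_real) simp
    moreover have "1 \<le> (2 * pi) ^ k" using pi_ge_two by (intro one_le_power) linarith
    then have "1 * 1 \<le> (2 * pi) ^ k * (2 * pi) ^ k" by (intro mult_mono) auto
    ultimately have P1: "norm P \<ge> 1" by simp
    have eq: "msymb r R w * cnj (fourier2 ?G w) * fourier2 ?F w = P * (indicator (strip r R) w *\<^sub>R h w)" if "r > 0" for r R w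
    proof (cases "w \<in> strip r R")
      case True
      then have "w \<noteq> 0" using that by (auto simp: strip_def)
      then have nz: "psym k l a w \<noteq> 0" "psym k l b w \<noteq> 0" using psym_nonzero ella ellb by auto
      have "cnj (fourier2 ?G w) = cnj ((2 * pi * \<i>) ^ k) * psym k l b w * cnj (fourier2 g w)"
        unfolding fourier2_Lop[OF g] complex_cnj_mult Asym_eq_psym(2)[OF k1] b ..
      moreover have "fourier2 ?F w = (2 * pi * \<i>) ^ k * psym k l a w * fourier2 f w"
        unfolding fourier2_Lop[OF f] Asym_eq_psym(1)[OF k1] a ..
      ultimately show ?thesis using True nz
        by (simp only: msymb_def symb_def P_def h_def indicator_simps scaleR_one) (simp add: field_simps)
    qed (simp add: msymb_def)
    have bound: "norm (integral\<^sup>L lborel (\<lambda>w. indicator (strip r R) w *\<^sub>R h w)) \<le> B * L1norm ?F * L1norm ?G" if r: "r > 0" for r R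
    proof -
      have "norm P * norm (integral\<^sup>L lborel (\<lambda>w. indicator (strip r R) w *\<^sub>R h w)) \<le> B * L1norm ?F * L1norm ?G"
        using bilinear_bound[OF FGi r B(2)[OF r]] unfolding eq[OF r] integral_mult_right_zero norm_mult .
      moreover have "1 * norm (integral\<^sup>L lborel (\<lambda>w. indicator (strip r R) w *\<^sub>R h w)) \<le> norm P * norm (integral\<^sup>L lborel (\<lambda>w. indicator (strip r R) w *\<^sub>R h w))"
        by (intro mult_right_mono P1) auto
      ultimately show ?thesis by simp
    qed
    have hm [measurable]: "h \<in> borel_measurable borel" using hi by auto
    have lim: "(\<lambda>n. integral\<^sup>L lborel (\<lambda>w. indicator (strip (1 / real (Suc n)) (real (Suc n))) w *\<^sub>R h w)) \<longlonglongrightarrow> integral\<^sup>L lborel h"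
    proof (rule integral_dominated_convergence[where w="\<lambda>w. norm (h w)"])
      show "AE w in lborel. (\<lambda>n. indicator (strip (1 / real (Suc n)) (real (Suc n))) w *\<^sub>R h w) \<longlonglongrightarrow> h w"
        using AE_snd_nonzero
      proof eventually_elim
        case (elim w)
        have "(\<lambda>n. 1 / real (Suc n)) \<longlonglongrightarrow> 0" by real_asymp
        then have 1: "\<forall>\<^sub>F n in sequentially. 1 / real (Suc n) < \<bar>snd w\<bar>"
          using elim by (intro order_tendstoD(2)) auto
        have "filterlim (\<lambda>n. real (Suc n)) at_top sequentially" by real_asymp
        then have 2: "\<forall>\<^sub>F n in sequentially. \<bar>snd w\<bar> < real (Suc n)"
          by (simp add: filterlim_at_top_dense)
        from 1 2 have "\<forall>\<^sub>F n in sequentially. indicator (strip (1 / real (Suc n)) (real (Suc n))) w *\<^sub>R h w = h w"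
          by eventually_elim (simp add: strip_def)
        then show ?case by (rule tendsto_eventually)
      qed
      show "AE w in lborel. norm (indicator (strip (1 / real (Suc n)) (real (Suc n))) w *\<^sub>R h w) \<le> norm (h w)" for n
        by (intro AE_I2) (simp add: indicator_def)
    qed (use hi in auto)
    show ?thesis unfolding W
      by (rule tendsto_upperbound[OF tendsto_norm[OF lim]]) (auto intro!: always_eventually bound)
  qed
  then show ?thesis unfolding BE_def by blast
qed

end

theorem theorem1:
  fixes k l :: nat and \<alpha> \<beta> :: real and \<sigma> \<tau> :: complex
  assumes "k \<ge> 1" and "l \<ge> 1"
    and "\<alpha> \<ge> 0" and "\<beta> \<ge> 0"
    and "\<sigma> \<noteq> 0" and "\<tau> \<noteq> 0"
    and "elliptic k l \<sigma> \<tau>"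
  shows "BE k l \<alpha> \<beta> \<sigma> \<tau> \<longleftrightarrow>
           ((odd k \<or> odd l) \<and> \<alpha> = (real k - 1) / 2 \<and> \<beta> = (real l - 1) / 2 \<and>
            Im (sigma1 k l \<sigma>) \<noteq> 0 \<and> Im (tau1 k l \<tau>) \<noteq> 0 \<and>
            sgn (Im (sigma1 k l \<sigma>)) = sgn (Im (tau1 k l \<tau>)))"
proof -
  define a where "a = tau1 k l \<tau>"
  define b where "b = sigma1 k l \<sigma>"
  have nz: "a \<noteq> 0" "b \<noteq> 0" using assms(5,6) by (auto simp: a_def b_def tau1_def sigma1_def)
  have ella: "ell_coeff k l a" and ellb: "ell_coeff k l b"
    using assms(7) unfolding elliptic_def a_def[symmetric] b_def[symmetric]
    by (intro ell_coeffI assms(1,2) nz; simp add: psym_def)+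
  interpret elliptic_pair k l \<alpha> \<beta> a b
    by unfold_locales (use assms ella ellb in auto)
  show ?thesis
  proof
    assume BE: "BE k l \<alpha> \<beta> \<sigma> \<tau>"
    have crit: "(2 * \<alpha> + 1) / real k + (2 * \<beta> + 1) / real l = 2" and c: "cval k l \<alpha> a b = 0"
      by (rule necessity[OF BE a_def b_def])+
    \<comment> \<open>Together with \<open>\<beta> \<ge> 0\<close> the critical relation yields
      \<open>\<alpha>k\<close>, the convergence condition for the integrals in
      \<open>cval\<close>.\<close>
    interpret critical_pair k l \<alpha> \<beta> a b by unfold_locales (rule crit)
    have *: "(odd k \<or> odd l) \<and> \<alpha> = (real k - 1) / 2 \<and> Im a \<noteq> 0 \<and> Im b \<noteq> 0 \<and> sgn (Im a) = sgn (Im b)"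
      using cval_zero_iff[OF ella ellb assms(3) \<alpha>k] c by blast
    \<comment> \<open>The critical relation now determines \<open>\<beta>\<close> from
      \<open>\<alpha>\<close>.\<close>
    then have "2 * \<alpha> + 1 = real k" by (simp add: field_simps)
    then have "(2 * \<beta> + 1) / real l = 1" using crit assms(1) by simp
    then have "\<beta> = (real l - 1) / 2" using assms(2) by (simp add: field_simps)
    with * show "(odd k \<or> odd l) \<and> \<alpha> = (real k - 1) / 2 \<and> \<beta> = (real l - 1) / 2 \<and>
            Im (sigma1 k l \<sigma>) \<noteq> 0 \<and> Im (tau1 k l \<tau>) \<noteq> 0 \<and> sgn (Im (sigma1 k l \<sigma>)) = sgn (Im (tau1 k l \<tau>))"
      unfolding a_def b_def by metis
  next
    assume R: "(odd k \<or> odd l) \<and> \<alpha> = (real k - 1) / 2 \<and> \<beta> = (real l - 1) / 2 \<and>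
            Im (sigma1 k l \<sigma>) \<noteq> 0 \<and> Im (tau1 k l \<tau>) \<noteq> 0 \<and> sgn (Im (sigma1 k l \<sigma>)) = sgn (Im (tau1 k l \<tau>))"
    have "2 * \<alpha> + 1 = real k" using R by (simp add: field_simps)
    then have "2 * \<alpha> + 1 < 2 * real k" using assms(1) by simp
    then have "cval k l \<alpha> a b = 0"
      using cval_zero_iff[OF ella ellb assms(3)] R unfolding a_def b_def by metis
    moreover have "\<alpha> = (real k - 1) / 2" "\<beta> = (real l - 1) / 2" using R by blast+
    ultimately interpret sufficient_pair k l \<alpha> \<beta> a b
      by unfold_locales
    show "BE k l \<alpha> \<beta> \<sigma> \<tau>" by (rule sufficiency[OF a_def b_def])
  qed
qed

end
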